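(* Let $p,q,r\in[1,\infty]$ with $\frac1p+\frac1q=1+\frac1r$. Assume that for all $i,j=1,\dots,I$ the collision kernel has the form $\mathcal B_{ij}(x,y)=x^{\lambda_{ij}}b_{ij}(y)$ with $\lambda_{ij}\ge0$ and $b_{ij}\in L^1\big([-1,1];(1-s^2)^{\frac{N-3}2}\mathrm ds\big)$, and put $\lambda=\max_{1\le i,j\le I}\lambda_{ij}$. Then for $\mathbb F\in L^p_\lambda$ and $\mathbb G\in L^q_\lambda$, $$\|\mathbb Q^+(\mathbb F,\mathbb G)\|_{L^r_0}\le C^{\mathbb Q^+}_{p,q,r}\,\|\mathbb F\|_{L^p_\lambda}\|\mathbb G\|_{L^q_\lambda},$$ where, for $r\ne1$ and $r\neq\infty$, $$C^{\mathbb Q^+}_{p,q,r}=I^{\frac{r-1}r}\max_{1\le i,j\le I}\big(2^{\lambda_{ij}}M_{ij}C^{ij}_{p,q,r}\big),\qquad M_{ij}=\Big(\frac{\sum_{l=1}^Im_l}{m_i}\Big)^{\frac{\lambda_{ij}}2}+\Big(\frac{\sum_{l=1}^Im_l}{m_j}\Big)^{\frac{\lambda_{ij}}2},$$ $$C^{ij}_{p,q,r}=|\mathbb S^{N-2}|\left(\int_{-1}^1\big((1-r_{ij})^2(2-2s)\big)^{-\frac N{2r'}}\mathrm d\xi_N^{b_{ij}}(s)\right)^{\frac{r'}{q'}}\left(\int_{-1}^1\Big(r_{ij}(1-r_{ij})\big(\tfrac1{r_{ij}(1-r_{ij})}-2+2s\big)\Big)^{-\frac N{2r'}}\mathrm d\xi_N^{b_{ij}}(s)\right)^{\frac{r'}{p'}}.$$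 For $r=1$ (so $p=q=1$) the constant is $C^{\mathbb Q^+}_{1,1,1}=\max_{i,j}\big(2^{\lambda_{ij}}M_{ij}\|b_{ij}\|_{L^1(\mathbb S^{N-1};\mathrm d\sigma)}\big)$, and for $r=\infty$ (so $q=p'$) it is $C^{\mathbb Q^+}_{p,p',\infty}=\max_{i,j}\big(2^{\lambda_{ij}}M_{ij}C^{ij}_{p,p',\infty}\big)$ with $$C^{ij}_{p,p',\infty}=|\mathbb S^{N-2}|\left(\int_{-1}^1\big((1-r_{ij})^2(2-2s)\big)^{-\frac N2}\mathrm d\xi_N^{b_{ij}}(s)\right)^{\frac1p}\left(\int_{-1}^1\Big(r_{ij}(1-r_{ij})\big(\tfrac1{r_{ij}(1-r_{ij})}-2+2s\big)\Big)^{-\frac N2}\mathrm d\xi_N^{b_{ij}}(s)\right)^{\frac1{p'}}.$$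
   Context: $N\ge2$, $I\ge1$, masses $m_1,\dots,m_I>0$, $r_{ij}=\frac{m_i}{m_i+m_j}$; $p',q',r'$ are the conjugate exponents. For $v,v_*\in\mathbb R^N$, $\sigma\in\mathbb S^{N-1}$: $u=v-v_*$, $\hat u=u/|u|$, $v'=v+(1-r_{ij})(|u|\sigma-u)$, $v'_*=v_*-r_{ij}(|u|\sigma-u)$. The functions $b_{ij}\ge0$ on $[-1,1]$ are supported in $[0,1]$, and $\mathrm d\xi_N^{b_{ij}}(s)=b_{ij}(s)(1-s^2)^{\frac{N-3}2}\mathrm ds$; $\|b_{ij}\|_{L^1(\mathbb S^{N-1};\mathrm d\sigma)}=|\mathbb S^{N-2}|\int_{-1}^1\mathrm d\xi_N^{b_{ij}}$. For vectors of (nonnegative) distribution functions $\mathbb F=[f_i]_{1\le i\le I}$, $\mathbb G=[g_i]_{1\le i\le I}$, $$[\mathbb Q^+(\mathbb F,\mathbb G)]_i(v)=\sum_{j=1}^I\int_{\mathbb R^N}\int_{\mathbb S^{N-1}}f_i(v')g_j(v'_* )\mathcal B_{ij}(|u|,\hat u\cdot\sigma)\,\mathrm d\sigma\,\mathrm dv_*.$$ With $\langle v\rangle_i=\sqrt{1+\frac{m_i}{\sum_lm_l}|v|^2}$: $\|\mathbb F\|_{L^p_k}=\big(\sum_i\int(|f_i|\langle v\rangle_i^k)^p\mathrm dv\big)^{1/p}$ for $1\le p<\infty$, and $\|\mathbb F\|_{L^\infty_k}=\sum_i\operatorname{ess\,sup}_v|f_i(v)|\langle v\rangle_i^k$. Constants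 may be $+\infty$; a factor raised to the power $0$ (e.g. $r'/q'$ with $q'=\infty$) equals $1$.
   Formalization: For r=∞ and 1<p<∞ the constant is multiplied by I (the value of I^{(r-1)/r} at r=∞), since the printed bound without it fails for many species with equal data; all other cases are as stated. *)

theory Defs
  imports "HOL-Probability.Essential_Supremum"
begin

section \<open>Powers and conjugate exponents in the extended half-line\<close>

text \<open>
  Used for exponents \<open>a \<ge> 0\<close> only; \<open>\<infinity>\<^sup>0 = 0\<^sup>0 = 1\<close>.
\<close>

definition enn_powr :: "ennreal \<Rightarrow> real \<Rightarrow> ennreal" where
  "enn_powr x a = (if a = 0 then 1 else if x = \<infinity> then \<infinity> else ennreal (enn2real x powr a))"

text \<open>
  Exponents in \<open>[1,\<infinity>]\<close> are extended nonnegative reals, where \<open>1 / \<infinity> = 0\<close> and \<open>1 / 0 = \<infinity>\<close>.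
\<close>

definition conj_exp :: "ennreal \<Rightarrow> ennreal" where
  "conj_exp p = 1 / (1 - 1 / p)"

lemma conj_exp_1 [simp]: "conj_exp 1 = \<infinity>"
  by (simp add: conj_exp_def)

lemma conj_exp_infinity [simp]: "conj_exp \<infinity> = 1"
  by (simp add: conj_exp_def)

lemma conj_exp_conjugate: "1 \<le> p \<Longrightarrow> 1 / p + 1 / conj_exp p = 1"
proof -
  assume "1 \<le> p"
  have inv_inv: "inverse (inverse x) = x" for x :: ennreal
  proof (cases x)
    case (real a)
    then show ?thesis
      by (cases "a = 0") (auto simp: inverse_ennreal)
  qed simp
  from \<open>1 \<le> p\<close> have "1 / p \<le> 1"
    by (cases p) (auto simp: divide_ennreal ennreal_1[symmetric] simp del: ennreal_1)
  moreover have "1 / conj_exp p = 1 - 1 / p"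
    by (simp add: conj_exp_def divide_ennreal_def inv_inv)
  ultimately show ?thesis
    by (simp add: add_diff_inverse_ennreal)
qed

section \<open>Surface measure of the unit sphere\<close>

text \<open>
  The surface measure of a set \<open>A\<close> of unit vectors in dimension \<open>N\<close> is \<open>N\<close> times the volume
  of the cone \<open>{t x | x \<in> A, 0 < t < 1}\<close>, equivalently the measure for which integration in
  polar coordinates holds with Jacobian \<open>t\<^sup>N\<^sup>-\<^sup>1\<close>. It is realised as a Borel measure on the ambient
  space that is concentrated on \<open>sphere 0 1\<close>; the ball's centre, which \<^const>\<open>sgn\<close> sends
  to \<open>0\<close>, is a null set.
\<close>

definition sphere_measure :: "'a::euclidean_space measure" where
  "sphere_measure =
     scale_measure (of_nat DIM('a)) (distr (restrict_space lborel (ball 0 1)) borel sgn)"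

text \<open>
  Area of the \<open>d\<close>-dimensional unit sphere, in dimension \<open>d + 1\<close>. In particular it is \<open>2\<close> for
  \<open>d = 0\<close>, where the sphere consists of two points.
\<close>

definition sphere_area :: "nat \<Rightarrow> real" where
  "sphere_area d = real (d + 1) * unit_ball_vol (real (d + 1))"

lemma sphere_area_0: "sphere_area 0 = 2"
  by (simp add: sphere_area_def unit_ball_vol_1)

lemma emeasure_sphere_measure_UNIV:
  "emeasure (sphere_measure :: 'a::euclidean_space measure) UNIV = ennreal (sphere_area (DIM('a) - 1))"
proof -
  have [measurable]: "(sgn :: 'a \<Rightarrow> 'a) \<in> borel_measurable borel"
    by (simp add: sgn_div_norm)
  have "(sgn :: 'a \<Rightarrow> 'a) \<in> measurable (restrict_space lborel (ball 0 1)) borel"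
    by (intro measurable_restrict_space1) simp
  then have "emeasure (distr (restrict_space lborel (ball 0 1)) borel (sgn :: 'a \<Rightarrow> 'a)) UNIV =
      emeasure lborel (ball (0::'a) 1)"
    by (subst emeasure_distr) (auto simp: space_restrict_space emeasure_restrict_space)
  then show ?thesis
    by (simp add: sphere_measure_def sphere_area_def emeasure_ball ennreal_mult' ennreal_of_nat_eq_real_of_nat)
qed

section \<open>Collisions and the gain operator\<close>

definition mass_ratio :: "('i \<Rightarrow> real) \<Rightarrow> 'i \<Rightarrow> 'i \<Rightarrow> real" where
  "mass_ratio m i j = m i / (m i + m j)"

definition post_v :: "real \<Rightarrow> 'a::real_normed_vector \<Rightarrow> 'a \<Rightarrow> 'a \<Rightarrow> 'a" where
  "post_v \<rho> v vs \<sigma> = v + (1 - \<rho>) *\<^sub>R (norm (v - vs) *\<^sub>R \<sigma> - (v - vs))"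

definition post_vs :: "real \<Rightarrow> 'a::real_normed_vector \<Rightarrow> 'a \<Rightarrow> 'a \<Rightarrow> 'a" where
  "post_vs \<rho> v vs \<sigma> = vs - \<rho> *\<^sub>R (norm (v - vs) *\<^sub>R \<sigma> - (v - vs))"

text \<open>
  The distribution functions and the kernel are nonnegative, so the gain term is always
  defined as an element of \<open>[0,\<infinity>]\<close>; \<open>sgn (v - vs)\<close> is the direction of the relative velocity.
\<close>

definition gain :: "('i::finite \<Rightarrow> real) \<Rightarrow> ('i \<Rightarrow> 'i \<Rightarrow> real \<Rightarrow> real \<Rightarrow> real) \<Rightarrow>
    ('i \<Rightarrow> 'a::euclidean_space \<Rightarrow> real) \<Rightarrow> ('i \<Rightarrow> 'a \<Rightarrow> real) \<Rightarrow> 'i \<Rightarrow> 'a \<Rightarrow> ennreal" where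
  "gain m B F G i v =
     (\<Sum>j\<in>UNIV. \<integral>\<^sup>+vs. \<integral>\<^sup>+\<sigma>.
        ennreal (F i (post_v (mass_ratio m i j) v vs \<sigma>) * G j (post_vs (mass_ratio m i j) v vs \<sigma>)
          * B i j (norm (v - vs)) (sgn (v - vs) \<bullet> \<sigma>))
        \<partial>sphere_measure \<partial>lebesgue)"

section \<open>Weighted Lebesgue norms of vectors of functions\<close>

definition bracket :: "('i::finite \<Rightarrow> real) \<Rightarrow> 'i \<Rightarrow> 'a::real_normed_vector \<Rightarrow> real" where
  "bracket m i v = sqrt (1 + m i / (\<Sum>l\<in>UNIV. m l) * (norm v)\<^sup>2)"

text \<open>
  The norm is taken of the moduli \<open>H i v\<close>, which are \<open>[0,\<infinity>]\<close>-valued so that it also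
  applies to the gain operator.
\<close>

definition Lnorm :: "('i::finite \<Rightarrow> real) \<Rightarrow> ennreal \<Rightarrow> real \<Rightarrow>
    ('i \<Rightarrow> 'a::euclidean_space \<Rightarrow> ennreal) \<Rightarrow> ennreal" where
  "Lnorm m p k H =
     (if p = \<infinity> then \<Sum>i\<in>UNIV. esssup lebesgue (\<lambda>v. H i v * ennreal (bracket m i v powr k))
      else enn_powr
        (\<Sum>i\<in>UNIV. \<integral>\<^sup>+v. enn_powr (H i v * ennreal (bracket m i v powr k)) (enn2real p) \<partial>lebesgue)
        (1 / enn2real p))"

definition Lspace :: "('i::finite \<Rightarrow> real) \<Rightarrow> ennreal \<Rightarrow> real \<Rightarrow>
    ('i \<Rightarrow> 'a::euclidean_space \<Rightarrow> real) set" where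
  "Lspace m p k = {F. (\<forall>i. F i \<in> borel_measurable lebesgue) \<and>
                      Lnorm m p k (\<lambda>i v. ennreal \<bar>F i v\<bar>) < \<infinity>}"

section \<open>The constants\<close>

text \<open>
  The values \<open>0 powr a = 0\<close> at the endpoints \<open>s = 1\<close> and \<open>s = -1\<close>, here and in the
  integrands below, concern null sets only.
\<close>

definition xi_measure :: "nat \<Rightarrow> (real \<Rightarrow> real) \<Rightarrow> real measure" where
  "xi_measure N b =
     density lebesgue (\<lambda>s. ennreal (indicator {-1..1} s * (b s * (1 - s\<^sup>2) powr ((real N - 3) / 2))))"

definition minus_int :: "nat \<Rightarrow> (real \<Rightarrow> real) \<Rightarrow> real \<Rightarrow> real \<Rightarrow> ennreal" where
  "minus_int N b \<rho> a = (\<integral>\<^sup>+s. ennreal (((1 - \<rho>)\<^sup>2 * (2 - 2 * s)) powr (- a)) \<partial>xi_measure N b)"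

definition plus_int :: "nat \<Rightarrow> (real \<Rightarrow> real) \<Rightarrow> real \<Rightarrow> real \<Rightarrow> ennreal" where
  "plus_int N b \<rho> a =
     (\<integral>\<^sup>+s. ennreal ((\<rho> * (1 - \<rho>) * (1 / (\<rho> * (1 - \<rho>)) - 2 + 2 * s)) powr (- a)) \<partial>xi_measure N b)"

definition b_norm :: "nat \<Rightarrow> (real \<Rightarrow> real) \<Rightarrow> ennreal" where
  "b_norm N b = ennreal (sphere_area (N - 2)) * emeasure (xi_measure N b) {-1..1}"

definition C_pair :: "nat \<Rightarrow> (real \<Rightarrow> real) \<Rightarrow> real \<Rightarrow> ennreal \<Rightarrow> ennreal \<Rightarrow> ennreal \<Rightarrow> ennreal" where
  "C_pair N b \<rho> p q r =
     ennreal (sphere_area (N - 2))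
     * enn_powr (minus_int N b \<rho> (real N / (2 * enn2real (conj_exp r))))
         (enn2real (conj_exp r / conj_exp q))
     * enn_powr (plus_int N b \<rho> (real N / (2 * enn2real (conj_exp r))))
         (enn2real (conj_exp r / conj_exp p))"

definition C_pair_infinity :: "nat \<Rightarrow> (real \<Rightarrow> real) \<Rightarrow> real \<Rightarrow> ennreal \<Rightarrow> ennreal" where
  "C_pair_infinity N b \<rho> p =
     ennreal (sphere_area (N - 2))
     * enn_powr (minus_int N b \<rho> (real N / 2)) (enn2real (1 / p))
     * enn_powr (plus_int N b \<rho> (real N / 2)) (enn2real (1 / conj_exp p))"

definition M_pair :: "('i::finite \<Rightarrow> real) \<Rightarrow> ('i \<Rightarrow> 'i \<Rightarrow> real) \<Rightarrow> 'i \<Rightarrow> 'i \<Rightarrow> real" where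
  "M_pair m lam i j =
     ((\<Sum>l\<in>UNIV. m l) / m i) powr (lam i j / 2) + ((\<Sum>l\<in>UNIV. m l) / m j) powr (lam i j / 2)"

text \<open>
  For \<open>r = \<infinity>\<close> and \<open>1 < p < \<infinity>\<close> this constant, which then has no power of the number \<open>I\<close>
  of species, is too small: with equal data for all species the \<open>r\<close>-norm of the gain term grows
  like \<open>I\<^sup>2\<close> (a sum over \<open>i\<close> of sums over \<open>j\<close>), whereas the product of the norms grows like
  \<open>I\<close>. The factor \<open>I\<close> needed there is not part of the constant and has to be written
  separately.
\<close>

definition C_gain :: "nat \<Rightarrow> ('i::finite \<Rightarrow> real) \<Rightarrow> ('i \<Rightarrow> 'i \<Rightarrow> real) \<Rightarrow> ('i \<Rightarrow> 'i \<Rightarrow> real \<Rightarrow> real) \<Rightarrow>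
    ennreal \<Rightarrow> ennreal \<Rightarrow> ennreal \<Rightarrow> ennreal" where
  "C_gain N m lam b p q r =
     (if r = 1 then
        (MAX i. MAX j. ennreal (2 powr lam i j * M_pair m lam i j) * b_norm N (b i j))
      else if r = \<infinity> then
        (MAX i. MAX j. ennreal (2 powr lam i j * M_pair m lam i j)
           * C_pair_infinity N (b i j) (mass_ratio m i j) p)
      else
        ennreal (real CARD('i) powr ((enn2real r - 1) / enn2real r))
        * (MAX i. MAX j. ennreal (2 powr lam i j * M_pair m lam i j)
             * C_pair N (b i j) (mass_ratio m i j) p q r))"

end

theory Submission
  imports Defs
begin

text \<open>
  The gain operator behaves like a convolution, and the estimate is proved like Young's convolution inequality.

  Conservation of energy reduces it to kernels without the factor \<open>norm u powr lam i j\<close>: collisions preserve the relative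
  speed, so its power is at most a constant times the product of the weights at the two outgoing velocities
  (\<open>kernel_gain_le_pair_gain\<close>), and these weights are part of the norms of \<open>F\<close> and \<open>G\<close>. For one pair of species the
  outgoing velocities are \<open>v - displ \<rho> u \<sigma>\<close> and \<open>v - displ_s \<rho> u \<sigma>\<close> with \<open>u = v - vs\<close>. As in Young's inequality,
  Hoelder's inequality with the exponents \<open>1 / r\<close>, \<open>1 - 1 / q\<close> and \<open>1 - 1 / p\<close> is applied to the integral over \<open>u\<close> and
  \<open>\<sigma>\<close> (\<open>pair_gain_Holder\<close>). This leaves three integrals.

  The first one, of \<open>f\<^sup>p g\<^sup>q\<close>, is kept, and is finally integrated over \<open>v\<close>. The two outgoing velocities
  differ by \<open>norm u *\<^sub>R \<sigma>\<close>, and in polar coordinates the direction of \<open>u\<close> can be exchanged with \<open>\<sigma>\<close>, so the integral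
  factorises (\<open>nn_integral_pair_gain\<close>). The other two contain a single function, evaluated at \<open>v - displ \<rho> u \<sigma>\<close> or
  at \<open>v - displ_s \<rho> u \<sigma>\<close>. Both displacements are multiples of \<open>u + \<kappa> norm u \<sigma>\<close>, with \<open>\<kappa> = -1\<close> and
  \<open>\<kappa> = \<rho> / (1 - \<rho>)\<close> respectively. Their lengths are \<open>norm u\<close> times the root of a function of the cosine \<open>s\<close>
  between \<open>u\<close> and \<open>\<sigma>\<close>, and passing to the displacement as integration variable costs this function to the power \<open>- N / 2\<close>
  (\<open>nn_integral_sphere_shear\<close>). The reason is that the map shifts points along \<open>\<sigma>\<close> only: it is a monotone substitution on
  each line parallel to \<open>\<sigma>\<close>, because the angular kernel lives on \<open>s \<ge> 0\<close>, and the integral over \<open>\<sigma>\<close> of the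
  resulting Jacobian is an integral over slices of the sphere (\<open>nn_integral_sphere_slices\<close>).

  Weights in \<open>s\<close> can be moved between the three factors. They are chosen so that all three angular integrals agree, which
  gives the integral of \<open>minus_sq \<rho> s powr (- N (1 - 1 / q) / 2) * plus_sq \<rho> s powr (- N (1 - 1 / p) / 2)\<close>; Hoelder's
  inequality bounds it by the product in the constant (\<open>Holder_weight_integral\<close>). A function with infinite exponent is
  bounded by its essential supremum instead (\<open>pair_gain_le_sup_right\<close>, \<open>pair_gain_le_sup_left\<close>). In the mixture, the sums over species are
  compared by Hoelder's inequality for sums and by \<open>r \<ge> p\<close>, \<open>r \<ge> q\<close> (\<open>sum_le_species_Lr\<close>).

  The distribution functions and the angular kernels are Lebesgue measurable only. As the collision maps pull null sets back
  to null sets, they can be replaced by Borel functions without changing the gain term at any point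
  (\<open>gain_term_eq_kernel_gain\<close>).
\<close>

section \<open>Powers in the extended half-line and Hoelder's inequality\<close>

lemma enn_powr_0 [simp]: "enn_powr x 0 = 1"
  by (simp add: enn_powr_def)

lemma enn_powr_ennreal:
  assumes "0 \<le> x" "a \<noteq> 0"
  shows "enn_powr (ennreal x) a = ennreal (x powr a)"
  using assms by (simp add: enn_powr_def)

lemma enn_powr_top: "a \<noteq> 0 \<Longrightarrow> enn_powr top a = top"
  by (simp add: enn_powr_def)

lemma enn_powr_0_left: "a \<noteq> 0 \<Longrightarrow> enn_powr 0 a = 0"
  by (simp add: enn_powr_def)

lemma enn_powr_eq_0_iff: "enn_powr x a = 0 \<longleftrightarrow> a \<noteq> 0 \<and> x = 0"
  by (cases x) (auto simp: enn_powr_def)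

lemma enn_powr_1 [simp]: "enn_powr x 1 = x"
  by (cases x) (auto simp: enn_powr_def)

lemma enn_powr_one_left [simp]: "enn_powr 1 a = 1"
  by (simp add: enn_powr_def)

lemma enn_powr_mono:
  assumes "x \<le> y" "0 \<le> a"
  shows "enn_powr x a \<le> enn_powr y a"
  using assms
  by (cases x; cases y) (auto simp: enn_powr_def powr_mono2 top_unique intro!: ennreal_leI)

lemma enn_powr_mult:
  assumes "0 \<le> a"
  shows "enn_powr (x * y) a = enn_powr x a * enn_powr y a"
proof (cases "a = 0")
  case False
  show ?thesis
  proof (cases x; cases y)
    fix x' y' assume "0 \<le> x'" "x = ennreal x'" "0 \<le> y'" "y = ennreal y'"
    then show ?thesis
      using False by (simp add: enn_powr_ennreal powr_mult flip: ennreal_mult)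
  qed (use False in \<open>auto simp: enn_powr_top enn_powr_ennreal enn_powr_0_left ennreal_mult_top ennreal_top_mult\<close>)
qed simp

lemma enn_powr_add:
  assumes "0 \<le> a" "0 \<le> b"
  shows "enn_powr x (a + b) = enn_powr x a * enn_powr x b"
  using assms
  by (cases "a = 0"; cases "b = 0"; cases x)
     (auto simp: enn_powr_top enn_powr_ennreal powr_add ennreal_top_mult simp flip: ennreal_mult)

lemma enn_powr_powr:
  assumes "0 \<le> a" "0 \<le> b"
  shows "enn_powr (enn_powr x a) b = enn_powr x (a * b)"
  using assms
  by (cases "a = 0"; cases "b = 0"; cases x)
     (auto simp: enn_powr_top enn_powr_ennreal powr_powr)

lemma measurable_enn_powr [measurable]:
  assumes [measurable]: "f \<in> borel_measurable M"
  shows "(\<lambda>x. enn_powr (f x) a) \<in> borel_measurable M"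
  unfolding enn_powr_def by measurable

text \<open>
  Young's inequality for the quotients \<open>x / A\<close> and \<open>y / B\<close>. It is integrated below with \<open>A\<close> and \<open>B\<close> equal to
  the integrals of the two functions, so that the right-hand side becomes the product in Hoelder's inequality.
\<close>

lemma weighted_arith_geom_mean_scaled:
  assumes ab: "0 < \<alpha>" "0 < \<beta>" "\<alpha> + \<beta> = 1" and AB: "0 < A" "0 < B"
  shows "enn_powr x \<alpha> * enn_powr y \<beta>
           \<le> ennreal (A powr \<alpha> * B powr \<beta>) * (ennreal (\<alpha> / A) * x + ennreal (\<beta> / B) * y)"
proof (cases "x = 0 \<or> y = 0 \<or> x = top \<or> y = top")
  case True
  then show ?thesis
    using ab AB
    by (auto simp: enn_powr_0_left ennreal_mult_top ennreal_top_mult ennreal_mult_eq_top_iff)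
next
  case False
  then obtain x' y' where xy: "x = ennreal x'" "y = ennreal y'" "0 < x'" "0 < y'"
    by (cases x; cases y) (auto simp: less_le)
  have "x' powr \<alpha> * y' powr \<beta> = A powr \<alpha> * B powr \<beta> * ((x' / A) powr \<alpha> * (y' / B) powr \<beta>)"
    using xy AB by (simp add: powr_divide)
  also have "\<dots> \<le> A powr \<alpha> * B powr \<beta> * (\<alpha> * (x' / A) + \<beta> * (y' / B))"
    using xy AB ab by (intro mult_left_mono Youngs_inequality_0) auto
  finally show ?thesis
    using xy ab AB by (simp add: enn_powr_ennreal ennreal_leI flip: ennreal_mult ennreal_plus)
qed

text \<open>
  The degenerate cases agree with the conventions of \<^const>\<open>enn_powr\<close>. If an integral with positive exponent
  vanishes, then so does its function almost everywhere, hence the left-hand side; if neither vanishes and one of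
  them is infinite, then so is the right-hand side.
\<close>

lemma nn_integral_Holder:
  assumes [measurable]: "f \<in> borel_measurable M" "g \<in> borel_measurable M"
    and ab: "0 \<le> \<alpha>" "0 \<le> \<beta>" "\<alpha> + \<beta> = 1"
  shows "(\<integral>\<^sup>+x. enn_powr (f x) \<alpha> * enn_powr (g x) \<beta> \<partial>M)
           \<le> enn_powr (\<integral>\<^sup>+x. f x \<partial>M) \<alpha> * enn_powr (\<integral>\<^sup>+x. g x \<partial>M) \<beta>"
proof (cases "\<alpha> = 0 \<or> \<beta> = 0")
  case True
  then show ?thesis using ab by auto
next
  case False
  then have ab': "0 < \<alpha>" "0 < \<beta>" using ab by auto
  let ?A = "\<integral>\<^sup>+x. f x \<partial>M" and ?B = "\<integral>\<^sup>+x. g x \<partial>M"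
  show ?thesis
  proof (cases "?A = 0 \<or> ?B = 0")
    case True
    then have "(AE x in M. f x = 0) \<or> (AE x in M. g x = 0)"
      by (simp add: nn_integral_0_iff_AE)
    then have "AE x in M. enn_powr (f x) \<alpha> * enn_powr (g x) \<beta> = 0"
      using ab' by (elim disjE) (auto elim!: eventually_mono simp: enn_powr_0_left)
    then have "(\<integral>\<^sup>+x. enn_powr (f x) \<alpha> * enn_powr (g x) \<beta> \<partial>M) = 0"
      by (simp add: nn_integral_0_iff_AE)
    then show ?thesis by simp
  next
    case nz: False
    show ?thesis
    proof (cases "?A = top \<or> ?B = top")
      case True
      then have "enn_powr ?A \<alpha> * enn_powr ?B \<beta> = top"
        using nz ab' by (auto simp: enn_powr_top ennreal_mult_top ennreal_top_mult enn_powr_eq_0_iff ennreal_mult_eq_top_iff)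
      then show ?thesis by simp
    next
      case fin: False
      then obtain A B where AB: "?A = ennreal A" "?B = ennreal B" "0 < A" "0 < B"
        using nz by (cases ?A; cases ?B) (auto simp: less_le)
      have "(\<integral>\<^sup>+x. enn_powr (f x) \<alpha> * enn_powr (g x) \<beta> \<partial>M)
          \<le> (\<integral>\<^sup>+x. ennreal (A powr \<alpha> * B powr \<beta>) * (ennreal (\<alpha> / A) * f x + ennreal (\<beta> / B) * g x) \<partial>M)"
        by (intro nn_integral_mono weighted_arith_geom_mean_scaled ab' ab AB)
      also have "\<dots> = ennreal (A powr \<alpha> * B powr \<beta>) * (ennreal (\<alpha> / A) * ?A + ennreal (\<beta> / B) * ?B)"
        by (simp add: nn_integral_cmult nn_integral_add)
      also have "\<dots> = ennreal (A powr \<alpha> * B powr \<beta> * (\<alpha> / A * A + \<beta> / B * B))"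
        using AB ab by (simp add: flip: ennreal_mult ennreal_plus)
      also have "\<alpha> / A * A + \<beta> / B * B = 1"
        using AB ab by simp
      also have "ennreal (A powr \<alpha> * B powr \<beta> * 1) = enn_powr ?A \<alpha> * enn_powr ?B \<beta>"
        using AB ab' by (simp add: enn_powr_ennreal flip: ennreal_mult)
      finally show ?thesis .
    qed
  qed
qed

lemma nn_integral_Holder3:
  assumes [measurable]: "f \<in> borel_measurable M" "g \<in> borel_measurable M" "h \<in> borel_measurable M"
    and abc: "0 \<le> \<alpha>" "0 \<le> \<beta>" "0 \<le> \<gamma>" "\<alpha> + \<beta> + \<gamma> = 1"
  shows "(\<integral>\<^sup>+x. enn_powr (f x) \<alpha> * enn_powr (g x) \<beta> * enn_powr (h x) \<gamma> \<partial>M)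
           \<le> enn_powr (\<integral>\<^sup>+x. f x \<partial>M) \<alpha> * enn_powr (\<integral>\<^sup>+x. g x \<partial>M) \<beta> * enn_powr (\<integral>\<^sup>+x. h x \<partial>M) \<gamma>"
proof (cases "\<beta> + \<gamma> = 0")
  case True
  then have "\<alpha> = 1" "\<beta> = 0" "\<gamma> = 0" using abc by auto
  then show ?thesis by simp
next
  case False
  define \<delta> where "\<delta> = \<beta> + \<gamma>"
  have d: "0 < \<delta>" using False abc by (simp add: \<delta>_def)
  let ?k = "\<lambda>x. enn_powr (g x) (\<beta> / \<delta>) * enn_powr (h x) (\<gamma> / \<delta>)"
  have split: "enn_powr (enn_powr x (\<beta> / \<delta>) * enn_powr y (\<gamma> / \<delta>)) \<delta> = enn_powr x \<beta> * enn_powr y \<gamma>" for x y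
    using d abc by (simp add: enn_powr_mult enn_powr_powr)
  have "(\<integral>\<^sup>+x. enn_powr (f x) \<alpha> * enn_powr (g x) \<beta> * enn_powr (h x) \<gamma> \<partial>M)
      = (\<integral>\<^sup>+x. enn_powr (f x) \<alpha> * enn_powr (?k x) \<delta> \<partial>M)"
    by (simp add: split mult.assoc)
  also have "\<dots> \<le> enn_powr (\<integral>\<^sup>+x. f x \<partial>M) \<alpha> * enn_powr (\<integral>\<^sup>+x. ?k x \<partial>M) \<delta>"
    using d abc by (intro nn_integral_Holder) (auto simp: \<delta>_def)
  also have "\<dots> \<le> enn_powr (\<integral>\<^sup>+x. f x \<partial>M) \<alpha> * enn_powr (enn_powr (\<integral>\<^sup>+x. g x \<partial>M) (\<beta> / \<delta>) * enn_powr (\<integral>\<^sup>+x. h x \<partial>M) (\<gamma> / \<delta>)) \<delta>"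
    using d abc
    by (intro mult_left_mono enn_powr_mono nn_integral_Holder) (auto simp: \<delta>_def simp flip: add_divide_distrib)
  finally show ?thesis
    by (simp add: split mult.assoc)
qed

text \<open>
  Hoelder's inequality for the counting measure, against the constant function \<open>1\<close>.
\<close>

lemma power_sum_le_card_powr_sum:
  fixes a :: "'i::finite \<Rightarrow> ennreal"
  assumes "1 \<le> r"
  shows "enn_powr (\<Sum>j\<in>UNIV. a j) r \<le> ennreal (real CARD('i) powr (r - 1)) * (\<Sum>j\<in>UNIV. enn_powr (a j) r)"
proof -
  have "(\<Sum>j\<in>UNIV. a j) = (\<integral>\<^sup>+j. enn_powr (enn_powr (a j) r) (1 / r) * enn_powr 1 (1 - 1 / r) \<partial>count_space UNIV)"
    using assms by (simp add: enn_powr_powr nn_integral_count_space_finite)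
  also have "\<dots> \<le> enn_powr (\<integral>\<^sup>+j. enn_powr (a j) r \<partial>count_space UNIV) (1 / r) *
      enn_powr (\<integral>\<^sup>+(j::'i). 1 \<partial>count_space UNIV) (1 - 1 / r)"
    using assms by (intro nn_integral_Holder) auto
  finally have "(\<Sum>j\<in>UNIV. a j) \<le> enn_powr (\<Sum>j\<in>UNIV. enn_powr (a j) r) (1 / r) * enn_powr (of_nat CARD('i)) (1 - 1 / r)"
    by (simp add: nn_integral_count_space_finite)
  then have "enn_powr (\<Sum>j\<in>UNIV. a j) r \<le> enn_powr (enn_powr (\<Sum>j\<in>UNIV. enn_powr (a j) r) (1 / r) * enn_powr (of_nat CARD('i)) (1 - 1 / r)) r"
    using assms by (intro enn_powr_mono) auto
  also have "\<dots> = (\<Sum>j\<in>UNIV. enn_powr (a j) r) * enn_powr (of_nat CARD('i)) ((1 - 1 / r) * r)"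
    using assms by (simp add: enn_powr_mult enn_powr_powr)
  also have "(1 - 1 / r) * r = r - 1"
    using assms by (simp add: field_simps)
  also have "enn_powr (of_nat CARD('i)) (r - 1) = ennreal (real CARD('i) powr (r - 1))"
    by (cases "r = 1") (auto simp: enn_powr_ennreal ennreal_of_nat_eq_real_of_nat)
  finally show ?thesis by (simp add: mult.commute)
qed

lemma sum_powr_le_powr_sum:
  fixes a :: "'i \<Rightarrow> ennreal"
  assumes "1 \<le> t"
  shows "(\<Sum>j\<in>A. enn_powr (a j) t) \<le> enn_powr (\<Sum>j\<in>A. a j) t"
proof (induction A rule: infinite_finite_induct)
  case (insert i A)
  have *: "enn_powr x t + enn_powr y t \<le> enn_powr (x + y) t" for x y :: ennreal
  proof -
    have "enn_powr z t = z * enn_powr z (t - 1)" for z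
      using enn_powr_add[of 1 "t - 1" z] assms by simp
    moreover have "enn_powr x (t - 1) \<le> enn_powr (x + y) (t - 1)" "enn_powr y (t - 1) \<le> enn_powr (x + y) (t - 1)"
      using assms by (auto intro!: enn_powr_mono)
    ultimately show ?thesis
      by (simp add: distrib_right add_mono mult_left_mono)
  qed
  have "(\<Sum>j\<in>insert i A. enn_powr (a j) t) \<le> enn_powr (a i) t + enn_powr (\<Sum>j\<in>A. a j) t"
    using insert by simp
  also have "\<dots> \<le> enn_powr (\<Sum>j\<in>insert i A. a j) t"
    using insert * by simp
  finally show ?case .
qed (use assms in \<open>auto simp: enn_powr_0_left\<close>)

section \<open>Change of variables on a line and line decompositions\<close>

text \<open>
  The substitution rule on a compact interval passes to increasing unions. This covers half-lines and half-open
  intervals, at whose open end the substitution may fail to be differentiable.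
\<close>

lemma nn_integral_substitution_exhaust:
  fixes f :: "real \<Rightarrow> ennreal" and g g' :: "real \<Rightarrow> real" and lo hi :: "nat \<Rightarrow> real"
  assumes [measurable]: "f \<in> borel_measurable borel" "g \<in> borel_measurable borel" "g' \<in> borel_measurable borel"
    and less: "\<And>n. lo n < hi n"
    and inc: "\<And>n. lo (Suc n) \<le> lo n" "\<And>n. hi n \<le> hi (Suc n)"
    and deriv: "\<And>n x. x \<in> {lo n..hi n} \<Longrightarrow> (g has_real_derivative g' x) (at x)"
    and cont: "\<And>n. continuous_on {lo n..hi n} g'"
    and nonneg: "\<And>n x. x \<in> {lo n..hi n} \<Longrightarrow> 0 \<le> g' x"
  shows "(\<integral>\<^sup>+x. f x * indicator (\<Union>n. {g (lo n)..g (hi n)}) x \<partial>lborel) =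
         (\<integral>\<^sup>+x. f (g x) * ennreal (g' x) * indicator (\<Union>n. {lo n..hi n}) x \<partial>lborel)"
proof -
  have mono: "g x \<le> g y" if "x \<in> {lo n..hi n}" "y \<in> {lo n..hi n}" "x \<le> y" for x y n
    using that by (intro DERIV_nonneg_imp_nondecreasing[of x y g]) (auto intro!: exI deriv[of _ n] nonneg[of _ n])
  have inc1: "incseq (\<lambda>n. {lo n..hi n})"
    using inc by (intro incseq_SucI) (auto intro: order_trans)
  have inc2: "incseq (\<lambda>n. {g (lo n)..g (hi n)})"
  proof (rule incseq_SucI)
    fix n
    have "g (lo (Suc n)) \<le> g (lo n)" "g (hi n) \<le> g (hi (Suc n))"
      using inc[of n] less[of n] less[of "Suc n"] by (auto intro!: mono[of _ "Suc n"])
    then show "{g (lo n)..g (hi n)} \<subseteq> {g (lo (Suc n))..g (hi (Suc n))}"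
      by auto
  qed
  have "(\<integral>\<^sup>+x. f x * indicator (\<Union>n. {g (lo n)..g (hi n)}) x \<partial>lborel)
      = emeasure (density lborel f) (\<Union>n. {g (lo n)..g (hi n)})"
    by (simp add: emeasure_density)
  also have "\<dots> = (SUP n. emeasure (density lborel f) {g (lo n)..g (hi n)})"
    using inc2 by (intro SUP_emeasure_incseq[symmetric]) auto
  also have "\<dots> = (SUP n. emeasure (density lborel (\<lambda>x. f (g x) * ennreal (g' x))) {lo n..hi n})"
    by (intro SUP_cong refl)
       (simp add: emeasure_density, rule nn_integral_substitution_aux[OF _ _ deriv cont nonneg less], simp_all)
  also have "\<dots> = emeasure (density lborel (\<lambda>x. f (g x) * ennreal (g' x))) (\<Union>n. {lo n..hi n})"
    using inc1 by (intro SUP_emeasure_incseq) auto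
  also have "\<dots> = (\<integral>\<^sup>+x. f (g x) * ennreal (g' x) * indicator (\<Union>n. {lo n..hi n}) x \<partial>lborel)"
    by (simp add: emeasure_density)
  finally show ?thesis .
qed

lemma nn_integral_lborel_translate:
  fixes f :: "'a::euclidean_space \<Rightarrow> ennreal"
  assumes [measurable]: "f \<in> borel_measurable borel"
  shows "(\<integral>\<^sup>+x. f (c + x) \<partial>lborel) = (\<integral>\<^sup>+x. f x \<partial>lborel)"
proof -
  have "(\<integral>\<^sup>+x. f x \<partial>lborel) = (\<integral>\<^sup>+x. f x \<partial>distr lborel borel ((+) c))"
    by (simp add: lborel_distr_plus)
  then show ?thesis by (simp add: nn_integral_distr)
qed

lemma nn_integral_lborel_scale:
  fixes f :: "'a::euclidean_space \<Rightarrow> ennreal"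
  assumes [measurable]: "f \<in> borel_measurable borel" and c: "c \<noteq> 0"
  shows "(\<integral>\<^sup>+x. f x \<partial>lborel) = ennreal (\<bar>c\<bar> ^ DIM('a)) * (\<integral>\<^sup>+x. f (c *\<^sub>R x) \<partial>lborel)"
  by (subst lborel_affine[OF c, of 0])
     (simp add: nn_integral_density nn_integral_distr nn_integral_cmult)

lemma nn_integral_lborel_reflect:
  fixes f :: "'a::euclidean_space \<Rightarrow> ennreal"
  assumes [measurable]: "f \<in> borel_measurable borel"
  shows "(\<integral>\<^sup>+x. f (c - x) \<partial>lborel) = (\<integral>\<^sup>+x. f x \<partial>lborel)"
  using nn_integral_lborel_scale[of f "-1"] nn_integral_lborel_translate[of "\<lambda>x. f (- x)" "- c"]
  by simp

definition perp :: "'a::euclidean_space \<Rightarrow> 'a \<Rightarrow> 'a" where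
  "perp e x = x - (x \<bullet> e) *\<^sub>R e"

lemma measurable_perp [measurable]:
  assumes [measurable]: "f \<in> borel_measurable M" "g \<in> borel_measurable M"
  shows "(\<lambda>x. perp (f x) (g x)) \<in> borel_measurable M"
  unfolding perp_def by measurable

lemma perp_inner [simp]: "norm e = 1 \<Longrightarrow> perp e x \<bullet> e = 0"
  by (simp add: perp_def inner_diff_left flip: norm_eq_1)

lemma perp_add_line [simp]: "norm e = 1 \<Longrightarrow> perp e (perp e x + t *\<^sub>R e) = perp e x"
  by (simp add: perp_def algebra_simps norm_eq_1)

lemma inner_perp_add_line [simp]: "norm e = 1 \<Longrightarrow> (perp e x + t *\<^sub>R e) \<bullet> e = t"
  by (simp add: inner_add_left flip: norm_eq_1)

lemma perp_scaleR: "perp e (c *\<^sub>R x) = c *\<^sub>R perp e x"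
  by (simp add: perp_def algebra_simps)

lemma norm_perp_add_line:
  assumes "norm e = 1"
  shows "norm (perp e x + t *\<^sub>R e) = sqrt (t\<^sup>2 + (norm (perp e x))\<^sup>2)"
proof -
  have "(norm (perp e x + t *\<^sub>R e))\<^sup>2 = (norm (perp e x))\<^sup>2 + (norm (t *\<^sub>R e))\<^sup>2"
    using assms by (intro norm_add_Pythagorean) (simp add: orthogonal_def)
  then show ?thesis
    using assms by (simp add: add.commute real_sqrt_unique)
qed

lemma AE_perp_nonzero:
  assumes "2 \<le> DIM('a)"
  shows "AE x in (lborel :: 'a::euclidean_space measure). perp e x \<noteq> 0"
proof -
  have "dim (span {e}) < DIM('a)"
    using assms by (simp add: dim_singleton split: if_splits)
  then have "negligible (span {e})"
    by (intro negligible_lowdim) simp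
  then have "AE x in lebesgue. x \<notin> span {e}"
    using AE_not_in negligible_iff_null_sets by blast
  then have "AE x in lborel. x \<notin> span {e}"
    by (simp add: AE_completion_iff)
  then show ?thesis
    by (rule AE_mp) (auto simp: perp_def span_singleton)
qed

text \<open>
  The inner integral depends on \<open>x\<close> only through the line \<open>x + t e\<close>. Exchanging the integrals and translating
  \<open>x\<close> by \<open>t e\<close> turns the indicator into one of \<open>t\<close>, of total mass \<open>1\<close>. Translation invariance thus plays the role
  that a rotation taking \<open>e\<close> to a coordinate axis would have.
\<close>

lemma nn_integral_line_decomposition:
  fixes \<Phi> :: "'a::euclidean_space \<Rightarrow> ennreal"
  assumes [measurable]: "\<Phi> \<in> borel_measurable borel" and e: "norm e = 1"
  shows "(\<integral>\<^sup>+x. \<Phi> x \<partial>lborel) =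
         (\<integral>\<^sup>+x. indicator {0..<1} (x \<bullet> e) * (\<integral>\<^sup>+t. \<Phi> (perp e x + t *\<^sub>R e) \<partial>lborel) \<partial>lborel)"
proof -
  let ?\<chi> = "indicator {0..<1} :: real \<Rightarrow> ennreal"
  have ee: "e \<bullet> e = 1" using e by (simp flip: norm_eq_1)
  have unit: "(\<integral>\<^sup>+t. ?\<chi> (a - t) \<partial>lborel) = 1" for a :: real
    using nn_integral_lborel_reflect[of ?\<chi> a] by simp
  have "(\<integral>\<^sup>+t. \<Phi> (perp e x + t *\<^sub>R e) \<partial>lborel) = (\<integral>\<^sup>+t. \<Phi> (x + t *\<^sub>R e) \<partial>lborel)" for x
    by (subst nn_integral_lborel_translate[of "\<lambda>t. \<Phi> (perp e x + t *\<^sub>R e)" "x \<bullet> e", symmetric])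
       (simp_all add: perp_def algebra_simps)
  then have "(\<integral>\<^sup>+x. ?\<chi> (x \<bullet> e) * (\<integral>\<^sup>+t. \<Phi> (perp e x + t *\<^sub>R e) \<partial>lborel) \<partial>lborel)
      = (\<integral>\<^sup>+x. (\<integral>\<^sup>+t. ?\<chi> (x \<bullet> e) * \<Phi> (x + t *\<^sub>R e) \<partial>lborel) \<partial>lborel)"
    by (simp add: nn_integral_cmult)
  also have "\<dots> = (\<integral>\<^sup>+t. (\<integral>\<^sup>+x. ?\<chi> (x \<bullet> e) * \<Phi> (x + t *\<^sub>R e) \<partial>lborel) \<partial>lborel)"
    by (rule lborel_pair.Fubini') simp
  also have "\<dots> = (\<integral>\<^sup>+t. (\<integral>\<^sup>+x. ?\<chi> (x \<bullet> e - t) * \<Phi> x \<partial>lborel) \<partial>lborel)"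
  proof (rule nn_integral_cong)
    fix t :: real
    show "(\<integral>\<^sup>+x. ?\<chi> (x \<bullet> e) * \<Phi> (x + t *\<^sub>R e) \<partial>lborel) = (\<integral>\<^sup>+x. ?\<chi> (x \<bullet> e - t) * \<Phi> x \<partial>lborel)"
      by (subst nn_integral_lborel_translate[of "\<lambda>x. ?\<chi> (x \<bullet> e - t) * \<Phi> x" "t *\<^sub>R e", symmetric])
         (simp_all add: inner_add_left ee add.commute)
  qed
  also have "\<dots> = (\<integral>\<^sup>+x. (\<integral>\<^sup>+t. ?\<chi> (x \<bullet> e - t) * \<Phi> x \<partial>lborel) \<partial>lborel)"
    by (rule lborel_pair.Fubini') simp
  also have "\<dots> = (\<integral>\<^sup>+x. \<Phi> x \<partial>lborel)"
    by (simp add: nn_integral_multc unit)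
  finally show ?thesis by simp
qed

text \<open>
  The exponent is that of the cross-section: scaling all of the space also stretches the cylinder along its axis, and
  the line decomposition shows that only the length of the cylinder matters.
\<close>

lemma nn_integral_cylinder_scale:
  fixes h :: "'a::euclidean_space \<Rightarrow> ennreal"
  assumes [measurable]: "h \<in> borel_measurable borel" and e: "norm e = 1" and a: "0 < a"
  shows "(\<integral>\<^sup>+x. indicator {0..<1} (x \<bullet> e) * h (perp e x) \<partial>lborel)
       = ennreal (a ^ (DIM('a) - 1)) * (\<integral>\<^sup>+x. indicator {0..<1} (x \<bullet> e) * h (a *\<^sub>R perp e x) \<partial>lborel)"
proof -
  let ?\<chi> = "indicator {0..<1} :: real \<Rightarrow> ennreal"
  let ?\<chi>' = "\<lambda>t. ?\<chi> (a * t)"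
  have len: "ennreal a * (\<integral>\<^sup>+t. ?\<chi>' t \<partial>lborel) = 1"
    using nn_integral_real_affine[of ?\<chi> a 0] a by simp
  have "(\<integral>\<^sup>+x. ?\<chi> (x \<bullet> e) * h (perp e x) \<partial>lborel)
      = ennreal (a ^ DIM('a)) * (\<integral>\<^sup>+x. ?\<chi>' (x \<bullet> e) * h (a *\<^sub>R perp e x) \<partial>lborel)"
    using a by (subst nn_integral_lborel_scale[of _ a]) (simp_all add: perp_scaleR)
  also have "(\<integral>\<^sup>+x. ?\<chi>' (x \<bullet> e) * h (a *\<^sub>R perp e x) \<partial>lborel)
      = (\<integral>\<^sup>+t. ?\<chi>' t \<partial>lborel) * (\<integral>\<^sup>+x. ?\<chi> (x \<bullet> e) * h (a *\<^sub>R perp e x) \<partial>lborel)"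
  proof -
    have "(\<integral>\<^sup>+x. ?\<chi>' (x \<bullet> e) * h (a *\<^sub>R perp e x) \<partial>lborel)
        = (\<integral>\<^sup>+x. (\<integral>\<^sup>+t. ?\<chi>' t \<partial>lborel) * (?\<chi> (x \<bullet> e) * h (a *\<^sub>R perp e x)) \<partial>lborel)"
      by (subst nn_integral_line_decomposition[OF _ e]) (simp_all add: e nn_integral_cmult mult_ac)
    then show ?thesis by (subst (asm) nn_integral_cmult) simp_all
  qed
  also have "ennreal (a ^ DIM('a)) * \<dots>
      = ennreal (a ^ (DIM('a) - 1)) * (ennreal a * (\<integral>\<^sup>+t. ?\<chi>' t \<partial>lborel)) * (\<integral>\<^sup>+x. ?\<chi> (x \<bullet> e) * h (a *\<^sub>R perp e x) \<partial>lborel)"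
  proof -
    have "a ^ DIM('a) = a ^ (DIM('a) - 1) * a"
      using DIM_positive[where 'a='a] by (cases "DIM('a)") auto
    then show ?thesis
      using a by (simp add: ennreal_mult mult_ac)
  qed
  finally show ?thesis by (simp add: len)
qed

section \<open>The sphere cut into slices of constant direction cosine\<close>

lemma sets_sphere_measure [measurable_cong, simp]: "sets sphere_measure = sets borel"
  by (simp add: sphere_measure_def)

lemma space_sphere_measure [simp]: "space sphere_measure = UNIV"
  using sets_eq_imp_space_eq[OF sets_sphere_measure] by simp

lemma finite_measure_sphere_measure: "finite_measure (sphere_measure :: 'a::euclidean_space measure)"
  by (rule finite_measureI) (simp add: emeasure_sphere_measure_UNIV)

interpretation sphere: finite_measure "sphere_measure :: 'a::euclidean_space measure"
  by (rule finite_measure_sphere_measure)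

lemma borel_measurable_sgn [measurable]: "(sgn :: 'a::euclidean_space \<Rightarrow> 'a) \<in> borel_measurable borel"
  by (simp add: sgn_div_norm)

lemma nn_integral_sphere_measure:
  fixes f :: "'a::euclidean_space \<Rightarrow> ennreal"
  assumes [measurable]: "f \<in> borel_measurable borel"
  shows "(\<integral>\<^sup>+\<sigma>. f \<sigma> \<partial>sphere_measure) =
         of_nat DIM('a) * (\<integral>\<^sup>+x. f (sgn x) * indicator {..<1} (norm x) \<partial>lborel)"
proof -
  have "(sgn :: 'a \<Rightarrow> 'a) \<in> measurable (restrict_space lborel (ball 0 1)) borel"
    by (intro measurable_restrict_space1) simp
  then have "(\<integral>\<^sup>+\<sigma>. f \<sigma> \<partial>distr (restrict_space lborel (ball 0 1)) borel sgn)
      = (\<integral>\<^sup>+x. f (sgn x) * indicator (ball 0 1) x \<partial>lborel)"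
    by (simp add: nn_integral_distr nn_integral_restrict_space)
  also have "(\<lambda>x::'a. indicator (ball 0 1) x :: ennreal) = (\<lambda>x. indicator {..<1} (norm x))"
    by (auto simp: indicator_def)
  finally show ?thesis
    by (simp add: sphere_measure_def nn_integral_scale_measure)
qed

lemma AE_sphere_norm: "AE \<sigma> in (sphere_measure :: 'a::euclidean_space measure). norm \<sigma> = 1"
proof -
  have "(\<integral>\<^sup>+\<sigma>. indicator {\<sigma>. norm \<sigma> \<noteq> 1} \<sigma> \<partial>(sphere_measure :: 'a measure)) = 
    of_nat DIM('a) * (\<integral>\<^sup>+x. indicator {\<sigma>. norm \<sigma> \<noteq> 1} (sgn x) * indicator {..<1} (norm x) \<partial>(lborel :: 'a measure))"
    by (rule nn_integral_sphere_measure) simp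
  also have "(\<integral>\<^sup>+x. indicator {\<sigma>. norm \<sigma> \<noteq> 1} (sgn x) * indicator {..<1} (norm x) \<partial>(lborel :: 'a measure)) = (\<integral>\<^sup>+x. 0 \<partial>(lborel :: 'a measure))"
    using AE_lborel_singleton[of "0::'a"]
    by (intro nn_integral_cong_AE) (auto simp: norm_sgn elim!: eventually_mono)
  finally have "(\<integral>\<^sup>+\<sigma>. indicator {\<sigma>. norm \<sigma> \<noteq> 1} \<sigma> \<partial>(sphere_measure :: 'a measure)) = 0" by simp
  then have "AE \<sigma> in (sphere_measure :: 'a measure). indicator {\<sigma>. norm \<sigma> \<noteq> 1} \<sigma> = (0::ennreal)"
    by (subst (asm) nn_integral_0_iff_AE) auto
  then show ?thesis by (auto elim!: eventually_mono simp: indicator_def split: if_splits)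
qed

text \<open>
  The density of the direction cosine under the surface measure, up to the area of the sphere in one dimension less.
\<close>

definition slice_weight :: "nat \<Rightarrow> real \<Rightarrow> ennreal" where
  "slice_weight d s = ennreal (indicator {-1<..<1} s * (1 - s\<^sup>2) powr ((real d - 3) / 2))"

lemma measurable_slice_weight [measurable]: "slice_weight d \<in> borel_measurable borel"
  unfolding slice_weight_def[abs_def] by measurable

abbreviation slice_integral :: "nat \<Rightarrow> (real \<Rightarrow> ennreal) \<Rightarrow> ennreal" where
  "slice_integral d h \<equiv> ennreal (sphere_area (d - 2)) * (\<integral>\<^sup>+s. h s * slice_weight d s \<partial>lborel)"

text \<open>
  The affine substitution \<open>t = (1 + s) / 2\<close> gives a Beta function with two equal arguments. Legendre's duplication formula
  brings it to the form that equals the quotient of the areas of two consecutive spheres.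
\<close>

lemma slice_weight_total:
  assumes "2 \<le> d"
  shows "(\<integral>\<^sup>+s. slice_weight d s \<partial>lborel) = ennreal (Beta (1 / 2) ((real d - 1) / 2))"
proof -
  define a where "a = (real d - 1) / 2"
  have a: "0 < a" "a - 1 = (real d - 3) / 2" using assms by (auto simp: a_def field_simps)
  let ?h = "\<lambda>t::real. ennreal (t powr (a - 1) * (1 - t) powr (a - 1)) * indicator {0..1} t"
  have I: "(\<integral>\<^sup>+t. ?h t \<partial>lborel) = ennreal (Beta a a)"
    using nn_integral_has_integral_lebesgue[OF _ has_integral_Beta_real[OF a(1) a(1)]]
    by (simp add: ennreal_mult' ennreal_indicator mult_ac)
  have "(\<integral>\<^sup>+t. ?h t \<partial>lborel) = ennreal (1 / 2) * (\<integral>\<^sup>+s. ?h (1 / 2 + 1 / 2 * s) \<partial>lborel)"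
    by (subst nn_integral_real_affine[of _ "1/2" "1/2"]) simp_all
  also have "(\<integral>\<^sup>+s. ?h (1 / 2 + 1 / 2 * s) \<partial>lborel) = (\<integral>\<^sup>+s. ennreal ((1 / 4) powr (a - 1)) * slice_weight d s \<partial>lborel)"
  proof (rule nn_integral_cong_AE)
    have "AE s::real in lborel. s \<noteq> 1 \<and> s \<noteq> -1"
      using AE_lborel_singleton[of "1::real"] AE_lborel_singleton[of "-1::real"] by eventually_elim auto
    then show "AE s in lborel. ?h (1 / 2 + 1 / 2 * s) = ennreal ((1 / 4) powr (a - 1)) * slice_weight d s"
    proof eventually_elim
      case (elim s)
      show ?case
      proof (cases "-1 < s \<and> s < 1")
        case True
        have pos: "0 < 1 - s\<^sup>2" using True by (simp add: abs_square_less_1 abs_less_iff)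
        have "(1 / 2 + 1 / 2 * s) powr (a - 1) * (1 - (1 / 2 + 1 / 2 * s)) powr (a - 1)
            = ((1 / 2 + 1 / 2 * s) * (1 - (1 / 2 + 1 / 2 * s))) powr (a - 1)"
          using True by (subst powr_mult) auto
        also have "(1 / 2 + 1 / 2 * s) * (1 - (1 / 2 + 1 / 2 * s)) = 1 / 4 * (1 - s\<^sup>2)"
          by (simp add: field_simps power2_eq_square)
        also have "\<dots> powr (a - 1) = (1 / 4) powr (a - 1) * (1 - s\<^sup>2) powr (a - 1)"
          using pos by (subst powr_mult) auto
        finally have "(1 / 2 + 1 / 2 * s) powr (a - 1) * (1 - (1 / 2 + 1 / 2 * s)) powr (a - 1) = (1 / 4) powr (a - 1) * (1 - s\<^sup>2) powr (a - 1)" .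
        then show ?thesis
          using True by (simp add: slice_weight_def a(2) flip: ennreal_mult)
      qed (use elim in \<open>auto simp: slice_weight_def indicator_def\<close>)
    qed
  qed
  also have "\<dots> = ennreal ((1 / 4) powr (a - 1)) * (\<integral>\<^sup>+s. slice_weight d s \<partial>lborel)"
    by (rule nn_integral_cmult) simp
  finally have half: "(\<integral>\<^sup>+t. ?h t \<partial>lborel) = ennreal (1 / 2) * (ennreal ((1 / 4) powr (a - 1)) * (\<integral>\<^sup>+s. slice_weight d s \<partial>lborel))" .
  have "ennreal (Beta a a) = ennreal (1 / 2 * (1 / 4) powr (a - 1)) * (\<integral>\<^sup>+s. slice_weight d s \<partial>lborel)"
  proof -
    have "ennreal (1 / 2 * (1 / 4) powr (a - 1)) = ennreal (1 / 2) * ennreal ((1 / 4) powr (a - 1))"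
      by (rule ennreal_mult) auto
    with half I show ?thesis by (simp only: mult.assoc)
  qed
  then have "ennreal (2 * 4 powr (a - 1)) * ennreal (Beta a a) =
      ennreal (2 * 4 powr (a - 1)) * ennreal (1 / 2 * (1 / 4) powr (a - 1)) * (\<integral>\<^sup>+s. slice_weight d s \<partial>lborel)"
    by (simp add: mult.assoc)
  also have "ennreal (2 * 4 powr (a - 1)) * ennreal (1 / 2 * (1 / 4) powr (a - 1)) = 1"
    by (simp add: powr_divide flip: ennreal_mult)
  finally have scaled: "ennreal (2 * 4 powr (a - 1)) * ennreal (Beta a a) = (\<integral>\<^sup>+s. slice_weight d s \<partial>lborel)"
    by (simp only: mult_1)
  have "ennreal (2 * 4 powr (a - 1) * Beta a a) = ennreal (2 * 4 powr (a - 1)) * ennreal (Beta a a)"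
    by (rule ennreal_mult') simp
  with scaled have "(\<integral>\<^sup>+s. slice_weight d s \<partial>lborel) = ennreal (2 * 4 powr (a - 1) * Beta a a)"
    by (simp only:)
  also have "2 * 4 powr (a - 1) * Beta a a = Beta (1 / 2) a"
  proof -
    have dup: "Gamma a * Gamma (a + 1 / 2) = exp ((1 - 2 * a) * ln 2) * sqrt pi * Gamma (2 * a)"
    proof -
      have "complex_of_real a \<notin> \<int>\<^sub>\<le>\<^sub>0" "complex_of_real (a + 1 / 2) \<notin> \<int>\<^sub>\<le>\<^sub>0"
        using a by (auto simp only: of_real_in_nonpos_Ints_iff elim!: nonpos_Ints_cases)
      then have "complex_of_real (Gamma a * Gamma (a + 1 / 2)) =
          complex_of_real (exp ((1 - 2 * a) * ln 2) * sqrt pi * Gamma (2 * a))"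
        using Gamma_legendre_duplication[of "complex_of_real a"]
        by (simp flip: exp_of_real Gamma_complex_of_real)
      then show ?thesis by (simp only: of_real_eq_iff)
    qed
    have e: "exp ((1 - 2 * a) * ln 2) = 1 / (2 * 4 powr (a - 1))"
    proof -
      have "4 powr (a - 1) = exp ((a - 1) * ln (2 * 2))" by (simp add: powr_def)
      also have "ln (2 * 2 :: real) = ln 2 + ln 2" by (subst ln_mult) auto
      finally have "2 * 4 powr (a - 1) = exp (ln 2) * exp ((a - 1) * (ln 2 + ln 2))" by simp
      also have "\<dots> = exp (- ((1 - 2 * a) * ln 2))" unfolding exp_add[symmetric] by (simp add: algebra_simps)
      finally show ?thesis by (simp only: exp_minus inverse_eq_divide) simp
    qed
    have pos: "Gamma a > 0" "Gamma (a + 1 / 2) > 0" "Gamma (2 * a) > 0" using a by (auto intro!: Gamma_real_pos)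
    have "2 * 4 powr (a - 1) * (Gamma a * Gamma (a + 1 / 2)) = sqrt pi * Gamma (2 * a)"
      unfolding dup e by simp
    then show ?thesis
      using pos by (simp add: Beta_def Gamma_one_half_real field_simps add.commute)
  qed
  finally show ?thesis by (simp add: a_def)
qed

text \<open>
  On a line at distance \<open>\<rho>\<close> from the origin, with \<open>t\<close> measured from the closest point, the direction cosine is
  \<open>s = t / sqrt (t\<^sup>2 + \<rho>\<^sup>2)\<close>; it runs through \<open>(-1,1)\<close>, and \<open>\<rho>\<^sup>2 / (t\<^sup>2 + \<rho>\<^sup>2) = 1 - s\<^sup>2\<close>.
\<close>

lemma direction_cosine_substitution:
  fixes \<psi> :: "real \<Rightarrow> ennreal"
  assumes [measurable]: "\<psi> \<in> borel_measurable borel" and \<rho>: "0 < \<rho>"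
  shows "(\<integral>\<^sup>+t. \<psi> (t / sqrt (t\<^sup>2 + \<rho>\<^sup>2)) * indicator {..<1} (sqrt (t\<^sup>2 + \<rho>\<^sup>2)) \<partial>lborel)
       = (\<integral>\<^sup>+s. \<psi> s * ennreal (indicator {-1<..<1} s * (1 - s\<^sup>2) powr (- 3 / 2))
              * (ennreal \<rho> * indicator {0<..} (sqrt (1 - s\<^sup>2) - \<rho>)) \<partial>lborel)"
proof -
  let ?q = "\<lambda>t. t\<^sup>2 + \<rho>\<^sup>2"
  let ?g = "\<lambda>t. t / sqrt (?q t)"
  let ?g' = "\<lambda>t. \<rho>\<^sup>2 * ?q t powr (- 3 / 2)"
  let ?f = "\<lambda>s. \<psi> s * ennreal (indicator {-1<..<1} s * (1 - s\<^sup>2) powr (- 3 / 2))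
              * (ennreal \<rho> * indicator {0<..} (sqrt (1 - s\<^sup>2) - \<rho>))"
  have q: "0 < ?q t" for t using \<rho> by (simp add: add_nonneg_pos)
  have one_minus: "1 - (?g t)\<^sup>2 = \<rho>\<^sup>2 / ?q t" for t
  proof -
    have "?q t \<noteq> 0" using q[of t] by (metis less_irrefl)
    then show ?thesis using q[of t] \<rho> by (simp add: power_divide eq_divide_eq left_diff_distrib)
  qed
  have range: "-1 < ?g t \<and> ?g t < 1" for t
  proof -
    have "(?g t)\<^sup>2 < 1" using one_minus[of t] q[of t] \<rho> by (smt (verit) divide_pos_pos zero_less_power)
    then show ?thesis unfolding abs_square_less_1 by (auto simp only: abs_less_iff minus_less_iff)
  qed
  have deriv: "(?g has_real_derivative ?g' t) (at t)" for t
  proof -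
    have "(?g has_real_derivative (1 * sqrt (?q t) - t * ((2 * t) * (inverse (sqrt (?q t)) / 2))) / (sqrt (?q t) * sqrt (?q t))) (at t)"
      using q[of t] by (auto intro!: derivative_eq_intros)
    also have "(1 * sqrt (?q t) - t * ((2 * t) * (inverse (sqrt (?q t)) / 2))) / (sqrt (?q t) * sqrt (?q t)) = ?g' t"
    proof -
      have "?q t powr (- 3 / 2) = ?q t powr (- (1 + 1 / 2))" by simp
      also have "\<dots> = inverse (?q t * sqrt (?q t))"
        using q[of t] unfolding powr_minus powr_add by (simp add: powr_half_sqrt)
      finally have w: "?q t powr (- 3 / 2) = inverse (?q t * sqrt (?q t))" .
      define Y where "Y = sqrt (?q t)"
      have Y: "0 < Y" "?q t = Y * Y" "\<rho>\<^sup>2 = Y * Y - t * t"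
        using q[of t] by (auto simp: Y_def power2_eq_square)
      have "(1 * Y - t * ((2 * t) * (inverse Y / 2))) / (Y * Y) = (Y * Y - t * t) * inverse (Y * Y * Y)"
        using Y(1) by (simp add: field_simps)
      then show ?thesis unfolding w Y_def[symmetric] by (simp only: Y(3)) (simp add: power2_eq_square)
    qed
    finally show ?thesis .
  qed
  have cancel: "?f (?g t) * ennreal (?g' t) = \<psi> (?g t) * indicator {..<1} (sqrt (?q t))" for t
  proof -
    have "\<rho> < sqrt (\<rho>\<^sup>2 / ?q t) \<longleftrightarrow> sqrt (?q t) < 1"
      using \<rho> q[of t] by (simp add: real_sqrt_divide field_simps)
    then have i: "indicator {0<..} (sqrt (\<rho>\<^sup>2 / ?q t) - \<rho>) = (indicator {..<1} (sqrt (?q t)) :: ennreal)"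
      by (simp add: indicator_def)
    have "(\<rho>\<^sup>2 / ?q t) powr (- 3 / 2) * \<rho> * ?g' t = \<rho> * \<rho>\<^sup>2 * (\<rho>\<^sup>2) powr (- 3 / 2)"
      using \<rho> q[of t] by (simp add: powr_divide)
    also have "\<dots> = \<rho> powr 3 * \<rho> powr (-3)"
      using \<rho> powr_powr[of \<rho> 2 "- 3 / 2"] by (simp add: powr_numeral power2_eq_square power3_eq_cube)
    also have "\<dots> = 1" using \<rho> by (subst powr_add[symmetric]) simp
    finally have one: "(\<rho>\<^sup>2 / ?q t) powr (- 3 / 2) * \<rho> * ?g' t = 1" .
    have "ennreal x * ennreal y * ennreal z = ennreal (x * y * z)" if "0 \<le> x" "0 \<le> y" "0 \<le> z" for x y z
      using that by (simp add: ennreal_mult)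
    from this[of "(\<rho>\<^sup>2 / ?q t) powr (- 3 / 2)" \<rho> "?g' t"]
    have "ennreal ((\<rho>\<^sup>2 / ?q t) powr (- 3 / 2)) * ennreal \<rho> * ennreal (?g' t) = 1"
      using \<rho> unfolding one by simp
    moreover have "?f (?g t) = \<psi> (?g t) * (ennreal ((\<rho>\<^sup>2 / ?q t) powr (- 3 / 2)) * (ennreal \<rho> * indicator {..<1} (sqrt (?q t))))"
      using range[of t] by (simp only: one_minus i) (simp add: mult.assoc)
    moreover have "\<psi> (?g t) * (x * (y * j)) * z = \<psi> (?g t) * j * (x * y * z)" for x y z j
      by (simp only: mult_ac)
    ultimately show ?thesis by (simp only: mult_1_right)
  qed
  have cover: "(\<Union>n. {- real (Suc n)..real (Suc n)}) = UNIV"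
  proof -
    have "x \<in> (\<Union>n. {- real (Suc n)..real (Suc n)})" for x :: real
    proof -
      obtain n where "\<bar>x\<bar> < real n" using reals_Archimedean2 by blast
      then show ?thesis by (intro UN_I[of n]) auto
    qed
    then show ?thesis by auto
  qed
  have image: "s \<in> (\<Union>n. {?g (- real (Suc n))..?g (real (Suc n))})" if "-1 < s" "s < 1" for s
  proof -
    \<comment> \<open>The preimage of \<open>s\<close>.\<close>
    define h where "h = \<rho> * s / sqrt (1 - s\<^sup>2)"
    have pos: "0 < 1 - s\<^sup>2" using that by (simp add: abs_square_less_1 abs_less_iff)
    have "?q h = \<rho>\<^sup>2 / (1 - s\<^sup>2)"
      using pos by (simp add: h_def power_divide power_mult_distrib field_simps)
    then have gh: "?g h = s"
      using pos \<rho> by (simp add: h_def real_sqrt_divide)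
    obtain n where n: "\<bar>h\<bar> < real n" using reals_Archimedean2 by blast
    have mono: "?g x \<le> ?g y" if "x \<le> y" for x y
      using that by (intro DERIV_nonneg_imp_nondecreasing[of x y ?g]) (auto intro!: exI deriv)
    have "?g (- real (Suc n)) \<le> s" "s \<le> ?g (real (Suc n))"
      using mono[of "- real (Suc n)" h] mono[of h "real (Suc n)"] n gh by auto
    then show ?thesis by auto
  qed
  have "(\<integral>\<^sup>+t. \<psi> (?g t) * indicator {..<1} (sqrt (?q t)) \<partial>lborel)
      = (\<integral>\<^sup>+t. ?f (?g t) * ennreal (?g' t) * indicator (\<Union>n. {- real (Suc n)..real (Suc n)}) t \<partial>lborel)"
    unfolding cover by (simp only: cancel) simp
  also have "\<dots> = (\<integral>\<^sup>+s. ?f s * indicator (\<Union>n. {?g (- real (Suc n))..?g (real (Suc n))}) s \<partial>lborel)"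
  proof (rule nn_integral_substitution_exhaust[symmetric])
    show "(?g has_real_derivative ?g' t) (at t)" for t by (rule deriv)
    show "continuous_on {- real (Suc n)..real (Suc n)} ?g'" for n
      using q by (auto intro!: continuous_intros simp: less_imp_neq[symmetric])
  qed auto
  also have "\<dots> = (\<integral>\<^sup>+s. ?f s \<partial>lborel)"
    using image by (intro nn_integral_cong) (auto simp: indicator_def)
  finally show ?thesis .
qed

text \<open>
  Along each line parallel to \<open>e\<close> the direction cosine is taken as variable. Exchanging the integrals leaves, for fixed
  \<open>s\<close>, the integral of \<open>norm (perp e x)\<close> over a cylinder of radius \<open>sqrt (1 - s\<^sup>2)\<close>, which is a power of this radius
  by scaling. The missing constant is found from \<open>\<psi> = 1\<close> and the known area of the sphere.
\<close>

theorem nn_integral_sphere_slices: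
  fixes e :: "'a::euclidean_space" and \<psi> :: "real \<Rightarrow> ennreal"
  assumes dim: "2 \<le> DIM('a)" and e: "norm e = 1" and \<psi>: "\<psi> \<in> borel_measurable borel"
  shows "(\<integral>\<^sup>+\<sigma>. \<psi> (e \<bullet> \<sigma>) \<partial>sphere_measure) =
    slice_integral DIM('a) \<psi>"
proof -
  define N where "N = DIM('a)"
  let ?\<chi> = "indicator {0..<1} :: real \<Rightarrow> ennreal"
  let ?c = "\<lambda>s x. ?\<chi> (x \<bullet> e) * (ennreal (norm (perp e x)) * indicator {0<..} (sqrt (1 - s\<^sup>2) - norm (perp e x)))"
  let ?d = "\<lambda>s x. (ennreal (norm (perp e x)) * indicator {0<..} (sqrt (1 - s\<^sup>2) - norm (perp e x)))"
  let ?H = "\<lambda>a. \<integral>\<^sup>+x. ?\<chi> (x \<bullet> e) * (ennreal (norm (perp e x)) * indicator {0<..} (a - norm (perp e x))) \<partial>lborel"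
  have H: "?H a = ennreal (a ^ N) * ?H 1" if "0 < a" for a
  proof -
    have "?H a = ennreal (a ^ (N - 1)) * (\<integral>\<^sup>+x. ?\<chi> (x \<bullet> e) *
        (ennreal (norm (a *\<^sub>R perp e x)) * indicator {0<..} (a - norm (a *\<^sub>R perp e x))) \<partial>lborel)"
      unfolding N_def by (rule nn_integral_cylinder_scale[OF _ e that]) simp
    also have "(\<integral>\<^sup>+x. ?\<chi> (x \<bullet> e) * (ennreal (norm (a *\<^sub>R perp e x)) * indicator {0<..} (a - norm (a *\<^sub>R perp e x))) \<partial>lborel)
        = (\<integral>\<^sup>+x. ennreal a * (?\<chi> (x \<bullet> e) * (ennreal (norm (perp e x)) * indicator {0<..} (1 - norm (perp e x)))) \<partial>lborel)"
      using that by (intro nn_integral_cong) (auto simp: indicator_def ennreal_mult)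
    also have "\<dots> = ennreal a * ?H 1" by (rule nn_integral_cmult) simp
    finally show ?thesis
      using that dim by (cases N) (auto simp: N_def ennreal_mult mult_ac)
  qed
  \<comment> \<open>The value of this constant is found at the end, by comparing total masses.\<close>
  define c where "c = of_nat N * ?H 1"
  have slices: "(\<integral>\<^sup>+\<sigma>. \<psi> (e \<bullet> \<sigma>) \<partial>sphere_measure) = c * (\<integral>\<^sup>+s. \<psi> s * slice_weight N s \<partial>lborel)"
    if [measurable]: "\<psi> \<in> borel_measurable borel" for \<psi>
  proof -
    let ?w = "\<lambda>s. ennreal (indicator {-1<..<1} s * (1 - s\<^sup>2) powr (- 3 / 2))"
    have "(\<integral>\<^sup>+\<sigma>. \<psi> (e \<bullet> \<sigma>) \<partial>sphere_measure) = of_nat N * (\<integral>\<^sup>+x. \<psi> (e \<bullet> sgn x) * indicator {..<1} (norm x) \<partial>lborel)"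
      unfolding N_def by (rule nn_integral_sphere_measure) simp
    also have "(\<integral>\<^sup>+x. \<psi> (e \<bullet> sgn x) * indicator {..<1} (norm x) \<partial>lborel)
        = (\<integral>\<^sup>+x. ?\<chi> (x \<bullet> e) * (\<integral>\<^sup>+t. \<psi> (e \<bullet> sgn (perp e x + t *\<^sub>R e)) * indicator {..<1} (norm (perp e x + t *\<^sub>R e)) \<partial>lborel) \<partial>lborel)"
      by (rule nn_integral_line_decomposition[OF _ e]) simp
    also have "\<dots> = (\<integral>\<^sup>+x. ?\<chi> (x \<bullet> e) * (\<integral>\<^sup>+s. \<psi> s * ?w s * ?d s x \<partial>lborel) \<partial>lborel)"
      using AE_perp_nonzero[OF dim, of e]
    proof (intro nn_integral_cong_AE, eventually_elim)
      case (elim x)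
      have "e \<bullet> sgn (perp e x + t *\<^sub>R e) = t / sqrt (t\<^sup>2 + (norm (perp e x))\<^sup>2)" for t
        using e by (simp add: sgn_div_norm norm_perp_add_line inner_commute[of e] divide_inverse mult.commute)
      then show ?case
        using direction_cosine_substitution[OF that, of "norm (perp e x)"] elim e
        by (simp add: norm_perp_add_line)
    qed
    also have "\<dots> = (\<integral>\<^sup>+x. (\<integral>\<^sup>+s. \<psi> s * ?w s * (?c s x) \<partial>lborel) \<partial>lborel)"
    proof (rule nn_integral_cong)
      fix x :: 'a
      show "?\<chi> (x \<bullet> e) * (\<integral>\<^sup>+s. \<psi> s * ?w s * ?d s x \<partial>lborel)
          = (\<integral>\<^sup>+s. \<psi> s * ?w s * (?c s x) \<partial>lborel)"
        by (subst nn_integral_cmult[symmetric]) (simp_all only: mult_ac, measurable)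
    qed
    also have "\<dots> = (\<integral>\<^sup>+s. (\<integral>\<^sup>+x. \<psi> s * ?w s * (?c s x) \<partial>lborel) \<partial>lborel)"
      by (rule lborel_pair.Fubini') simp
    also have "\<dots> = (\<integral>\<^sup>+s. \<psi> s * ?w s * ?H (sqrt (1 - s\<^sup>2)) \<partial>lborel)"
      by (intro nn_integral_cong nn_integral_cmult) simp
    also have "\<dots> = (\<integral>\<^sup>+s. ?H 1 * (\<psi> s * slice_weight N s) \<partial>lborel)"
    proof (rule nn_integral_cong)
      fix s :: real
      show "\<psi> s * ?w s * ?H (sqrt (1 - s\<^sup>2)) = ?H 1 * (\<psi> s * slice_weight N s)"
      proof (cases "-1 < s \<and> s < 1")
        case True
        then have pos: "0 < 1 - s\<^sup>2" by (simp add: abs_square_less_1 abs_less_iff)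
        have "(1 - s\<^sup>2) powr (- 3 / 2) * sqrt (1 - s\<^sup>2) ^ N = (1 - s\<^sup>2) powr (- 3 / 2) * (1 - s\<^sup>2) powr (1 / 2 * real N)"
          using pos by (simp only: powr_powr[symmetric] powr_half_sqrt less_imp_le powr_realpow real_sqrt_gt_zero)
        also have "\<dots> = (1 - s\<^sup>2) powr ((real N - 3) / 2)"
          by (simp add: diff_divide_distrib flip: powr_add)
        finally have "slice_weight N s = ?w s * ennreal (sqrt (1 - s\<^sup>2) ^ N)"
          using True pos by (simp add: slice_weight_def flip: ennreal_mult)
        then show ?thesis
          using H[of "sqrt (1 - s\<^sup>2)"] pos by (simp add: mult_ac)
      qed (auto simp: slice_weight_def)
    qed
    also have "\<dots> = ?H 1 * (\<integral>\<^sup>+s. \<psi> s * slice_weight N s \<partial>lborel)"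
      by (rule nn_integral_cmult) simp
    finally show ?thesis by (simp add: c_def mult.assoc)
  qed
  have "c = ennreal (sphere_area (N - 2))"
  proof -
    define B where "B = Beta (1 / 2) ((real N - 1) / 2)"
    have N: "2 \<le> N" using dim by (simp add: N_def)
    have B: "0 < B"
      using N unfolding B_def Beta_def
      by (intro divide_pos_pos mult_pos_pos Gamma_real_pos) (auto simp: add_divide_distrib[symmetric])
    have "ennreal (sphere_area (N - 1)) = c * ennreal B"
      using slices[of "\<lambda>_. 1"] slice_weight_total[OF N] by (simp add: B_def N_def emeasure_sphere_measure_UNIV)
    also have "sphere_area (N - 1) = sphere_area (N - 2) * B"
    proof -
      define a where "a = (real N - 1) / 2"
      have a: "0 < a" "real N = 2 * a + 1" using N by (auto simp: a_def field_simps)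
      have "a \<notin> \<int>\<^sub>\<le>\<^sub>0" "a + 1 / 2 \<notin> \<int>\<^sub>\<le>\<^sub>0" using a by (auto elim!: nonpos_Ints_cases)
      then have g: "Gamma (a + 1 / 2 + 1) = (a + 1 / 2) * Gamma (a + 1 / 2)" "Gamma (a + 1) = a * Gamma a"
        by - (rule Gamma_plus1, assumption)+
      have pos: "0 < Gamma a" "0 < Gamma (a + 1 / 2)" using a by (auto intro!: Gamma_real_pos)
      have "real (N - 1 + 1) = 2 * a + 1" "real (N - 2 + 1) = 2 * a" using a N by auto
      then have "sphere_area (N - 1) = (2 * a + 1) * (pi powr (a + 1 / 2) / Gamma (a + 1 / 2 + 1))"
        "sphere_area (N - 2) = 2 * a * (pi powr a / Gamma (a + 1))"
        by (simp_all only: sphere_area_def unit_ball_vol_def add_divide_distrib) simp_all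
      moreover have "pi powr (a + 1 / 2) = pi powr a * sqrt pi" by (simp add: powr_add powr_half_sqrt)
      moreover have "B = sqrt pi * Gamma a / Gamma (a + 1 / 2)"
        by (simp only: B_def Beta_def Gamma_one_half_real add.commute[of "1 / 2"] flip: a_def)
      moreover have "(2 * a + 1) * (P * R / ((a + 1 / 2) * Y)) = 2 * a * (P / (a * X)) * (R * X / Y)"
        if "0 < X" "0 < Y" for P R X Y :: real
      proof -
        define c where "c = a + 1 / 2"
        have c: "2 * a + 1 = 2 * c" "0 < c" using a by (auto simp: c_def)
        then have "(2 * a + 1) * (P * R / (c * Y)) = 2 * (P * R / Y)" by simp
        also have "\<dots> = 2 * a * (P / (a * X)) * (R * X / Y)" using a that by simp
        finally show ?thesis by (simp only: c_def)
      qed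
      ultimately show ?thesis
        using pos unfolding g by (simp only:)
    qed
    finally have area: "ennreal (sphere_area (N - 2) * B) = c * ennreal B" .
    have "c = c * (ennreal B * ennreal (1 / B))" using B by (simp flip: ennreal_mult)
    also have "\<dots> = ennreal (sphere_area (N - 2) * B) * ennreal (1 / B)"
      by (simp only: area mult.assoc)
    also have "\<dots> = ennreal (sphere_area (N - 2) * B * (1 / B))"
      using B by (intro ennreal_mult''[symmetric]) simp
    also have "sphere_area (N - 2) * B * (1 / B) = sphere_area (N - 2)" using B by simp
    finally show ?thesis .
  qed
  then show ?thesis using slices[OF \<psi>] by (simp add: N_def)
qed

section \<open>Polar coordinates\<close>

lemma nn_integral_inverse_power_tail:
  assumes "0 < N" "0 < a"
  shows "(\<integral>\<^sup>+t. ennreal (real N / t ^ Suc N) * indicator {0<..} (t - a) \<partial>lborel) = ennreal (1 / a ^ N)"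
proof -
  have "(\<integral>\<^sup>+t. ennreal (real N / t ^ Suc N) * indicator {0<..} (t - a) \<partial>lborel)
      = (\<integral>\<^sup>+t. ennreal (real N / t ^ Suc N) * indicator {a..} t \<partial>lborel)"
    using AE_lborel_singleton[of a]
    by (intro nn_integral_cong_AE) (auto elim!: eventually_mono simp: indicator_def)
  also have "\<dots> = 0 - (- 1 / a ^ N)"
  proof (rule nn_integral_FTC_atLeast)
    show "((\<lambda>t. - 1 / t ^ N) has_real_derivative real N / t ^ Suc N) (at t)" if "a \<le> t" for t
    proof -
      have t: "t \<noteq> 0" using that assms by simp
      have "((\<lambda>t. - 1 / t ^ N) has_real_derivative (0 * t ^ N - (- 1) * (real N * (1 * t ^ (N - Suc 0)))) / (t ^ N * t ^ N)) (at t)"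
        using t by (intro derivative_eq_intros) auto
      moreover have "(0 * t ^ N - (- 1) * (real N * (1 * t ^ (N - Suc 0)))) / (t ^ N * t ^ N) = real N / t ^ Suc N"
        using t assms by (cases N) (auto simp: field_simps)
      ultimately show ?thesis by simp
    qed
    show "((\<lambda>t::real. - 1 / t ^ N) \<longlongrightarrow> 0) at_top"
      proof -
      have "filterlim (\<lambda>t::real. t ^ N) at_top at_top"
        using assms by (intro filterlim_pow_at_top filterlim_ident)
      then show ?thesis
        by (rule tendsto_divide_0[OF tendsto_const filterlim_at_top_imp_at_infinity])
    qed
  qed (use assms in auto)
  finally show ?thesis by simp
qed

text \<open>
  The spherical integral is an integral over the ball, so \<open>t \<sigma>\<close> becomes \<open>t (x / norm x)\<close>. Rescaling \<open>t\<close> by \<open>norm x\<close> and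
  then \<open>x\<close> by the new radius \<open>\<tau>\<close> puts \<open>\<Phi> x\<close> under the integral, and what remains is the integral of a power of
  \<open>\<tau>\<close> over \<open>\<tau> > norm x\<close>.
\<close>

theorem nn_integral_polar:
  fixes \<Phi> :: "'a::euclidean_space \<Rightarrow> ennreal"
  assumes [measurable]: "\<Phi> \<in> borel_measurable borel"
  shows "(\<integral>\<^sup>+x. \<Phi> x \<partial>lborel) =
    (\<integral>\<^sup>+t. ennreal (t ^ (DIM('a) - 1)) * indicator {0<..} t * (\<integral>\<^sup>+\<sigma>. \<Phi> (t *\<^sub>R \<sigma>) \<partial>sphere_measure) \<partial>lborel)"
proof -
  define N where "N = DIM('a)"
  have N: "0 < N" by (simp add: N_def)
  let ?p = "\<lambda>t::real. ennreal (t ^ (N - 1)) * indicator {0<..} t"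
  let ?ball = "\<lambda>x::'a. indicator {..<1} (norm x) :: ennreal"
  let ?A = "\<lambda>t x. of_nat N * ?ball x * (?p t * \<Phi> (t *\<^sub>R sgn x))"
  let ?B = "\<lambda>t x. of_nat N * ?ball x * (ennreal (norm x ^ N) * (?p t * \<Phi> (t *\<^sub>R x)))"
  let ?C = "\<lambda>t x. ennreal (real N / t ^ Suc N) * indicator {0<..} (t - norm x) * (ennreal (norm x ^ N) * \<Phi> x)"
  let ?D = "\<lambda>t x. ennreal (real N / t ^ Suc N) * indicator {0<..} (t - norm (t *\<^sub>R x)) * (ennreal (norm (t *\<^sub>R x) ^ N) * \<Phi> (t *\<^sub>R x))"
  have "(\<integral>\<^sup>+t. ?p t * (\<integral>\<^sup>+\<sigma>. \<Phi> (t *\<^sub>R \<sigma>) \<partial>sphere_measure) \<partial>lborel)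
      = (\<integral>\<^sup>+t. ?p t * (of_nat N * (\<integral>\<^sup>+x. \<Phi> (t *\<^sub>R sgn x) * ?ball x \<partial>lborel)) \<partial>lborel)"
    by (simp add: nn_integral_sphere_measure N_def)
  also have "\<dots> = (\<integral>\<^sup>+t. (\<integral>\<^sup>+x. ?A t x \<partial>lborel) \<partial>lborel)"
    by (simp add: nn_integral_cmult[symmetric] mult_ac)
  also have "\<dots> = (\<integral>\<^sup>+x. (\<integral>\<^sup>+t. ?A t x \<partial>lborel) \<partial>lborel)"
    by (rule lborel_pair.Fubini') simp
  also have "\<dots> = (\<integral>\<^sup>+x. (\<integral>\<^sup>+\<tau>. ?B \<tau> x \<partial>lborel) \<partial>lborel)"
    using AE_lborel_singleton[of "0::'a"]
  proof (intro nn_integral_cong_AE, eventually_elim)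
    case (elim x)
    have nx: "0 < norm x" using elim by simp
    have "(\<integral>\<^sup>+t. ?A t x \<partial>lborel)
        = ennreal (norm x) * (\<integral>\<^sup>+\<tau>. of_nat N * ?ball x * (?p (norm x * \<tau>) * \<Phi> ((norm x * \<tau>) *\<^sub>R sgn x)) \<partial>lborel)"
      using nx by (subst nn_integral_real_affine[of _ "norm x" 0]) simp_all
    also have "\<dots> = (\<integral>\<^sup>+\<tau>. ennreal (norm x) * (of_nat N * ?ball x * (?p (norm x * \<tau>) * \<Phi> ((norm x * \<tau>) *\<^sub>R sgn x))) \<partial>lborel)"
      by (rule nn_integral_cmult[symmetric]) simp
    also have "\<dots> = (\<integral>\<^sup>+\<tau>. ?B \<tau> x \<partial>lborel)"
    proof (rule nn_integral_cong)
      fix \<tau> :: real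
      have arg: "(norm x * \<tau>) *\<^sub>R sgn x = \<tau> *\<^sub>R x"
        using nx by (simp add: sgn_div_norm)
      have power: "ennreal (norm x) * ?p (norm x * \<tau>) = ennreal (norm x ^ N) * ?p \<tau>"
      proof (cases "0 < \<tau>")
        case True
        have "norm x * (norm x * \<tau>) ^ (N - 1) = norm x ^ N * \<tau> ^ (N - 1)"
          using N by (cases N) (auto simp: power_mult_distrib)
        moreover have "ennreal (norm x * (norm x * \<tau>) ^ (N - 1)) = ennreal (norm x) * ennreal ((norm x * \<tau>) ^ (N - 1))"
          "ennreal (norm x ^ N * \<tau> ^ (N - 1)) = ennreal (norm x ^ N) * ennreal (\<tau> ^ (N - 1))"
          using True nx by (auto intro!: ennreal_mult)
        moreover have "indicator {0<..} \<tau> = (1::ennreal)" "indicator {0<..} (norm x * \<tau>) = (1::ennreal)"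
          using True nx by (auto simp: indicator_def)
        ultimately show ?thesis by (simp only: mult_1_right)
      qed (use nx in \<open>auto simp: indicator_def zero_less_mult_iff\<close>)
      have shuffle: "a * (n * (p * f)) = n * (b * (q * f))" if "a * p = b * q" for a b n p q f :: ennreal
        by (metis (no_types) that mult.assoc mult.left_commute)
      show "ennreal (norm x) * (of_nat N * ?ball x * (?p (norm x * \<tau>) * \<Phi> ((norm x * \<tau>) *\<^sub>R sgn x)))
          = ?B \<tau> x"
        unfolding arg by (rule shuffle[OF power])
    qed
    finally show ?case .
  qed
  also have "\<dots> = (\<integral>\<^sup>+\<tau>. (\<integral>\<^sup>+x. ?B \<tau> x \<partial>lborel) \<partial>lborel)"
    by (rule lborel_pair.Fubini') simp
  also have "\<dots> = (\<integral>\<^sup>+\<tau>. (\<integral>\<^sup>+x. ?C \<tau> x \<partial>lborel) \<partial>lborel)"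
  proof (rule nn_integral_cong)
    fix \<tau> :: real
    show "(\<integral>\<^sup>+x. ?B \<tau> x \<partial>lborel)
       = (\<integral>\<^sup>+x. ?C \<tau> x \<partial>lborel)"
    proof (cases "0 < \<tau>")
      case True
      have "(\<integral>\<^sup>+x. ?C \<tau> x \<partial>lborel)
          = ennreal (\<tau> ^ N) * (\<integral>\<^sup>+x. ?D \<tau> x \<partial>lborel)"
        using True by (subst nn_integral_lborel_scale[of _ \<tau>]) (simp_all add: N_def)
      also have "\<dots> = (\<integral>\<^sup>+x. ennreal (\<tau> ^ N) * (?D \<tau> x) \<partial>lborel)"
        by (rule nn_integral_cmult[symmetric]) simp
      also have "\<dots> = (\<integral>\<^sup>+x. ?B \<tau> x \<partial>lborel)"
      proof (rule nn_integral_cong)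
        fix x :: 'a
        have "0 < \<tau> - norm (\<tau> *\<^sub>R x) \<longleftrightarrow> norm x < 1"
          using True by simp
        then have ind: "indicator {0<..} (\<tau> - norm (\<tau> *\<^sub>R x)) = ?ball x"
          by (simp add: indicator_def)
        have "\<tau> ^ N * (real N / \<tau> ^ Suc N) * (norm (\<tau> *\<^sub>R x) ^ N) = real N * norm x ^ N * \<tau> ^ (N - 1)"
          using True N by (cases N) (auto simp: power_mult_distrib field_simps)
        then have "ennreal (\<tau> ^ N * (real N / \<tau> ^ Suc N) * norm (\<tau> *\<^sub>R x) ^ N) = ennreal (real N * norm x ^ N * \<tau> ^ (N - 1))"
          by (simp only:)
        then have "ennreal (\<tau> ^ N) * ennreal (real N / \<tau> ^ Suc N) * ennreal (norm (\<tau> *\<^sub>R x) ^ N) = of_nat N * ennreal (norm x ^ N) * ennreal (\<tau> ^ (N - 1))"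
          using True by (simp only: ennreal_mult zero_le_power less_imp_le norm_ge_zero mult_nonneg_nonneg divide_nonneg_nonneg of_nat_0_le_iff ennreal_of_nat_eq_real_of_nat)
        then show "ennreal (\<tau> ^ N) * (?D \<tau> x)
          = ?B \<tau> x"
          using True unfolding ind by (simp add: indicator_def) (metis (no_types, lifting) mult.assoc)
      qed
      finally show ?thesis by simp
    next
      case False
      then have "indicator {0<..} (\<tau> - norm x) = (0::ennreal)" for x :: 'a
        using norm_ge_zero[of x] by (auto simp: indicator_def simp del: norm_ge_zero)
      then show ?thesis using False by simp
    qed
  qed
  also have "\<dots> = (\<integral>\<^sup>+x. (\<integral>\<^sup>+\<tau>. ?C \<tau> x \<partial>lborel) \<partial>lborel)"
    by (rule lborel_pair.Fubini') simp
  also have "\<dots> = (\<integral>\<^sup>+x. \<Phi> x \<partial>lborel)"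
    using AE_lborel_singleton[of "0::'a"]
  proof (intro nn_integral_cong_AE, eventually_elim)
    case (elim x)
    then have "ennreal (1 / norm x ^ N) * ennreal (norm x ^ N) = 1"
      by (subst ennreal_mult[symmetric]) auto
    moreover have "(\<integral>\<^sup>+\<tau>. ?C \<tau> x \<partial>lborel)
        = ennreal (1 / norm x ^ N) * (ennreal (norm x ^ N) * \<Phi> x)"
      using nn_integral_inverse_power_tail[OF N, of "norm x"] elim
      by (subst nn_integral_multc) (simp_all del: power_Suc)
    ultimately show ?case by (simp flip: mult.assoc)
  qed
  finally show ?thesis by (simp add: N_def)
qed

text \<open>
  In polar coordinates the direction of \<open>u\<close> and the vector \<open>\<sigma>\<close> range over the same sphere and can be exchanged. This is
  the passage from the relative velocity after a collision to the one before it.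
\<close>

lemma nn_integral_exchange_directions:
  fixes \<psi> :: "'a::euclidean_space \<Rightarrow> ennreal" and w :: "real \<Rightarrow> ennreal"
  assumes dim: "2 \<le> DIM('a)"
    and [measurable]: "\<psi> \<in> borel_measurable borel" "w \<in> borel_measurable borel"
  shows "(\<integral>\<^sup>+u. (\<integral>\<^sup>+\<sigma>. \<psi> (norm u *\<^sub>R \<sigma>) * w (sgn u \<bullet> \<sigma>) \<partial>sphere_measure) \<partial>lborel) =
    slice_integral DIM('a) w * (\<integral>\<^sup>+x. \<psi> x \<partial>lborel)"
proof -
  interpret pair_sigma_finite "sphere_measure :: 'a measure" "sphere_measure :: 'a measure"
    by standard
  let ?c = "slice_integral DIM('a) w"
  let ?p = "\<lambda>t::real. ennreal (t ^ (DIM('a) - 1)) * indicator {0<..} t"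
  let ?h = "\<lambda>t x s. \<psi> (norm (t *\<^sub>R x) *\<^sub>R s) * w (sgn (t *\<^sub>R x) \<bullet> s)"
  let ?k = "\<lambda>t x s. \<psi> (t *\<^sub>R s) * w (s \<bullet> x)"
  have "(\<integral>\<^sup>+u. (\<integral>\<^sup>+\<sigma>. \<psi> (norm u *\<^sub>R \<sigma>) * w (sgn u \<bullet> \<sigma>) \<partial>sphere_measure) \<partial>lborel)
      = (\<integral>\<^sup>+t. ?p t * (\<integral>\<^sup>+\<omega>. (\<integral>\<^sup>+\<sigma>. ?h t \<omega> \<sigma> \<partial>sphere_measure) \<partial>sphere_measure) \<partial>lborel)"
    by (rule nn_integral_polar) simp
  also have "\<dots> = (\<integral>\<^sup>+t. ?p t * (?c * (\<integral>\<^sup>+\<sigma>. \<psi> (t *\<^sub>R \<sigma>) \<partial>sphere_measure)) \<partial>lborel)"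
  proof (rule nn_integral_cong)
    fix t :: real
    show "?p t * (\<integral>\<^sup>+\<omega>. (\<integral>\<^sup>+\<sigma>. ?h t \<omega> \<sigma> \<partial>sphere_measure) \<partial>sphere_measure)
        = ?p t * (?c * (\<integral>\<^sup>+\<sigma>. \<psi> (t *\<^sub>R \<sigma>) \<partial>sphere_measure))"
    proof (cases "0 < t")
      case True
      have "(\<integral>\<^sup>+\<omega>. (\<integral>\<^sup>+\<sigma>. ?h t \<omega> \<sigma> \<partial>sphere_measure) \<partial>sphere_measure)
          = (\<integral>\<^sup>+\<omega>. (\<integral>\<^sup>+\<sigma>. ?k t \<omega> \<sigma> \<partial>sphere_measure) \<partial>sphere_measure)"
        using AE_sphere_norm[where 'a='a]
        by (rule nn_integral_cong_AE[OF eventually_mono])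
           (use True in \<open>simp add: sgn_div_norm inner_commute\<close>)
      also have "\<dots> = (\<integral>\<^sup>+\<sigma>. (\<integral>\<^sup>+\<omega>. ?k t \<omega> \<sigma> \<partial>sphere_measure) \<partial>sphere_measure)"
        by (rule Fubini') simp
      also have "\<dots> = (\<integral>\<^sup>+\<sigma>. ?c * \<psi> (t *\<^sub>R \<sigma>) \<partial>sphere_measure)"
        using AE_sphere_norm[where 'a='a]
      proof (intro nn_integral_cong_AE, eventually_elim)
        case (elim \<sigma>)
        then show ?case
          by (simp add: nn_integral_cmult nn_integral_sphere_slices[OF dim] mult.commute)
      qed
      finally show ?thesis by (simp add: nn_integral_cmult)
    qed simp
  qed
  also have "\<dots> = (\<integral>\<^sup>+t. ?c * (?p t * (\<integral>\<^sup>+\<sigma>. \<psi> (t *\<^sub>R \<sigma>) \<partial>sphere_measure)) \<partial>lborel)"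
    by (simp only: mult_ac)
  also have "\<dots> = ?c * (\<integral>\<^sup>+t. ?p t * (\<integral>\<^sup>+\<sigma>. \<psi> (t *\<^sub>R \<sigma>) \<partial>sphere_measure) \<partial>lborel)"
    by (rule nn_integral_cmult) simp
  finally show ?thesis
    by (simp add: nn_integral_polar[of \<psi>])
qed

section \<open>Shears along the directions of the sphere\<close>

text \<open>
  These three functions describe the shear of \<open>u\<close> to \<open>z = u + \<kappa> norm u e\<close> with a unit vector \<open>e\<close>. If \<open>s\<close> is the cosine
  of the angle between \<open>u\<close> and \<open>e\<close>, then \<open>norm z\<close> is \<open>norm u\<close> times the root of \<open>shear_sq \<kappa> s\<close>, and the
  angle between \<open>z\<close> and \<open>e\<close> has cosine \<open>sheared_cos \<kappa> s\<close>. The function \<open>unsheared_cos \<kappa>\<close>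
  recovers \<open>s\<close> by the law of sines.
\<close>

definition shear_sq :: "real \<Rightarrow> real \<Rightarrow> real" where
  "shear_sq \<kappa> s = 1 + \<kappa>\<^sup>2 + 2 * \<kappa> * s"

definition sheared_cos :: "real \<Rightarrow> real \<Rightarrow> real" where
  "sheared_cos \<kappa> s = (s + \<kappa>) / sqrt (shear_sq \<kappa> s)"

definition unsheared_cos :: "real \<Rightarrow> real \<Rightarrow> real" where
  "unsheared_cos \<kappa> \<tau> = \<tau> * sqrt (1 - \<kappa>\<^sup>2 * (1 - \<tau>\<^sup>2)) - \<kappa> * (1 - \<tau>\<^sup>2)"

lemma measurable_shear [measurable]:
  "shear_sq \<kappa> \<in> borel_measurable borel"
  "sheared_cos \<kappa> \<in> borel_measurable borel"
  "unsheared_cos \<kappa> \<in> borel_measurable borel"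
  unfolding shear_sq_def[abs_def] sheared_cos_def[abs_def] unsheared_cos_def[abs_def] by measurable

context
  fixes \<kappa> s :: real
  assumes \<kappa>: "-1 \<le> \<kappa>" and s: "0 \<le> s" "s < 1"
begin

lemma shear_jacobian_pos: "0 < 1 + \<kappa> * s"
proof -
  have "- s \<le> \<kappa> * s" using mult_right_mono[OF \<kappa> s(1)] by simp
  with s show ?thesis by simp
qed

lemma shear_sq_pos: "0 < shear_sq \<kappa> s"
proof -
  have "shear_sq \<kappa> s = (1 + \<kappa> * s)\<^sup>2 + \<kappa>\<^sup>2 * (1 - s\<^sup>2)"
    by (simp add: shear_sq_def power2_eq_square algebra_simps)
  moreover have "s\<^sup>2 \<le> 1" using s by (simp add: power_le_one)
  ultimately show ?thesis
    using shear_jacobian_pos by (simp add: add_pos_nonneg)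
qed

lemma one_minus_sheared_cos_sq: "1 - (sheared_cos \<kappa> s)\<^sup>2 = (1 - s\<^sup>2) / shear_sq \<kappa> s"
proof -
  have "(sheared_cos \<kappa> s)\<^sup>2 = (s + \<kappa>)\<^sup>2 / shear_sq \<kappa> s"
    using shear_sq_pos by (simp add: sheared_cos_def power_divide)
  moreover have "shear_sq \<kappa> s - (s + \<kappa>)\<^sup>2 = 1 - s\<^sup>2"
    by (simp add: shear_sq_def power2_eq_square algebra_simps)
  ultimately show ?thesis
    using shear_sq_pos by (simp add: eq_divide_eq left_diff_distrib)
qed

lemma unsheared_sheared_cos: "unsheared_cos \<kappa> (sheared_cos \<kappa> s) = s"
proof -
  let ?X = "shear_sq \<kappa> s"
  have X: "0 < ?X" by (rule shear_sq_pos)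
  have "?X - \<kappa>\<^sup>2 * (1 - s\<^sup>2) = (1 + \<kappa> * s)\<^sup>2"
    by (simp add: shear_sq_def power2_eq_square algebra_simps)
  then have "1 - \<kappa>\<^sup>2 * ((1 - s\<^sup>2) / ?X) = (1 + \<kappa> * s)\<^sup>2 / ?X"
    using X by (simp add: eq_divide_eq left_diff_distrib)
  then have "sqrt (1 - \<kappa>\<^sup>2 * ((1 - s\<^sup>2) / ?X)) = (1 + \<kappa> * s) / sqrt ?X"
    using shear_jacobian_pos by (simp add: real_sqrt_divide)
  then have "unsheared_cos \<kappa> (sheared_cos \<kappa> s) = (s + \<kappa>) / sqrt ?X * ((1 + \<kappa> * s) / sqrt ?X) - \<kappa> * ((1 - s\<^sup>2) / ?X)"
    unfolding unsheared_cos_def one_minus_sheared_cos_sq by (simp add: sheared_cos_def)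
  also have "\<dots> = ((s + \<kappa>) * (1 + \<kappa> * s) - \<kappa> * (1 - s\<^sup>2)) / ?X"
  proof -
    have "(s + \<kappa>) / sqrt ?X * ((1 + \<kappa> * s) / sqrt ?X) = (s + \<kappa>) * (1 + \<kappa> * s) / ?X" using X by simp
    then show ?thesis by (simp only: times_divide_eq_right diff_divide_distrib[symmetric])
  qed
  also have "(s + \<kappa>) * (1 + \<kappa> * s) - \<kappa> * (1 - s\<^sup>2) = s * ?X"
    by (simp add: shear_sq_def power2_eq_square algebra_simps)
  finally show ?thesis using X by simp
qed

lemma sheared_cos_less: "sheared_cos \<kappa> s < 1" "- 1 < sheared_cos \<kappa> s"
proof -
  have "s\<^sup>2 < 1" using s by (simp add: abs_square_less_1)
  then have "0 < 1 - (sheared_cos \<kappa> s)\<^sup>2"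
    using shear_sq_pos by (simp add: one_minus_sheared_cos_sq)
  then show "sheared_cos \<kappa> s < 1" "- 1 < sheared_cos \<kappa> s"
    by (auto simp: abs_square_less_1 abs_less_iff)
qed

lemma sheared_cos_deriv:
  "(sheared_cos \<kappa> has_real_derivative (1 + \<kappa> * s) * shear_sq \<kappa> s powr (- 3 / 2)) (at s)"
proof -
  define X where "X = shear_sq \<kappa> s"
  define Y where "Y = sqrt X"
  have X: "0 < X" by (simp add: X_def shear_sq_pos)
  have Y: "0 < Y" "X = Y * Y" using X by (auto simp: Y_def)
  have "((\<lambda>s. (s + \<kappa>) / sqrt (1 + \<kappa>\<^sup>2 + 2 * \<kappa> * s)) has_real_derivative
     (1 * Y - (s + \<kappa>) * ((2 * \<kappa>) * (inverse Y / 2))) / (Y * Y)) (at s)"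
    using X unfolding Y_def X_def shear_sq_def by (auto intro!: derivative_eq_intros)
  moreover have "(1 * Y - (s + \<kappa>) * ((2 * \<kappa>) * (inverse Y / 2))) / (Y * Y) = (Y * Y - (s + \<kappa>) * \<kappa>) * inverse (Y * Y * Y)"
    using Y(1) by (simp add: field_simps)
  moreover have "Y * Y - (s + \<kappa>) * \<kappa> = 1 + \<kappa> * s"
    unfolding Y(2)[symmetric] by (simp add: X_def shear_sq_def power2_eq_square algebra_simps)
  moreover have "inverse (Y * Y * Y) = X powr (- 3 / 2)"
  proof -
    have "X powr (- 3 / 2) = X powr (- (1 + 1 / 2))" by simp
    also have "\<dots> = inverse (X * sqrt X)"
      using X unfolding powr_minus powr_add by (simp add: powr_half_sqrt)
    finally show ?thesis by (simp only: Y_def[symmetric] Y(2)[symmetric])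
  qed
  ultimately show ?thesis
    by (simp add: sheared_cos_def[abs_def] shear_sq_def[abs_def] X_def)
qed

end

text \<open>
  The image of the cosines in \<open>[0,1)\<close>, written as a countable union of intervals so that it is a Borel set to which
  the substitution by exhaustion applies.
\<close>

definition sheared_cos_range :: "real \<Rightarrow> real set" where
  "sheared_cos_range \<kappa> = (\<Union>n. {sheared_cos \<kappa> 0..sheared_cos \<kappa> (1 - 1 / real (Suc (Suc n)))})"

lemma sets_sheared_cos_range [measurable]: "sheared_cos_range \<kappa> \<in> sets borel"
  unfolding sheared_cos_range_def by measurable

lemma less_one_if_in_closed_below_one:
  assumes "s \<in> {0..1 - 1 / real (Suc (Suc n))}"
  shows "0 \<le> s" "s < 1"
proof -
  have "s \<le> 1 - 1 / real (Suc (Suc n))" using assms by simp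
  also have "\<dots> < 1" by simp
  finally show "s < 1" .
qed (use assms in simp)

lemma UN_closed_below_one: "(\<Union>n. {0..1 - 1 / real (Suc (Suc n))}) = {0..<1}"
proof -
  have "s \<in> (\<Union>n. {0..1 - 1 / real (Suc (Suc n))})" if "0 \<le> s" "s < 1" for s
  proof -
    obtain n where "inverse (real (Suc n)) < 1 - s"
      using reals_Archimedean[of "1 - s"] \<open>s < 1\<close> by auto
    moreover have "1 / real (Suc (Suc n)) \<le> inverse (real (Suc n))"
      by (simp add: inverse_eq_divide frac_le)
    ultimately have "s \<in> {0..1 - 1 / real (Suc (Suc n))}"
      using that by simp
    then show ?thesis by blast
  qed
  then have "{0..<1} \<subseteq> (\<Union>n. {0..1 - 1 / real (Suc (Suc n))})"
    by (intro subsetI) simp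
  moreover have "{0..1 - 1 / real (Suc (Suc n))} \<subseteq> {0..<1}" for n
  proof
    fix s assume "s \<in> {0..1 - 1 / real (Suc (Suc n))}"
    from less_one_if_in_closed_below_one[OF this] show "s \<in> {0..<1}" by simp
  qed
  ultimately show ?thesis by (intro subset_antisym UN_least)
qed

lemma sheared_cos_in_range:
  assumes \<kappa>: "-1 \<le> \<kappa>" and s: "0 \<le> s" "s < 1"
  shows "sheared_cos \<kappa> s \<in> sheared_cos_range \<kappa>"
proof -
  have mono: "sheared_cos \<kappa> x \<le> sheared_cos \<kappa> y" if "0 \<le> x" "x \<le> y" "y < 1" for x y
  proof (rule DERIV_nonneg_imp_nondecreasing[OF \<open>x \<le> y\<close>])
    fix z assume "x \<le> z" "z \<le> y"
    then have z: "0 \<le> z" "z < 1" using that by auto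
    show "\<exists>d. (sheared_cos \<kappa> has_real_derivative d) (at z) \<and> 0 \<le> d"
      using sheared_cos_deriv[OF \<kappa> z] shear_jacobian_pos[OF \<kappa> z] by (auto intro!: exI)
  qed
  obtain n where n: "s \<le> 1 - 1 / real (Suc (Suc n))"
  proof -
    have "s \<in> (\<Union>n. {0..1 - 1 / real (Suc (Suc n))})"
      using s by (simp only: UN_closed_below_one) simp
    then show ?thesis using that by (auto simp del: of_nat_Suc)
  qed
  then have "sheared_cos \<kappa> s \<in> {sheared_cos \<kappa> 0..sheared_cos \<kappa> (1 - 1 / real (Suc (Suc n)))}"
    using s by (auto intro!: mono)
  then show ?thesis unfolding sheared_cos_range_def by blast
qed

text \<open>
  An angular weight expressed through the sheared cosine and divided by the Jacobian of the shear.
\<close>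

definition sheared_weight :: "real \<Rightarrow> (real \<Rightarrow> ennreal) \<Rightarrow> real \<Rightarrow> ennreal" where
  "sheared_weight \<kappa> w \<tau> = indicator (sheared_cos_range \<kappa>) \<tau> *
     (w (unsheared_cos \<kappa> \<tau>) * ennreal (1 / (1 + \<kappa> * unsheared_cos \<kappa> \<tau>)))"

lemma measurable_sheared_weight [measurable]:
  assumes [measurable]: "w \<in> borel_measurable borel"
  shows "sheared_weight \<kappa> w \<in> borel_measurable borel"
  unfolding sheared_weight_def[abs_def] by measurable

lemma sheared_weight_eq:
  assumes "-1 \<le> \<kappa>" "0 \<le> s" "s < 1"
  shows "sheared_weight \<kappa> w (sheared_cos \<kappa> s) = w s * ennreal (1 / (1 + \<kappa> * s))"
  using sheared_cos_in_range[OF assms] by (simp add: sheared_weight_def unsheared_sheared_cos[OF assms])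

text \<open>
  The factor \<open>1 + \<kappa> s\<close> in the derivative of the sheared cosine cancels the Jacobian. The powers of
  \<open>shear_sq \<kappa> s\<close> from the derivative and from the slice weight add up to \<open>- 3 / 2 - (d - 3) / 2 = - d / 2\<close>.
\<close>

lemma sheared_weight_total:
  assumes \<kappa>: "-1 \<le> \<kappa>" and [measurable]: "w \<in> borel_measurable borel"
  shows "(\<integral>\<^sup>+\<tau>. sheared_weight \<kappa> w \<tau> * slice_weight d \<tau> \<partial>lborel)
       \<le> (\<integral>\<^sup>+s. w s * ennreal (shear_sq \<kappa> s powr (- (real d / 2))) * slice_weight d s \<partial>lborel)"
proof -
  let ?W = "\<lambda>\<tau>. w (unsheared_cos \<kappa> \<tau>) * ennreal (1 / (1 + \<kappa> * unsheared_cos \<kappa> \<tau>)) * slice_weight d \<tau>"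
  let ?D = "\<lambda>s. (1 + \<kappa> * s) * shear_sq \<kappa> s powr (- 3 / 2)"
  have "(\<integral>\<^sup>+\<tau>. sheared_weight \<kappa> w \<tau> * slice_weight d \<tau> \<partial>lborel)
      = (\<integral>\<^sup>+\<tau>. ?W \<tau> * indicator (\<Union>n. {sheared_cos \<kappa> 0..sheared_cos \<kappa> (1 - 1 / real (Suc (Suc n)))}) \<tau> \<partial>lborel)"
    by (simp add: sheared_weight_def sheared_cos_range_def mult_ac)
  also have "\<dots> = (\<integral>\<^sup>+s. ?W (sheared_cos \<kappa> s) * ennreal (?D s) * indicator (\<Union>n. {0..1 - 1 / real (Suc (Suc n))}) s \<partial>lborel)"
  proof (rule nn_integral_substitution_exhaust)
    fix n :: nat and s :: real
    assume "s \<in> {0..1 - 1 / real (Suc (Suc n))}"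
    then have s: "0 \<le> s" "s < 1"
      by (rule less_one_if_in_closed_below_one)+
    show "(sheared_cos \<kappa> has_real_derivative ?D s) (at s)"
      by (rule sheared_cos_deriv[OF \<kappa> s])
    show "0 \<le> ?D s" using shear_jacobian_pos[OF \<kappa> s] by simp
  next
    fix n :: nat
    have "shear_sq \<kappa> s \<noteq> 0" if "s \<in> {0..1 - 1 / real (Suc (Suc n))}" for s
      using shear_sq_pos[OF \<kappa> less_one_if_in_closed_below_one[OF that]] by simp
    then show "continuous_on {0..1 - 1 / real (Suc (Suc n))} ?D"
      by (intro continuous_intros) (auto simp: shear_sq_def intro!: continuous_intros)
  next
    fix n :: nat
    have "1 / real (Suc (Suc n)) < 1" by simp
    then show "0 < 1 - 1 / real (Suc (Suc n))" by simp
    show "1 - 1 / real (Suc (Suc n)) \<le> 1 - 1 / real (Suc (Suc (Suc n)))"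
      by (intro diff_left_mono divide_left_mono) auto
  qed simp_all
  also have "\<dots> \<le> (\<integral>\<^sup>+s. w s * ennreal (shear_sq \<kappa> s powr (- (real d / 2))) * slice_weight d s \<partial>lborel)"
    unfolding UN_closed_below_one
  proof (rule nn_integral_mono)
    fix s :: real
    show "?W (sheared_cos \<kappa> s) * ennreal (?D s) * indicator {0..<1} s
        \<le> w s * ennreal (shear_sq \<kappa> s powr (- (real d / 2))) * slice_weight d s"
    proof (cases "0 \<le> s \<and> s < 1")
      case True
      then have s: "0 \<le> s" "s < 1" by auto
      let ?X = "shear_sq \<kappa> s" and ?k = "(real d - 3) / 2"
      have X: "0 < ?X" and J: "0 < 1 + \<kappa> * s"
        using shear_sq_pos[OF \<kappa> s] shear_jacobian_pos[OF \<kappa> s] by auto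
      have s2: "s\<^sup>2 \<le> 1" using s by (simp add: power_le_one)
      have "1 / (1 + \<kappa> * s) * (1 - (sheared_cos \<kappa> s)\<^sup>2) powr ?k * ?D s = ((1 - s\<^sup>2) / ?X) powr ?k * ?X powr (- 3 / 2)"
      proof -
        have "1 / j * a * (j * b) = a * b" if "0 < j" for j a b :: real using that by simp
        from this[OF J] show ?thesis unfolding one_minus_sheared_cos_sq[OF \<kappa> s] .
      qed
      also have "\<dots> = (1 - s\<^sup>2) powr ?k * (?X powr (- ?k) * ?X powr (- 3 / 2))"
      proof -
        have "((1 - s\<^sup>2) / ?X) powr k = (1 - s\<^sup>2) powr k * ?X powr (- k)" for k
          by (simp only: powr_divide powr_minus_divide times_divide_eq_right mult_1_right)
        then show ?thesis by (simp only: mult.assoc)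
      qed
      also have "?X powr (- ?k) * ?X powr (- 3 / 2) = ?X powr (- (real d / 2))"
        by (simp only: powr_add[symmetric]) (simp add: field_simps)
      finally have eq: "1 / (1 + \<kappa> * s) * (1 - (sheared_cos \<kappa> s)\<^sup>2) powr ?k * ?D s = (1 - s\<^sup>2) powr ?k * ?X powr (- (real d / 2))" .
      have "ennreal (1 / (1 + \<kappa> * s)) * slice_weight d (sheared_cos \<kappa> s) * ennreal (?D s)
         = ennreal (1 / (1 + \<kappa> * s) * (1 - (sheared_cos \<kappa> s)\<^sup>2) powr ?k * ?D s)"
      proof -
        have "slice_weight d (sheared_cos \<kappa> s) = ennreal ((1 - (sheared_cos \<kappa> s)\<^sup>2) powr ?k)"
          using sheared_cos_less[OF \<kappa> s] by (simp add: slice_weight_def)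
        moreover have "ennreal x * ennreal y * ennreal z = ennreal (x * y * z)" if "0 \<le> x" "0 \<le> y" "0 \<le> z" for x y z
          using that by (simp add: ennreal_mult)
        ultimately show ?thesis using J by simp
      qed
      also have "\<dots> = ennreal (?X powr (- (real d / 2))) * slice_weight d s"
        unfolding eq using s by (simp add: slice_weight_def ennreal_mult mult.commute)
      finally have key: "ennreal (1 / (1 + \<kappa> * s)) * slice_weight d (sheared_cos \<kappa> s) * ennreal (?D s)
          = ennreal (?X powr (- (real d / 2))) * slice_weight d s" .
      have "?W (sheared_cos \<kappa> s) * ennreal (?D s) * indicator {0..<1} s
          = w s * (ennreal (1 / (1 + \<kappa> * s)) * slice_weight d (sheared_cos \<kappa> s) * ennreal (?D s))"
        using s by (simp only: unsheared_sheared_cos[OF \<kappa> s]) (simp add: mult.assoc)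
      then show ?thesis unfolding key by (simp only: mult.assoc)
    qed (auto simp: indicator_def)
  qed
  finally show ?thesis .
qed

text \<open>
  The derivative of the map is \<open>1 + \<kappa> s\<close> with \<open>s = t / sqrt (t\<^sup>2 + \<rho>\<^sup>2)\<close>. It is positive for \<open>s\<close> in \<open>[0,1)\<close>, so
  the condition on the support of \<open>w\<close> confines the integral to a half-line on which the map is increasing.
\<close>

lemma nn_integral_shear_along_line:
  fixes \<phi> :: "real \<Rightarrow> ennreal" and w :: "real \<Rightarrow> ennreal"
  assumes \<kappa>: "-1 \<le> \<kappa>" and \<rho>: "0 < \<rho>"
    and [measurable]: "\<phi> \<in> borel_measurable borel" "w \<in> borel_measurable borel"
    and supp: "\<And>s. s \<notin> {0..1} \<Longrightarrow> w s = 0"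
  shows "(\<integral>\<^sup>+t. \<phi> (t + \<kappa> * sqrt (t\<^sup>2 + \<rho>\<^sup>2)) * w (t / sqrt (t\<^sup>2 + \<rho>\<^sup>2)) \<partial>lborel)
       \<le> (\<integral>\<^sup>+z. \<phi> z * sheared_weight \<kappa> w (z / sqrt (z\<^sup>2 + \<rho>\<^sup>2)) \<partial>lborel)"
proof -
  let ?R = "\<lambda>t. sqrt (t\<^sup>2 + \<rho>\<^sup>2)"
  let ?g = "\<lambda>t. t + \<kappa> * ?R t" and ?g' = "\<lambda>t. 1 + \<kappa> * (t / ?R t)"
  let ?f = "\<lambda>z. \<phi> z * sheared_weight \<kappa> w (z / ?R z)"
  have q: "0 < t\<^sup>2 + \<rho>\<^sup>2" for t using \<rho> by (simp add: add_nonneg_pos)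
  then have R: "0 < ?R t" for t by simp
  have cos_range: "0 \<le> t / ?R t" "t / ?R t < 1" if "0 \<le> t" for t
  proof -
    have "sqrt (t\<^sup>2) < ?R t" using \<rho> by (intro real_sqrt_less_mono) simp
    then show "t / ?R t < 1" using R[of t] that by simp
    show "0 \<le> t / ?R t" using R[of t] that by simp
  qed
  have cover: "(\<Union>n. {0..real (Suc n)}) = {0..}"
  proof -
    have "x \<in> (\<Union>n. {0..real (Suc n)})" if "0 \<le> x" for x :: real
    proof -
      obtain n where "x < real n" using reals_Archimedean2 by blast
      with that show ?thesis by (intro UN_I[of n]) auto
    qed
    then show ?thesis by auto
  qed
  have "\<phi> (?g t) * w (t / ?R t) = ?f (?g t) * ennreal (?g' t) * indicator {0..} t" for t
  proof (cases "0 \<le> t")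
    case True
    define s where "s = t / ?R t"
    have s: "0 \<le> s" "s < 1" using cos_range[OF True] by (auto simp: s_def)
    have t: "t = ?R t * s" using R[of t] by (simp add: s_def)
    have g: "?g t = ?R t * (s + \<kappa>)"
      by (simp only: distrib_left t[symmetric] mult.commute[of _ \<kappa>])
    moreover have "(?g t)\<^sup>2 + \<rho>\<^sup>2 = (?R t)\<^sup>2 * shear_sq \<kappa> s"
    proof -
      have "\<rho>\<^sup>2 = (?R t)\<^sup>2 - (?R t * s)\<^sup>2"
        using q[of t] unfolding t[symmetric] by simp
      moreover have "(R * (s + \<kappa>))\<^sup>2 + y = R\<^sup>2 * shear_sq \<kappa> s" if "y = R\<^sup>2 - (R * s)\<^sup>2" for R y
        using that by (simp add: shear_sq_def power2_eq_square algebra_simps)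
      ultimately show ?thesis unfolding g by blast
    qed
    ultimately have "?g t / ?R (?g t) = sheared_cos \<kappa> s"
      using R[of t] q[of t] \<rho> by (simp add: sheared_cos_def real_sqrt_mult)
    then have "?f (?g t) * ennreal (?g' t) = \<phi> (?g t) * w s * (ennreal (1 / (1 + \<kappa> * s)) * ennreal (1 + \<kappa> * s))"
      by (simp only: sheared_weight_eq[OF \<kappa> s] flip: s_def) (simp only: mult.assoc)
    also have "ennreal (1 / (1 + \<kappa> * s)) * ennreal (1 + \<kappa> * s) = 1"
      using shear_jacobian_pos[OF \<kappa> s] by (subst ennreal_mult[symmetric]) auto
    finally show ?thesis using True by (simp add: s_def)
  next
    case False
    then have "t / ?R t < 0" using R[of t] by (simp add: divide_neg_pos)
    then show ?thesis using False supp[of "t / ?R t"] by simp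
  qed
  then have "(\<integral>\<^sup>+t. \<phi> (?g t) * w (t / ?R t) \<partial>lborel)
      = (\<integral>\<^sup>+t. ?f (?g t) * ennreal (?g' t) * indicator (\<Union>n. {0..real (Suc n)}) t \<partial>lborel)"
    unfolding cover by (simp only:)
  also have "\<dots> = (\<integral>\<^sup>+z. ?f z * indicator (\<Union>n. {?g 0..?g (real (Suc n))}) z \<partial>lborel)"
  proof (rule nn_integral_substitution_exhaust[symmetric])
    fix n :: nat and t :: real
    assume "t \<in> {0..real (Suc n)}"
    then show "0 \<le> ?g' t"
      using shear_jacobian_pos[OF \<kappa> cos_range(1) cos_range(2), of t] by simp
    have "(?g has_real_derivative 1 + \<kappa> * ((2 * t) * (inverse (?R t) / 2))) (at t)"
      using q[of t] by (auto intro!: derivative_eq_intros)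
    moreover have "1 + \<kappa> * ((2 * t) * (inverse R / 2)) = 1 + \<kappa> * (t / R)" for R
      by (simp add: divide_simps)
    ultimately show "(?g has_real_derivative ?g' t) (at t)"
      by (simp only:)
  next
    fix n :: nat
    have "?R t \<noteq> 0" for t using R[of t] by (metis less_irrefl)
    then show "continuous_on {0..real (Suc n)} ?g'"
      by (intro continuous_intros) auto
  qed auto
  also have "\<dots> \<le> (\<integral>\<^sup>+z. ?f z \<partial>lborel)"
    by (intro nn_integral_mono) (simp add: indicator_def)
  finally show ?thesis .
qed

text \<open>
  The shear moves points along \<open>e\<close> only, so it maps each line parallel to \<open>e\<close> to itself.
\<close>

lemma nn_integral_shear:
  fixes \<phi> :: "'a::euclidean_space \<Rightarrow> ennreal" and w :: "real \<Rightarrow> ennreal"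
  assumes dim: "2 \<le> DIM('a)" and e: "norm e = 1" and \<kappa>: "-1 \<le> \<kappa>"
    and [measurable]: "\<phi> \<in> borel_measurable borel" "w \<in> borel_measurable borel"
    and supp: "\<And>s. s \<notin> {0..1} \<Longrightarrow> w s = 0"
  shows "(\<integral>\<^sup>+u. \<phi> (u + (\<kappa> * norm u) *\<^sub>R e) * w (sgn u \<bullet> e) \<partial>lborel)
       \<le> (\<integral>\<^sup>+z. \<phi> z * sheared_weight \<kappa> w (sgn z \<bullet> e) \<partial>lborel)"
proof -
  let ?\<chi> = "indicator {0..<1} :: real \<Rightarrow> ennreal"
  have "(\<integral>\<^sup>+u. \<phi> (u + (\<kappa> * norm u) *\<^sub>R e) * w (sgn u \<bullet> e) \<partial>lborel)
      = (\<integral>\<^sup>+x. ?\<chi> (x \<bullet> e) * (\<integral>\<^sup>+t. \<phi> (perp e x + t *\<^sub>R e + (\<kappa> * norm (perp e x + t *\<^sub>R e)) *\<^sub>R e)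
           * w (sgn (perp e x + t *\<^sub>R e) \<bullet> e) \<partial>lborel) \<partial>lborel)"
    by (rule nn_integral_line_decomposition[OF _ e]) simp
  also have "\<dots> \<le> (\<integral>\<^sup>+x. ?\<chi> (x \<bullet> e) * (\<integral>\<^sup>+t. \<phi> (perp e x + t *\<^sub>R e)
           * sheared_weight \<kappa> w (sgn (perp e x + t *\<^sub>R e) \<bullet> e) \<partial>lborel) \<partial>lborel)"
    using AE_perp_nonzero[OF dim, of e]
  proof (intro nn_integral_mono_AE, eventually_elim)
    case (elim x)
    have cos: "sgn (perp e x + t *\<^sub>R e) \<bullet> e = t / sqrt (t\<^sup>2 + (norm (perp e x))\<^sup>2)" for t
      using e by (simp add: sgn_div_norm norm_perp_add_line divide_inverse mult.commute)
    have line: "perp e x + t *\<^sub>R e + (\<kappa> * c) *\<^sub>R e = perp e x + (t + \<kappa> * c) *\<^sub>R e" for t c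
      by (simp add: algebra_simps)
    have "0 < norm (perp e x)" using elim by simp
    from nn_integral_shear_along_line[OF \<kappa> this, of "\<lambda>t. \<phi> (perp e x + t *\<^sub>R e)" w] supp
    show ?case unfolding cos norm_perp_add_line[OF e] line by (intro mult_left_mono) simp_all
  qed
  also have "\<dots> = (\<integral>\<^sup>+z. \<phi> z * sheared_weight \<kappa> w (sgn z \<bullet> e) \<partial>lborel)"
    by (rule nn_integral_line_decomposition[OF _ e, symmetric]) simp
  finally show ?thesis .
qed

text \<open>
  For fixed \<open>\<sigma>\<close> the variable \<open>u\<close> is replaced by its shear \<open>z\<close>. The resulting density depends on the angle between \<open>z\<close>
  and \<open>\<sigma>\<close> only, and so integrates over \<open>\<sigma>\<close> to a constant independent of \<open>z\<close>.
\<close>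

theorem nn_integral_sphere_shear:
  fixes \<phi> :: "'a::euclidean_space \<Rightarrow> ennreal" and w :: "real \<Rightarrow> ennreal"
  assumes dim: "2 \<le> DIM('a)" and \<kappa>: "-1 \<le> \<kappa>"
    and [measurable]: "\<phi> \<in> borel_measurable borel" "w \<in> borel_measurable borel"
    and supp: "\<And>s. s \<notin> {0..1} \<Longrightarrow> w s = 0"
  shows "(\<integral>\<^sup>+u. (\<integral>\<^sup>+\<sigma>. \<phi> (u + (\<kappa> * norm u) *\<^sub>R \<sigma>) * w (sgn u \<bullet> \<sigma>) \<partial>sphere_measure) \<partial>lborel)
       \<le> slice_integral DIM('a) (\<lambda>s. w s * ennreal (shear_sq \<kappa> s powr (- (real DIM('a) / 2)))) *
          (\<integral>\<^sup>+x. \<phi> x \<partial>lborel)"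
proof -
  interpret pair_sigma_finite "lborel :: 'a measure" "sphere_measure :: 'a measure"
    by standard
  let ?W = "sheared_weight \<kappa> w"
  let ?I = "\<integral>\<^sup>+\<tau>. ?W \<tau> * slice_weight DIM('a) \<tau> \<partial>lborel"
  have "(\<integral>\<^sup>+u. (\<integral>\<^sup>+\<sigma>. \<phi> (u + (\<kappa> * norm u) *\<^sub>R \<sigma>) * w (sgn u \<bullet> \<sigma>) \<partial>sphere_measure) \<partial>lborel)
      = (\<integral>\<^sup>+\<sigma>. (\<integral>\<^sup>+u. \<phi> (u + (\<kappa> * norm u) *\<^sub>R \<sigma>) * w (sgn u \<bullet> \<sigma>) \<partial>lborel) \<partial>sphere_measure)"
    by (rule Fubini'[symmetric]) simp
  also have "\<dots> \<le> (\<integral>\<^sup>+\<sigma>. (\<integral>\<^sup>+z. \<phi> z * ?W (sgn z \<bullet> \<sigma>) \<partial>lborel) \<partial>sphere_measure)"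
    using AE_sphere_norm[where 'a='a]
  proof (intro nn_integral_mono_AE, eventually_elim)
    case (elim \<sigma>)
    then show ?case by (intro nn_integral_shear[OF dim _ \<kappa>] supp) auto
  qed
  also have "\<dots> = (\<integral>\<^sup>+z. (\<integral>\<^sup>+\<sigma>. \<phi> z * ?W (sgn z \<bullet> \<sigma>) \<partial>sphere_measure) \<partial>lborel)"
    by (rule Fubini') simp
  also have "\<dots> = (\<integral>\<^sup>+z. \<phi> z * (ennreal (sphere_area (DIM('a) - 2)) * ?I) \<partial>lborel)"
    using AE_lborel_singleton[of "0::'a"]
  proof (intro nn_integral_cong_AE, eventually_elim)
    case (elim z)
    then have "norm (sgn z) = 1" by (simp add: norm_sgn)
    then show ?case
      by (simp add: nn_integral_cmult nn_integral_sphere_slices[OF dim])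
  qed
  also have "\<dots> = ennreal (sphere_area (DIM('a) - 2)) * ?I * (\<integral>\<^sup>+x. \<phi> x \<partial>lborel)"
    by (simp add: nn_integral_multc mult.commute)
  also have "\<dots> \<le> slice_integral DIM('a) (\<lambda>s. w s * ennreal (shear_sq \<kappa> s powr (- (real DIM('a) / 2)))) *
          (\<integral>\<^sup>+x. \<phi> x \<partial>lborel)"
    by (intro mult_mono sheared_weight_total \<kappa>) auto
  finally show ?thesis .
qed

section \<open>The gain operator of one pair of species without the kinetic factor\<close>

text \<open>
  The vectors by which the two velocities after the collision differ from \<open>v\<close>, as functions of the relative velocity
  \<open>u\<close>. Both are multiples of shears of \<open>u\<close>.
\<close>

definition displ :: "real \<Rightarrow> 'a::euclidean_space \<Rightarrow> 'a \<Rightarrow> 'a" where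
  "displ \<rho> u \<sigma> = (1 - \<rho>) *\<^sub>R (u - norm u *\<^sub>R \<sigma>)"

definition displ_s :: "real \<Rightarrow> 'a::euclidean_space \<Rightarrow> 'a \<Rightarrow> 'a" where
  "displ_s \<rho> u \<sigma> = (1 - \<rho>) *\<^sub>R u + (\<rho> * norm u) *\<^sub>R \<sigma>"

lemma displ_s_minus_displ: "displ_s \<rho> u \<sigma> - displ \<rho> u \<sigma> = norm u *\<^sub>R \<sigma>"
  by (simp add: displ_def displ_s_def algebra_simps)

lemma post_v_eq: "post_v \<rho> v vs \<sigma> = v - displ \<rho> (v - vs) \<sigma>"
  by (simp add: post_v_def displ_def algebra_simps)

lemma post_vs_eq: "post_vs \<rho> v vs \<sigma> = v - displ_s \<rho> (v - vs) \<sigma>"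
  by (simp add: post_vs_def displ_s_def algebra_simps)

lemma measurable_displ [measurable]:
  assumes [measurable]: "f \<in> borel_measurable M" "g \<in> borel_measurable M"
  shows "(\<lambda>x. displ \<rho> (f x) (g x)) \<in> borel_measurable M"
    and "(\<lambda>x. displ_s \<rho> (f x) (g x)) \<in> borel_measurable M"
  unfolding displ_def displ_s_def by measurable

text \<open>
  The squared lengths of \<open>displ \<rho> u \<sigma>\<close> and \<open>displ_s \<rho> u \<sigma>\<close> relative to that of \<open>u\<close>, where \<open>s\<close>
  is the cosine of the angle between \<open>u\<close> and \<open>\<sigma>\<close>. They are the bases of the powers in the constants.
\<close>

definition minus_sq :: "real \<Rightarrow> real \<Rightarrow> real" where
  "minus_sq \<rho> s = (1 - \<rho>)\<^sup>2 * (2 - 2 * s)"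

definition plus_sq :: "real \<Rightarrow> real \<Rightarrow> real" where
  "plus_sq \<rho> s = \<rho> * (1 - \<rho>) * (1 / (\<rho> * (1 - \<rho>)) - 2 + 2 * s)"

lemma measurable_displ_sq [measurable]:
  "minus_sq \<rho> \<in> borel_measurable borel" "plus_sq \<rho> \<in> borel_measurable borel"
  unfolding minus_sq_def[abs_def] plus_sq_def[abs_def] by measurable

lemma minus_sq_pos: "\<rho> < 1 \<Longrightarrow> s < 1 \<Longrightarrow> 0 < minus_sq \<rho> s"
  by (simp add: minus_sq_def)

lemma plus_sq_eq:
  assumes "0 < \<rho>" "\<rho> < 1"
  shows "plus_sq \<rho> s = (1 - \<rho>)\<^sup>2 + \<rho>\<^sup>2 + 2 * \<rho> * (1 - \<rho>) * s"
proof -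
  have "\<rho> * (1 - \<rho>) \<noteq> 0" using assms by simp
  then have "plus_sq \<rho> s = 1 - 2 * (\<rho> * (1 - \<rho>)) + 2 * (\<rho> * (1 - \<rho>)) * s"
    by (simp only: plus_sq_def distrib_left right_diff_distrib) simp
  then show ?thesis by (simp add: power2_eq_square algebra_simps)
qed

lemma plus_sq_pos: "0 < \<rho> \<Longrightarrow> \<rho> < 1 \<Longrightarrow> 0 \<le> s \<Longrightarrow> 0 < plus_sq \<rho> s"
  by (simp add: plus_sq_eq add_pos_nonneg)

lemma nn_integral_sphere_shear_scaled:
  fixes \<phi> :: "'a::euclidean_space \<Rightarrow> ennreal" and w :: "real \<Rightarrow> ennreal"
  assumes dim: "2 \<le> DIM('a)" and \<kappa>: "-1 \<le> \<kappa>" and \<alpha>: "0 < \<alpha>"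
    and [measurable]: "\<phi> \<in> borel_measurable borel" "w \<in> borel_measurable borel"
    and supp: "\<And>s. s \<notin> {0..1} \<Longrightarrow> w s = 0"
  shows "(\<integral>\<^sup>+u. (\<integral>\<^sup>+\<sigma>. \<phi> (v - \<alpha> *\<^sub>R (u + (\<kappa> * norm u) *\<^sub>R \<sigma>)) * w (sgn u \<bullet> \<sigma>) \<partial>sphere_measure) \<partial>lborel)
       \<le> slice_integral DIM('a) (\<lambda>s. w s * ennreal ((\<alpha>\<^sup>2 * shear_sq \<kappa> s) powr (- (real DIM('a) / 2)))) *
          (\<integral>\<^sup>+x. \<phi> x \<partial>lborel)"
proof -
  let ?N = "DIM('a)"
  let ?S = "ennreal (sphere_area (?N - 2))"
  let ?I = "\<integral>\<^sup>+s. w s * ennreal (shear_sq \<kappa> s powr (- (real ?N / 2))) * slice_weight ?N s \<partial>lborel"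
  have "(\<integral>\<^sup>+u. (\<integral>\<^sup>+\<sigma>. \<phi> (v - \<alpha> *\<^sub>R (u + (\<kappa> * norm u) *\<^sub>R \<sigma>)) * w (sgn u \<bullet> \<sigma>) \<partial>sphere_measure) \<partial>lborel)
      \<le> ?S * ?I * (\<integral>\<^sup>+x. \<phi> (v - \<alpha> *\<^sub>R x) \<partial>lborel)"
    by (rule nn_integral_sphere_shear[OF dim \<kappa>, where \<phi> = "\<lambda>x. \<phi> (v - \<alpha> *\<^sub>R x)"]) (simp_all add: supp)
  also have "(\<integral>\<^sup>+x. \<phi> (v - \<alpha> *\<^sub>R x) \<partial>lborel) = ennreal ((\<alpha>\<^sup>2) powr (- (real ?N / 2))) * (\<integral>\<^sup>+x. \<phi> x \<partial>lborel)"
  proof -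
    have "(\<integral>\<^sup>+x. \<phi> x \<partial>lborel) = (\<integral>\<^sup>+x. \<phi> (v - x) \<partial>lborel)"
      by (simp add: nn_integral_lborel_reflect)
    also have "\<dots> = ennreal (\<alpha> ^ ?N) * (\<integral>\<^sup>+x. \<phi> (v - \<alpha> *\<^sub>R x) \<partial>lborel)"
      using \<alpha> by (subst nn_integral_lborel_scale[of _ \<alpha>]) simp_all
    finally have "ennreal ((\<alpha>\<^sup>2) powr (- (real ?N / 2))) * (\<integral>\<^sup>+x. \<phi> x \<partial>lborel) =
        ennreal ((\<alpha>\<^sup>2) powr (- (real ?N / 2))) * ennreal (\<alpha> ^ ?N) * (\<integral>\<^sup>+x. \<phi> (v - \<alpha> *\<^sub>R x) \<partial>lborel)"
      by (simp only: mult.assoc)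
    also have "ennreal ((\<alpha>\<^sup>2) powr (- (real ?N / 2))) * ennreal (\<alpha> ^ ?N) = 1"
    proof -
      have "(\<alpha>\<^sup>2) powr (- (real ?N / 2)) = \<alpha> powr (- real ?N)"
        using \<alpha> powr_powr[of \<alpha> 2 "- (real ?N / 2)"] by simp
      moreover have "\<alpha> ^ ?N = \<alpha> powr real ?N" using \<alpha> by (simp add: powr_realpow)
      ultimately have "(\<alpha>\<^sup>2) powr (- (real ?N / 2)) * \<alpha> ^ ?N = 1"
        using \<alpha> by (simp add: powr_add[symmetric])
      then show ?thesis using \<alpha> by (subst ennreal_mult[symmetric]) auto
    qed
    finally show ?thesis by simp
  qed
  also have "?S * ?I * (ennreal ((\<alpha>\<^sup>2) powr (- (real ?N / 2))) * (\<integral>\<^sup>+x. \<phi> x \<partial>lborel))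
      = ?S * (ennreal ((\<alpha>\<^sup>2) powr (- (real ?N / 2))) * ?I) * (\<integral>\<^sup>+x. \<phi> x \<partial>lborel)"
    by (simp only: mult_ac)
  also have "ennreal ((\<alpha>\<^sup>2) powr (- (real ?N / 2))) * ?I
      = (\<integral>\<^sup>+s. ennreal ((\<alpha>\<^sup>2) powr (- (real ?N / 2))) * (w s * ennreal (shear_sq \<kappa> s powr (- (real ?N / 2))) * slice_weight ?N s) \<partial>lborel)"
    by (rule nn_integral_cmult[symmetric]) simp
  also have "\<dots> = (\<integral>\<^sup>+s. w s * ennreal ((\<alpha>\<^sup>2 * shear_sq \<kappa> s) powr (- (real ?N / 2))) * slice_weight ?N s \<partial>lborel)"
    by (simp add: powr_mult ennreal_mult mult_ac)
  finally show ?thesis .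
qed

context
  fixes \<rho> :: real
  assumes \<rho>: "0 < \<rho>" "\<rho> < 1"
begin

lemma nn_integral_displ:
  fixes \<phi> :: "'a::euclidean_space \<Rightarrow> ennreal" and w :: "real \<Rightarrow> ennreal"
  assumes dim: "2 \<le> DIM('a)"
    and [measurable]: "\<phi> \<in> borel_measurable borel" "w \<in> borel_measurable borel"
    and supp: "\<And>s. s \<notin> {0..1} \<Longrightarrow> w s = 0"
  shows "(\<integral>\<^sup>+u. (\<integral>\<^sup>+\<sigma>. \<phi> (v - displ \<rho> u \<sigma>) * w (sgn u \<bullet> \<sigma>) \<partial>sphere_measure) \<partial>lborel)
       \<le> slice_integral DIM('a) (\<lambda>s. w s * ennreal (minus_sq \<rho> s powr (- (real DIM('a) / 2)))) *
          (\<integral>\<^sup>+x. \<phi> x \<partial>lborel)"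
  using nn_integral_sphere_shear_scaled[OF dim, of "-1" "1 - \<rho>" \<phi> w v] \<rho> supp
  by (simp add: displ_def minus_sq_def shear_sq_def)

lemma nn_integral_displ_s:
  fixes \<phi> :: "'a::euclidean_space \<Rightarrow> ennreal" and w :: "real \<Rightarrow> ennreal"
  assumes dim: "2 \<le> DIM('a)"
    and [measurable]: "\<phi> \<in> borel_measurable borel" "w \<in> borel_measurable borel"
    and supp: "\<And>s. s \<notin> {0..1} \<Longrightarrow> w s = 0"
  shows "(\<integral>\<^sup>+u. (\<integral>\<^sup>+\<sigma>. \<phi> (v - displ_s \<rho> u \<sigma>) * w (sgn u \<bullet> \<sigma>) \<partial>sphere_measure) \<partial>lborel)
       \<le> slice_integral DIM('a) (\<lambda>s. w s * ennreal (plus_sq \<rho> s powr (- (real DIM('a) / 2)))) *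
          (\<integral>\<^sup>+x. \<phi> x \<partial>lborel)"
proof -
  let ?\<kappa> = "\<rho> / (1 - \<rho>)"
  have \<kappa>: "(1 - \<rho>) * ?\<kappa> = \<rho>" "0 < ?\<kappa>" using \<rho> by auto
  have "displ_s \<rho> u \<sigma> = (1 - \<rho>) *\<^sub>R (u + (?\<kappa> * norm u) *\<^sub>R \<sigma>)" for u \<sigma> :: 'a
    unfolding displ_s_def scaleR_add_right scaleR_scaleR mult.assoc[symmetric] \<kappa> ..
  moreover have "(1 - \<rho>)\<^sup>2 * shear_sq ?\<kappa> s = plus_sq \<rho> s" for s
  proof -
    have "(1 - \<rho>)\<^sup>2 * shear_sq k s = (1 - \<rho>)\<^sup>2 + ((1 - \<rho>) * k)\<^sup>2 + 2 * ((1 - \<rho>) * k) * (1 - \<rho>) * s" for k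
      by (simp add: shear_sq_def power2_eq_square algebra_simps)
    from this[of ?\<kappa>] show ?thesis unfolding \<kappa> plus_sq_eq[OF \<rho>] .
  qed
  ultimately show ?thesis
    using nn_integral_sphere_shear_scaled[OF dim _ _ assms(2,3) supp, of ?\<kappa> "1 - \<rho>" v] \<kappa> \<rho> by simp
qed

end

definition pair_gain :: "real \<Rightarrow> (real \<Rightarrow> ennreal) \<Rightarrow> ('a::euclidean_space \<Rightarrow> ennreal) \<Rightarrow> ('a \<Rightarrow> ennreal) \<Rightarrow> 'a \<Rightarrow> ennreal" where
  "pair_gain \<rho> w f g v =
     (\<integral>\<^sup>+u. (\<integral>\<^sup>+\<sigma>. f (v - displ \<rho> u \<sigma>) * g (v - displ_s \<rho> u \<sigma>) * w (sgn u \<bullet> \<sigma>) \<partial>sphere_measure) \<partial>lborel)"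

lemma measurable_pair_gain [measurable]:
  assumes [measurable]: "w \<in> borel_measurable borel" "f \<in> borel_measurable borel" "g \<in> borel_measurable borel"
  shows "pair_gain \<rho> w f g \<in> borel_measurable borel"
  unfolding pair_gain_def[abs_def] by measurable

text \<open>
  For fixed \<open>u\<close> and \<open>\<sigma>\<close>, the arguments of \<open>f\<close> and \<open>g\<close> differ by \<open>norm u *\<^sub>R \<sigma>\<close>. After a translation in \<open>v\<close>
  the factor \<open>f\<close> no longer depends on them, and the exchange of directions evaluates the rest.
\<close>

lemma nn_integral_pair_gain:
  fixes f g :: "'a::euclidean_space \<Rightarrow> ennreal"
  assumes dim: "2 \<le> DIM('a)"
    and [measurable]: "w \<in> borel_measurable borel" "f \<in> borel_measurable borel" "g \<in> borel_measurable borel"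
  shows "(\<integral>\<^sup>+v. pair_gain \<rho> w f g v \<partial>lborel) =
    slice_integral DIM('a) w *
      (\<integral>\<^sup>+x. f x \<partial>lborel) * (\<integral>\<^sup>+x. g x \<partial>lborel)"
proof -
  interpret LS: pair_sigma_finite "lborel :: 'a measure" "sphere_measure :: 'a measure"
    by standard
  let ?j = "\<lambda>u t v. f (v - displ \<rho> u t) * g (v - displ_s \<rho> u t) * w (sgn u \<bullet> t)"
  let ?k = "\<lambda>u t z. f z * (g (z - norm u *\<^sub>R t) * w (sgn u \<bullet> t))"
  let ?c = "slice_integral DIM('a) w"
  have "(\<integral>\<^sup>+v. pair_gain \<rho> w f g v \<partial>lborel)
      = (\<integral>\<^sup>+u. (\<integral>\<^sup>+v. (\<integral>\<^sup>+\<sigma>. ?j u \<sigma> v \<partial>sphere_measure) \<partial>lborel) \<partial>lborel)"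
    unfolding pair_gain_def by (rule lborel_pair.Fubini') simp
  also have "\<dots> = (\<integral>\<^sup>+u. (\<integral>\<^sup>+\<sigma>. (\<integral>\<^sup>+v. ?j u \<sigma> v \<partial>lborel) \<partial>sphere_measure) \<partial>lborel)"
    by (intro nn_integral_cong LS.Fubini'[symmetric]) simp
  also have "\<dots> = (\<integral>\<^sup>+u. (\<integral>\<^sup>+\<sigma>. (\<integral>\<^sup>+z. ?k u \<sigma> z \<partial>lborel) \<partial>sphere_measure) \<partial>lborel)"
  proof (rule nn_integral_cong, rule nn_integral_cong)
    fix u \<sigma> :: 'a
    let ?h = "\<lambda>z. ?k u \<sigma> z"
    have "- displ \<rho> u \<sigma> + v = v - displ \<rho> u \<sigma>" "v - displ \<rho> u \<sigma> - norm u *\<^sub>R \<sigma> = v - displ_s \<rho> u \<sigma>" for v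
      unfolding displ_s_minus_displ[of \<rho>, symmetric] by simp_all
    then have "?h (- displ \<rho> u \<sigma> + v) = ?j u \<sigma> v" for v
      by (simp only: mult.assoc)
    then show "(\<integral>\<^sup>+v. ?j u \<sigma> v \<partial>lborel) = (\<integral>\<^sup>+z. ?h z \<partial>lborel)"
      by (subst nn_integral_lborel_translate[of ?h "- displ \<rho> u \<sigma>", symmetric]) simp_all
  qed
  also have "\<dots> = (\<integral>\<^sup>+u. (\<integral>\<^sup>+z. (\<integral>\<^sup>+\<sigma>. ?k u \<sigma> z \<partial>sphere_measure) \<partial>lborel) \<partial>lborel)"
    by (intro nn_integral_cong LS.Fubini') simp
  also have "\<dots> = (\<integral>\<^sup>+z. (\<integral>\<^sup>+u. (\<integral>\<^sup>+\<sigma>. ?k u \<sigma> z \<partial>sphere_measure) \<partial>lborel) \<partial>lborel)"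
    by (rule lborel_pair.Fubini') simp
  also have "\<dots> = (\<integral>\<^sup>+z. f z * (?c * (\<integral>\<^sup>+x. g x \<partial>lborel)) \<partial>lborel)"
  proof (rule nn_integral_cong)
    fix z :: 'a
    have "(\<integral>\<^sup>+u. (\<integral>\<^sup>+\<sigma>. ?k u \<sigma> z \<partial>sphere_measure) \<partial>lborel)
        = f z * (\<integral>\<^sup>+u. (\<integral>\<^sup>+\<sigma>. g (z - norm u *\<^sub>R \<sigma>) * w (sgn u \<bullet> \<sigma>) \<partial>sphere_measure) \<partial>lborel)"
      by (simp add: nn_integral_cmult)
    also have "\<dots> = f z * (?c * (\<integral>\<^sup>+x. g (z - x) \<partial>lborel))"
      using nn_integral_exchange_directions[OF dim, of "\<lambda>x. g (z - x)" w] by simp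
    finally show "(\<integral>\<^sup>+u. (\<integral>\<^sup>+\<sigma>. ?k u \<sigma> z \<partial>sphere_measure) \<partial>lborel)
        = f z * (?c * (\<integral>\<^sup>+x. g x \<partial>lborel))"
      by (simp add: nn_integral_lborel_reflect)
  qed
  also have "\<dots> = (\<integral>\<^sup>+x. f x \<partial>lborel) * (?c * (\<integral>\<^sup>+x. g x \<partial>lborel))"
    by (rule nn_integral_multc) simp
  finally show ?thesis by (simp only: mult_ac)
qed

text \<open>
  The Hoelder splitting of the gain distributes powers of the squared lengths over its three factors. This is the weight
  for which the three resulting angular integrals coincide.
\<close>

definition Holder_weight :: "nat \<Rightarrow> real \<Rightarrow> real \<Rightarrow> real \<Rightarrow> real \<Rightarrow> ennreal" where
  "Holder_weight N \<rho> b c s = ennreal (minus_sq \<rho> s powr (- (real N * b / 2)) * plus_sq \<rho> s powr (- (real N * c / 2)))"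

lemma measurable_Holder_weight [measurable]: "Holder_weight N \<rho> b c \<in> borel_measurable borel"
  unfolding Holder_weight_def[abs_def] by measurable

lemma enn_powr_ennreal_powr:
  assumes "0 < x" "0 \<le> b"
  shows "enn_powr (ennreal (x powr t)) b = ennreal (x powr (t * b))"
  using assms by (cases "b = 0") (simp_all add: enn_powr_ennreal powr_powr)

lemma Holder_weight_cancel:
  assumes "0 < minus_sq \<rho> s" "0 < plus_sq \<rho> s" "0 \<le> b" "0 \<le> c"
  shows "Holder_weight N \<rho> b c s * enn_powr (ennreal (minus_sq \<rho> s powr (real N / 2))) b
    * enn_powr (ennreal (plus_sq \<rho> s powr (real N / 2))) c = 1"
proof -
  let ?A = "minus_sq \<rho> s" and ?D = "plus_sq \<rho> s"
  let ?s = "real N * b / 2" and ?t = "real N * c / 2"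
  have "?A powr (- ?s) * ?D powr (- ?t) * ?A powr ?s * ?D powr ?t = (?A powr (- ?s) * ?A powr ?s) * (?D powr (- ?t) * ?D powr ?t)"
    by (simp only: mult_ac)
  also have "\<dots> = 1"
    using assms by (simp add: powr_add[symmetric])
  finally have "ennreal (?A powr (- ?s) * ?D powr (- ?t) * ?A powr ?s * ?D powr ?t) = 1"
    by simp
  then have "ennreal (?A powr (- ?s) * ?D powr (- ?t)) * ennreal (?A powr ?s) * ennreal (?D powr ?t) = 1"
    by (simp only: ennreal_mult mult_nonneg_nonneg powr_ge_zero)
  then show ?thesis
    using assms by (simp only: Holder_weight_def enn_powr_ennreal_powr times_divide_eq_left)
qed

lemma iterated_integral_eq_product:
  assumes [measurable]: "h \<in> borel_measurable (lborel \<Otimes>\<^sub>M (sphere_measure :: 'a::euclidean_space measure))"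
  shows "(\<integral>\<^sup>+u. (\<integral>\<^sup>+\<sigma>. h (u, \<sigma>) \<partial>sphere_measure) \<partial>lborel) = (\<integral>\<^sup>+z. h z \<partial>(lborel \<Otimes>\<^sub>M (sphere_measure :: 'a measure)))"
  by (rule sphere.nn_integral_fst) simp

text \<open>
  This is the splitting in the classical proof of Young's convolution inequality: \<open>f = f\<^sup>p\<^sup>a f\<^sup>p\<^sup>b\<close>
  and \<open>g = g\<^sup>q\<^sup>a g\<^sup>q\<^sup>c\<close>, and Hoelder's inequality with exponents \<open>a\<close>, \<open>b\<close>, \<open>c\<close> applied to
  \<open>f\<^sup>p g\<^sup>q\<close>, \<open>f\<^sup>p\<close> and \<open>g\<^sup>q\<close>. The last two integrals are those of a single function composed with a shear. For
  the norm in \<open>L\<^sup>r\<close> it is used with \<open>a = 1 / r\<close>, \<open>b = 1 - 1 / q\<close> and \<open>c = 1 - 1 / p\<close>.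
\<close>

lemma pair_gain_Holder:
  fixes f g :: "'a::euclidean_space \<Rightarrow> ennreal"
  assumes dim: "2 \<le> DIM('a)" and \<rho>: "0 < \<rho>" "\<rho> < 1"
    and [measurable]: "w \<in> borel_measurable borel" "f \<in> borel_measurable borel" "g \<in> borel_measurable borel"
    and supp: "\<And>s. s \<notin> {0..<1} \<Longrightarrow> w s = 0"
    and abc: "0 \<le> a" "0 \<le> b" "0 \<le> c" "a + b + c = 1"
    and p: "0 < p" "p * (a + b) = 1" and q: "0 < q" "q * (a + c) = 1"
  defines "W \<equiv> \<lambda>s. w s * Holder_weight DIM('a) \<rho> b c s"
  defines "T \<equiv> slice_integral DIM('a) W"
  shows "pair_gain \<rho> w f g v \<le>
    enn_powr (pair_gain \<rho> W (\<lambda>x. enn_powr (f x) p) (\<lambda>x. enn_powr (g x) q) v) a *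
    enn_powr (T * (\<integral>\<^sup>+x. enn_powr (f x) p \<partial>lborel)) b *
    enn_powr (T * (\<integral>\<^sup>+x. enn_powr (g x) q \<partial>lborel)) c"
proof -
  let ?N = "DIM('a)"
  let ?M = "lborel \<Otimes>\<^sub>M (sphere_measure :: 'a measure)"
  have [measurable]: "W \<in> borel_measurable borel" unfolding W_def by measurable
  define W1 where "W1 = (\<lambda>s. W s * ennreal (minus_sq \<rho> s powr (real ?N / 2)))"
  define W2 where "W2 = (\<lambda>s. W s * ennreal (plus_sq \<rho> s powr (real ?N / 2)))"
  have [measurable]: "W1 \<in> borel_measurable borel" "W2 \<in> borel_measurable borel"
    unfolding W1_def W2_def by measurable
  have pos: "0 < minus_sq \<rho> s" "0 < plus_sq \<rho> s" if "w s \<noteq> 0" for s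
    using supp[of s] that \<rho> by (auto intro!: minus_sq_pos plus_sq_pos)
  have W1: "W1 s * ennreal (minus_sq \<rho> s powr (- (real ?N / 2))) = W s" for s
  proof (cases "w s = 0")
    case False
    have "ennreal (minus_sq \<rho> s powr (real ?N / 2)) * ennreal (minus_sq \<rho> s powr (- (real ?N / 2))) = 1"
      using pos[OF False] by (simp add: powr_add[symmetric] flip: ennreal_mult)
    then show ?thesis by (simp add: W1_def mult.assoc)
  qed (simp add: W1_def W_def)
  have W2: "W2 s * ennreal (plus_sq \<rho> s powr (- (real ?N / 2))) = W s" for s
  proof (cases "w s = 0")
    case False
    have "ennreal (plus_sq \<rho> s powr (real ?N / 2)) * ennreal (plus_sq \<rho> s powr (- (real ?N / 2))) = 1"
      using pos[OF False] by (simp add: powr_add[symmetric] flip: ennreal_mult)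
    then show ?thesis by (simp add: W2_def mult.assoc)
  qed (simp add: W2_def W_def)
  let ?f = "\<lambda>z. f (v - displ \<rho> (fst z) (snd z))" and ?g = "\<lambda>z. g (v - displ_s \<rho> (fst z) (snd z))"
  let ?s = "\<lambda>z::'a \<times> 'a. sgn (fst z) \<bullet> snd z"
  let ?u = "\<lambda>z. enn_powr (?f z) p * enn_powr (?g z) q * W (?s z)"
  let ?x = "\<lambda>z. enn_powr (?f z) p * W1 (?s z)"
  let ?y = "\<lambda>z. enn_powr (?g z) q * W2 (?s z)"
  let ?A = "\<lambda>s. ennreal (minus_sq \<rho> s powr (real ?N / 2))"
  let ?D = "\<lambda>s. ennreal (plus_sq \<rho> s powr (real ?N / 2))"
  have split: "x * y * w s \<le> enn_powr (enn_powr x p * enn_powr y q * W s) a *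
      enn_powr (enn_powr x p * W1 s) b * enn_powr (enn_powr y q * W2 s) c" for x y s
  proof (cases "w s = 0")
    case False
    have "enn_powr x (p * a) * enn_powr x (p * b) = x" "enn_powr y (q * a) * enn_powr y (q * c) = y"
      using p q abc by (simp_all flip: enn_powr_add distrib_left)
    moreover have "enn_powr (W s) a * enn_powr (W s) b * enn_powr (W s) c = W s"
      using abc by (simp flip: enn_powr_add)
    moreover have "W s * enn_powr (?A s) b
        * enn_powr (?D s) c = w s"
      using Holder_weight_cancel[OF pos[OF False] abc(2,3), of ?N] by (simp add: W_def mult.assoc)
    ultimately have "x * y * w s = (enn_powr x (p * a) * enn_powr x (p * b)) * (enn_powr y (q * a) * enn_powr y (q * c)) *
      ((enn_powr (W s) a * enn_powr (W s) b * enn_powr (W s) c) * enn_powr (?A s) b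
        * enn_powr (?D s) c)"
      by (simp only:)
    also have "\<dots> = enn_powr (enn_powr x p * enn_powr y q * W s) a *
      enn_powr (enn_powr x p * W1 s) b * enn_powr (enn_powr y q * W2 s) c"
      using abc p q by (simp only: enn_powr_mult enn_powr_powr W1_def W2_def less_imp_le) (simp only: mult_ac)
    finally show ?thesis by simp
  qed simp
  have "pair_gain \<rho> w f g v = (\<integral>\<^sup>+z. ?f z * ?g z * w (?s z) \<partial>?M)"
    unfolding pair_gain_def by (subst iterated_integral_eq_product[symmetric]) simp_all
  also have "\<dots> \<le> (\<integral>\<^sup>+z. enn_powr (?u z) a *
      enn_powr (?x z) b * enn_powr (?y z) c \<partial>?M)"
    by (intro nn_integral_mono split)
  also have "\<dots> \<le> enn_powr (\<integral>\<^sup>+z. ?u z \<partial>?M) a *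
      enn_powr (\<integral>\<^sup>+z. ?x z \<partial>?M) b *
      enn_powr (\<integral>\<^sup>+z. ?y z \<partial>?M) c"
    using abc by (intro nn_integral_Holder3) measurable
  also have "(\<integral>\<^sup>+z. ?u z \<partial>?M) =
      pair_gain \<rho> W (\<lambda>x. enn_powr (f x) p) (\<lambda>x. enn_powr (g x) q) v"
    unfolding pair_gain_def by (subst iterated_integral_eq_product[symmetric]) simp_all
  finally have bound: "pair_gain \<rho> w f g v \<le> enn_powr (pair_gain \<rho> W (\<lambda>x. enn_powr (f x) p) (\<lambda>x. enn_powr (g x) q) v) a *
      enn_powr (\<integral>\<^sup>+z. ?x z \<partial>?M) b *
      enn_powr (\<integral>\<^sup>+z. ?y z \<partial>?M) c" .
  have "(\<integral>\<^sup>+z. ?x z \<partial>?M) \<le> T * (\<integral>\<^sup>+x. enn_powr (f x) p \<partial>lborel)"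
  proof -
    have "(\<integral>\<^sup>+z. ?x z \<partial>?M) =
       (\<integral>\<^sup>+u. (\<integral>\<^sup>+\<sigma>. enn_powr (f (v - displ \<rho> u \<sigma>)) p * W1 (sgn u \<bullet> \<sigma>) \<partial>sphere_measure) \<partial>lborel)"
      by (subst iterated_integral_eq_product[symmetric]) simp_all
    also have "\<dots> \<le> slice_integral ?N (\<lambda>s. W1 s * ennreal (minus_sq \<rho> s powr (- (real ?N / 2)))) *
          (\<integral>\<^sup>+x. enn_powr (f x) p \<partial>lborel)"
      by (rule nn_integral_displ[OF \<rho> dim, of "\<lambda>x. enn_powr (f x) p" W1 v]) (use supp in \<open>auto simp: W1_def W_def\<close>)
    also have "\<dots> = T * (\<integral>\<^sup>+x. enn_powr (f x) p \<partial>lborel)"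
      by (simp only: W1 T_def)
    finally show ?thesis .
  qed
  moreover have "(\<integral>\<^sup>+z. ?y z \<partial>?M) \<le> T * (\<integral>\<^sup>+x. enn_powr (g x) q \<partial>lborel)"
  proof -
    have "(\<integral>\<^sup>+z. ?y z \<partial>?M) =
       (\<integral>\<^sup>+u. (\<integral>\<^sup>+\<sigma>. enn_powr (g (v - displ_s \<rho> u \<sigma>)) q * W2 (sgn u \<bullet> \<sigma>) \<partial>sphere_measure) \<partial>lborel)"
      by (subst iterated_integral_eq_product[symmetric]) simp_all
    also have "\<dots> \<le> slice_integral ?N (\<lambda>s. W2 s * ennreal (plus_sq \<rho> s powr (- (real ?N / 2)))) *
          (\<integral>\<^sup>+x. enn_powr (g x) q \<partial>lborel)"
      by (rule nn_integral_displ_s[OF \<rho> dim, of "\<lambda>x. enn_powr (g x) q" W2 v]) (use supp in \<open>auto simp: W2_def W_def\<close>)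
    also have "\<dots> = T * (\<integral>\<^sup>+x. enn_powr (g x) q \<partial>lborel)"
      by (simp only: W2 T_def)
    finally show ?thesis .
  qed
  ultimately show ?thesis
    using abc by (intro order_trans[OF bound] mult_mono enn_powr_mono order_refl) simp_all
qed

lemma pair_gain_Lr:
  fixes f g :: "'a::euclidean_space \<Rightarrow> ennreal"
  assumes dim: "2 \<le> DIM('a)" and \<rho>: "0 < \<rho>" "\<rho> < 1"
    and meas [measurable]: "w \<in> borel_measurable borel" "f \<in> borel_measurable borel" "g \<in> borel_measurable borel"
    and supp: "\<And>s. s \<notin> {0..<1} \<Longrightarrow> w s = 0"
    and abc: "0 < a" "0 \<le> b" "0 \<le> c" "a + b + c = 1"
    and p: "0 < p" "p * (a + b) = 1" and q: "0 < q" "q * (a + c) = 1"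
  defines "W \<equiv> \<lambda>s. w s * Holder_weight DIM('a) \<rho> b c s"
  defines "T \<equiv> slice_integral DIM('a) W"
  shows "(\<integral>\<^sup>+v. enn_powr (pair_gain \<rho> w f g v) (1 / a) \<partial>lborel) \<le>
    enn_powr T (1 / a) * enn_powr (\<integral>\<^sup>+x. enn_powr (f x) p \<partial>lborel) (1 / (a * p)) *
    enn_powr (\<integral>\<^sup>+x. enn_powr (g x) q \<partial>lborel) (1 / (a * q))"
proof -
  let ?P = "\<integral>\<^sup>+x. enn_powr (f x) p \<partial>lborel" and ?Q = "\<integral>\<^sup>+x. enn_powr (g x) q \<partial>lborel"
  let ?J = "pair_gain \<rho> W (\<lambda>x. enn_powr (f x) p) (\<lambda>x. enn_powr (g x) q)"
  have [measurable]: "W \<in> borel_measurable borel" unfolding W_def by measurable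
  have J: "(\<integral>\<^sup>+v. ?J v \<partial>lborel) = T * ?P * ?Q"
    unfolding T_def by (rule nn_integral_pair_gain[OF dim]) measurable
  have "enn_powr (pair_gain \<rho> w f g v) (1 / a) \<le> ?J v * (enn_powr (T * ?P) (b / a) * enn_powr (T * ?Q) (c / a))" for v
  proof -
    have "enn_powr (pair_gain \<rho> w f g v) (1 / a) \<le>
        enn_powr (enn_powr (?J v) a * enn_powr (T * ?P) b * enn_powr (T * ?Q) c) (1 / a)"
      using abc unfolding T_def W_def
      by (intro enn_powr_mono pair_gain_Holder[OF dim \<rho> meas supp _ _ _ _ p q]) auto
    also have "\<dots> = ?J v * enn_powr (T * ?P) (b / a) * enn_powr (T * ?Q) (c / a)"
      using abc by (simp add: enn_powr_mult enn_powr_powr)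
    finally show ?thesis by (simp only: mult.assoc)
  qed
  then have "(\<integral>\<^sup>+v. enn_powr (pair_gain \<rho> w f g v) (1 / a) \<partial>lborel)
      \<le> (\<integral>\<^sup>+v. ?J v * (enn_powr (T * ?P) (b / a) * enn_powr (T * ?Q) (c / a)) \<partial>lborel)"
    by (rule nn_integral_mono)
  also have "\<dots> = T * ?P * ?Q * (enn_powr (T * ?P) (b / a) * enn_powr (T * ?Q) (c / a))"
    by (subst nn_integral_multc) (simp_all add: J)
  also have "\<dots> = (enn_powr T 1 * enn_powr T (b / a) * enn_powr T (c / a)) * (enn_powr ?P 1 * enn_powr ?P (b / a)) *
      (enn_powr ?Q 1 * enn_powr ?Q (c / a))"
    using abc by (simp add: enn_powr_mult mult_ac)
  also have "enn_powr T 1 * enn_powr T (b / a) * enn_powr T (c / a) = enn_powr T (1 + b / a + c / a)"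
    using abc by (subst enn_powr_add, simp, simp, subst enn_powr_add) simp_all
  also have "1 + b / a + c / a = 1 / a"
    using abc by (simp add: field_simps)
  also have "enn_powr ?P 1 * enn_powr ?P (b / a) = enn_powr ?P (1 + b / a)"
    using abc by (subst enn_powr_add) simp_all
  also have "1 + b / a = 1 / (a * p)"
    using abc p by (simp add: divide_simps) (simp add: algebra_simps)
  also have "enn_powr ?Q 1 * enn_powr ?Q (c / a) = enn_powr ?Q (1 + c / a)"
    using abc by (subst enn_powr_add) simp_all
  also have "1 + c / a = 1 / (a * q)"
    using abc q by (simp add: divide_simps) (simp add: algebra_simps)
  finally show ?thesis .
qed

text \<open>
  One more use of Hoelder's inequality separates the two lengths and gives the constant its product form.
\<close>

lemma Holder_weight_integral:
  assumes \<rho>: "0 < \<rho>" "\<rho> < 1" and [measurable]: "w \<in> borel_measurable borel"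
    and supp: "\<And>s. s \<notin> {0..<1} \<Longrightarrow> w s = 0"
    and bc: "0 \<le> b" "0 \<le> c" "0 < b + c"
  shows "(\<integral>\<^sup>+s. w s * Holder_weight N \<rho> b c s * slice_weight N s \<partial>lborel) \<le>
    enn_powr (\<integral>\<^sup>+s. w s * ennreal (minus_sq \<rho> s powr (- (real N * (b + c) / 2))) * slice_weight N s \<partial>lborel) (b / (b + c)) *
    enn_powr (\<integral>\<^sup>+s. w s * ennreal (plus_sq \<rho> s powr (- (real N * (b + c) / 2))) * slice_weight N s \<partial>lborel) (c / (b + c))"
proof -
  let ?\<beta> = "b / (b + c)" and ?\<gamma> = "c / (b + c)"
  let ?A = "\<lambda>s. minus_sq \<rho> s powr (- (real N * (b + c) / 2))" and ?D = "\<lambda>s. plus_sq \<rho> s powr (- (real N * (b + c) / 2))"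
  let ?a = "\<lambda>s. w s * ennreal (?A s) * slice_weight N s"
  let ?d = "\<lambda>s. w s * ennreal (?D s) * slice_weight N s"
  let ?e = "\<lambda>s. w s * Holder_weight N \<rho> b c s * slice_weight N s"
  have sum1: "?\<beta> + ?\<gamma> = 1" using bc by (simp flip: add_divide_distrib)
  have "?e s \<le>
    enn_powr (?a s) ?\<beta> * enn_powr (?d s) ?\<gamma>" for s
  proof (cases "w s = 0")
    case False
    then have s: "0 < minus_sq \<rho> s" "0 < plus_sq \<rho> s"
      using supp[of s] \<rho> by (auto intro!: minus_sq_pos plus_sq_pos)
    have e: "- (real N * (b + c) / 2) * ?\<beta> = - (real N * b / 2)" "- (real N * (b + c) / 2) * ?\<gamma> = - (real N * c / 2)"
      using bc by (auto simp: field_simps)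
    have "enn_powr (ennreal (?A s)) ?\<beta> * enn_powr (ennreal (?D s)) ?\<gamma> = Holder_weight N \<rho> b c s"
      using s bc by (simp only: enn_powr_ennreal_powr divide_nonneg_pos e Holder_weight_def) (simp add: ennreal_mult)
    moreover have "enn_powr x ?\<beta> * enn_powr x ?\<gamma> = x" for x
      using bc sum1 enn_powr_add[of ?\<beta> ?\<gamma> x] by simp
    ultimately have "?e s =
        (enn_powr (w s) ?\<beta> * enn_powr (w s) ?\<gamma>) * (enn_powr (ennreal (?A s)) ?\<beta> * enn_powr (ennreal (?D s)) ?\<gamma>) *
        (enn_powr (slice_weight N s) ?\<beta> * enn_powr (slice_weight N s) ?\<gamma>)"
      by (simp only:)
    also have "\<dots> = enn_powr (?a s) ?\<beta> * enn_powr (?d s) ?\<gamma>"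
      using bc by (simp only: enn_powr_mult divide_nonneg_pos) (simp only: mult_ac)
    finally show ?thesis by simp
  qed simp
  then have "(\<integral>\<^sup>+s. ?e s \<partial>lborel) \<le>
      (\<integral>\<^sup>+s. enn_powr (?a s) ?\<beta> * enn_powr (?d s) ?\<gamma> \<partial>lborel)"
    by (rule nn_integral_mono)
  also have "\<dots> \<le> enn_powr (\<integral>\<^sup>+s. ?a s \<partial>lborel) ?\<beta> *
      enn_powr (\<integral>\<^sup>+s. ?d s \<partial>lborel) ?\<gamma>"
    using bc sum1 by (intro nn_integral_Holder) simp_all
  finally show ?thesis .
qed

text \<open>
  By the shear estimate, both outgoing velocities pull null sets back to null sets, for each value of \<open>v\<close>. Hence the gain
  term does not depend on the representatives of the distribution functions.
\<close>

lemma AE_displ: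
  fixes N :: "'a::euclidean_space set"
  assumes dim: "2 \<le> DIM('a)" and \<rho>: "0 < \<rho>" "\<rho> < 1" and N: "N \<in> null_sets lborel"
  shows "AE u in lborel. AE \<sigma> in sphere_measure. sgn u \<bullet> \<sigma> \<in> {0..1} \<longrightarrow> v - displ \<rho> u \<sigma> \<notin> N"
    and "AE u in lborel. AE \<sigma> in sphere_measure. sgn u \<bullet> \<sigma> \<in> {0..1} \<longrightarrow> v - displ_s \<rho> u \<sigma> \<notin> N"
proof -
  have [measurable]: "N \<in> sets borel" using N by auto
  have zero: "(\<integral>\<^sup>+x. indicator N x \<partial>lborel) = (0::ennreal)" using N by auto
  have AE_I: "AE u in lborel. AE \<sigma> in sphere_measure. sgn u \<bullet> \<sigma> \<in> {0..1} \<longrightarrow> d u \<sigma> \<notin> N"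
    if [measurable]: "(\<lambda>z. d (fst z) (snd z)) \<in> borel_measurable (borel \<Otimes>\<^sub>M borel)"
      and le: "(\<integral>\<^sup>+u. (\<integral>\<^sup>+\<sigma>. indicator N (d u \<sigma>) * indicator {0..1} (sgn u \<bullet> \<sigma>) \<partial>sphere_measure) \<partial>lborel) \<le> c * (\<integral>\<^sup>+x. indicator N x \<partial>lborel)"
    for d :: "'a \<Rightarrow> 'a \<Rightarrow> 'a" and c :: ennreal
  proof -
    have m: "(\<lambda>x. d (f x) (g x)) \<in> borel_measurable M" if "f \<in> borel_measurable M" "g \<in> borel_measurable M" for f g :: "'b \<Rightarrow> 'a" and M
      using measurable_compose[OF measurable_Pair[OF that] \<open>(\<lambda>z. d (fst z) (snd z)) \<in> _\<close>] by simp
    note m [measurable]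
    have "(\<integral>\<^sup>+u. (\<integral>\<^sup>+\<sigma>. indicator N (d u \<sigma>) * indicator {0..1} (sgn u \<bullet> \<sigma>) \<partial>sphere_measure) \<partial>lborel) = (0::ennreal)"
      using le unfolding zero by simp
    then have "AE u in lborel. (\<integral>\<^sup>+\<sigma>. indicator N (d u \<sigma>) * indicator {0..1} (sgn u \<bullet> \<sigma>) \<partial>sphere_measure) = (0::ennreal)"
      by (subst (asm) nn_integral_0_iff_AE) auto
    then show ?thesis
    proof eventually_elim
      case (elim u)
      then have "AE \<sigma> in sphere_measure. indicator N (d u \<sigma>) * indicator {0..1} (sgn u \<bullet> \<sigma>) = (0::ennreal)"
        by (subst (asm) nn_integral_0_iff_AE) auto
      then show ?case
        by eventually_elim (auto simp: indicator_def split: if_splits)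
    qed
  qed
  show "AE u in lborel. AE \<sigma> in sphere_measure. sgn u \<bullet> \<sigma> \<in> {0..1} \<longrightarrow> v - displ \<rho> u \<sigma> \<notin> N"
    by (rule AE_I, measurable, rule nn_integral_displ[OF \<rho> dim]) simp_all
  show "AE u in lborel. AE \<sigma> in sphere_measure. sgn u \<bullet> \<sigma> \<in> {0..1} \<longrightarrow> v - displ_s \<rho> u \<sigma> \<notin> N"
    by (rule AE_I, measurable, rule nn_integral_displ_s[OF \<rho> dim]) simp_all
qed

lemma null_set_of_AE:
  assumes "AE x in M. P x"
  obtains N where "N \<in> null_sets M" "\<And>x. x \<in> space M \<Longrightarrow> x \<notin> N \<Longrightarrow> P x"
  using assms unfolding eventually_ae_filter by blast

lemma pair_gain_le_sup_right:
  fixes f g :: "'a::euclidean_space \<Rightarrow> ennreal"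
  assumes dim: "2 \<le> DIM('a)" and \<rho>: "0 < \<rho>" "\<rho> < 1"
    and [measurable]: "w \<in> borel_measurable borel" "f \<in> borel_measurable borel" "g \<in> borel_measurable borel"
    and supp: "\<And>s. s \<notin> {0..<1} \<Longrightarrow> w s = 0" and M: "AE x in lborel. g x \<le> M"
  shows "pair_gain \<rho> w f g v \<le> slice_integral DIM('a) (\<lambda>s. w s * ennreal (minus_sq \<rho> s powr (- (real DIM('a) / 2)))) *
          (\<integral>\<^sup>+x. f x \<partial>lborel) * M"
proof -
  obtain N where N: "N \<in> null_sets lborel" "\<And>x. x \<notin> N \<Longrightarrow> g x \<le> M"
    using null_set_of_AE[OF M] by auto
  have "pair_gain \<rho> w f g v \<le> (\<integral>\<^sup>+u. (\<integral>\<^sup>+\<sigma>. f (v - displ \<rho> u \<sigma>) * w (sgn u \<bullet> \<sigma>) * M \<partial>sphere_measure) \<partial>lborel)"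
    unfolding pair_gain_def
  proof (rule nn_integral_mono_AE[OF eventually_mono[OF AE_displ(2)[OF dim \<rho> N(1), of v]]], goal_cases)
    case (1 u)
    show ?case
      using 1
    proof (intro nn_integral_mono_AE, eventually_elim)
      case (elim \<sigma>)
      show ?case
      proof (cases "w (sgn u \<bullet> \<sigma>) = 0")
        case False
        then have "sgn u \<bullet> \<sigma> \<in> {0..<1}" using supp by blast
        then have "sgn u \<bullet> \<sigma> \<in> {0..1}" by simp
        then have "g (v - displ_s \<rho> u \<sigma>) \<le> M" using elim N(2) by auto
        then have "f (v - displ \<rho> u \<sigma>) * w (sgn u \<bullet> \<sigma>) * g (v - displ_s \<rho> u \<sigma>) \<le> f (v - displ \<rho> u \<sigma>) * w (sgn u \<bullet> \<sigma>) * M"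
          by (rule mult_left_mono) simp
        then show ?thesis by (simp only: mult_ac)
      qed simp
    qed
  qed
  also have "\<dots> = (\<integral>\<^sup>+u. (\<integral>\<^sup>+\<sigma>. f (v - displ \<rho> u \<sigma>) * w (sgn u \<bullet> \<sigma>) \<partial>sphere_measure) \<partial>lborel) * M"
    by (simp add: nn_integral_multc)
  also have "\<dots> \<le> slice_integral DIM('a) (\<lambda>s. w s * ennreal (minus_sq \<rho> s powr (- (real DIM('a) / 2)))) *
          (\<integral>\<^sup>+x. f x \<partial>lborel) * M"
    using supp by (intro mult_right_mono nn_integral_displ[OF \<rho> dim]) auto
  finally show ?thesis .
qed

lemma pair_gain_le_sup_left:
  fixes f g :: "'a::euclidean_space \<Rightarrow> ennreal"
  assumes dim: "2 \<le> DIM('a)" and \<rho>: "0 < \<rho>" "\<rho> < 1"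
    and [measurable]: "w \<in> borel_measurable borel" "f \<in> borel_measurable borel" "g \<in> borel_measurable borel"
    and supp: "\<And>s. s \<notin> {0..<1} \<Longrightarrow> w s = 0" and M: "AE x in lborel. f x \<le> M"
  shows "pair_gain \<rho> w f g v \<le> slice_integral DIM('a) (\<lambda>s. w s * ennreal (plus_sq \<rho> s powr (- (real DIM('a) / 2)))) *
          M * (\<integral>\<^sup>+x. g x \<partial>lborel)"
proof -
  obtain N where N: "N \<in> null_sets lborel" "\<And>x. x \<notin> N \<Longrightarrow> f x \<le> M"
    using null_set_of_AE[OF M] by auto
  have "pair_gain \<rho> w f g v \<le> (\<integral>\<^sup>+u. (\<integral>\<^sup>+\<sigma>. g (v - displ_s \<rho> u \<sigma>) * w (sgn u \<bullet> \<sigma>) * M \<partial>sphere_measure) \<partial>lborel)"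
    unfolding pair_gain_def
  proof (rule nn_integral_mono_AE[OF eventually_mono[OF AE_displ(1)[OF dim \<rho> N(1), of v]]], goal_cases)
    case (1 u)
    show ?case
      using 1
    proof (intro nn_integral_mono_AE, eventually_elim)
      case (elim \<sigma>)
      show ?case
      proof (cases "w (sgn u \<bullet> \<sigma>) = 0")
        case False
        then have "sgn u \<bullet> \<sigma> \<in> {0..<1}" using supp by blast
        then have "sgn u \<bullet> \<sigma> \<in> {0..1}" by simp
        then have "f (v - displ \<rho> u \<sigma>) \<le> M" using elim N(2) by auto
        then have "g (v - displ_s \<rho> u \<sigma>) * w (sgn u \<bullet> \<sigma>) * f (v - displ \<rho> u \<sigma>) \<le> g (v - displ_s \<rho> u \<sigma>) * w (sgn u \<bullet> \<sigma>) * M"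
          by (rule mult_left_mono) simp
        then show ?thesis by (simp only: mult_ac)
      qed simp
    qed
  qed
  also have "\<dots> = (\<integral>\<^sup>+u. (\<integral>\<^sup>+\<sigma>. g (v - displ_s \<rho> u \<sigma>) * w (sgn u \<bullet> \<sigma>) \<partial>sphere_measure) \<partial>lborel) * M"
    by (simp add: nn_integral_multc)
  also have "\<dots> \<le> slice_integral DIM('a) (\<lambda>s. w s * ennreal (plus_sq \<rho> s powr (- (real DIM('a) / 2)))) *
          (\<integral>\<^sup>+x. g x \<partial>lborel) * M"
    using supp by (intro mult_right_mono nn_integral_displ_s[OF \<rho> dim]) auto
  finally show ?thesis by (simp only: mult_ac)
qed

section \<open>The kinetic factor and measurable versions of the data\<close>

lemma AE_lborel_reflect:
  fixes P :: "'a::euclidean_space \<Rightarrow> bool"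
  assumes "AE x in lborel. P x"
  shows "AE x in lborel. P (c - x)"
proof -
  obtain N where N: "N \<in> null_sets lborel" "\<And>x. x \<notin> N \<Longrightarrow> P x"
    using null_set_of_AE[OF assms] by auto
  then have [measurable]: "N \<in> sets borel" by auto
  have "(\<integral>\<^sup>+x. indicator N (c - x) \<partial>lborel) = (0::ennreal)"
    using N(1) by (subst nn_integral_lborel_reflect) auto
  then have "AE x in lborel. indicator N (c - x) = (0::ennreal)"
    by (subst (asm) nn_integral_0_iff_AE) auto
  then show ?thesis
    by eventually_elim (use N(2) in \<open>auto simp: indicator_def split: if_splits\<close>)
qed

lemma AE_sphere_inner:
  fixes e :: "'a::euclidean_space"
  assumes dim: "2 \<le> DIM('a)" and e: "norm e = 1" and N: "N \<in> null_sets lborel"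
  shows "AE \<sigma> in sphere_measure. e \<bullet> \<sigma> \<notin> N"
proof -
  have [measurable]: "N \<in> sets borel" using N by auto
  have "AE s in lborel. indicator N s * slice_weight DIM('a) s = 0"
    using AE_not_in[OF N] by eventually_elim simp
  then have "(\<integral>\<^sup>+s. indicator N s * slice_weight DIM('a) s \<partial>lborel) = 0"
    by (subst nn_integral_0_iff_AE) auto
  then have "(\<integral>\<^sup>+\<sigma>. indicator N (e \<bullet> \<sigma>) \<partial>sphere_measure) = (0::ennreal)"
    by (subst nn_integral_sphere_slices[OF dim e]) auto
  then have "AE \<sigma> in sphere_measure. indicator N (e \<bullet> \<sigma>) = (0::ennreal)"
    by (subst (asm) nn_integral_0_iff_AE) auto
  then show ?thesis
    by eventually_elim (auto simp: indicator_def split: if_splits)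
qed

text \<open>
  One summand of the gain term for Borel data, in the variable \<open>u = v - vs\<close>.
\<close>

definition kernel_gain :: "real \<Rightarrow> real \<Rightarrow> (real \<Rightarrow> ennreal) \<Rightarrow> ('a::euclidean_space \<Rightarrow> ennreal) \<Rightarrow> ('a \<Rightarrow> ennreal) \<Rightarrow> 'a \<Rightarrow> ennreal" where
  "kernel_gain \<rho> l w f g v =
     (\<integral>\<^sup>+u. (\<integral>\<^sup>+\<sigma>. f (v - displ \<rho> u \<sigma>) * g (v - displ_s \<rho> u \<sigma>) * (ennreal (norm u powr l) * w (sgn u \<bullet> \<sigma>)) \<partial>sphere_measure) \<partial>lborel)"

lemma measurable_kernel_gain [measurable]:
  assumes [measurable]: "w \<in> borel_measurable borel" "f \<in> borel_measurable borel" "g \<in> borel_measurable borel"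
  shows "kernel_gain \<rho> l w f g \<in> borel_measurable borel"
  unfolding kernel_gain_def[abs_def] by measurable

text \<open>
  An equality, and not only a bound, is required: the essential supremum of a function that is not measurable is
  infinite, so the gain term itself must be shown to be measurable.
\<close>

lemma gain_term_eq_kernel_gain:
  fixes F G :: "'a::euclidean_space \<Rightarrow> real" and f g :: "'a \<Rightarrow> ennreal"
  assumes dim: "2 \<le> DIM('a)" and \<rho>: "0 < \<rho>" "\<rho> < 1"
    and [measurable]: "w \<in> borel_measurable borel" "f \<in> borel_measurable borel" "g \<in> borel_measurable borel"
    and F: "\<And>x. 0 \<le> F x" "AE x in lborel. ennreal (F x) = f x"
    and G: "\<And>x. 0 \<le> G x" "AE x in lborel. ennreal (G x) = g x"
    and supp: "\<And>s. s \<notin> {0..<1} \<Longrightarrow> w s = 0"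
    and w: "AE s in lborel. s \<in> {0..<1} \<longrightarrow> ennreal (b s) = w s"
    and b_nonneg: "\<And>s. s \<in> {-1..1} \<Longrightarrow> 0 \<le> b s"
    and b_supp: "\<And>s. s \<in> {-1..1} \<Longrightarrow> s \<notin> {0..1} \<Longrightarrow> b s = 0"
    and kernel: "\<And>x y. 0 < x \<Longrightarrow> y \<in> {-1..1} \<Longrightarrow> B x y = x powr l * b y"
  shows "(\<integral>\<^sup>+vs. (\<integral>\<^sup>+\<sigma>. ennreal (F (post_v \<rho> v vs \<sigma>) * G (post_vs \<rho> v vs \<sigma>) * B (norm (v - vs)) (sgn (v - vs) \<bullet> \<sigma>))
      \<partial>sphere_measure) \<partial>lebesgue) = kernel_gain \<rho> l w f g v"
proof -
  obtain NF where NF: "NF \<in> null_sets lborel" "\<And>x. x \<notin> NF \<Longrightarrow> ennreal (F x) = f x"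
    using null_set_of_AE[OF F(2)] by auto
  obtain NG where NG: "NG \<in> null_sets lborel" "\<And>x. x \<notin> NG \<Longrightarrow> ennreal (G x) = g x"
    using null_set_of_AE[OF G(2)] by auto
  obtain Nb where Nb: "Nb \<in> null_sets lborel" "\<And>s. s \<notin> Nb \<Longrightarrow> s \<in> {0..<1} \<Longrightarrow> ennreal (b s) = w s"
    using null_set_of_AE[OF w] by auto
  have Nb1: "insert 1 Nb \<in> null_sets lborel"
    using null_sets.Un[OF countable_imp_null_set_lborel[of "{1}"] Nb(1)] by simp
  let ?h = "\<lambda>u \<sigma>. f (v - displ \<rho> u \<sigma>) * g (v - displ_s \<rho> u \<sigma>) * (ennreal (norm u powr l) * w (sgn u \<bullet> \<sigma>))"
  have "AE u in lborel. AE \<sigma> in sphere_measure.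
      ennreal (F (v - displ \<rho> u \<sigma>) * G (v - displ_s \<rho> u \<sigma>) * B (norm u) (sgn u \<bullet> \<sigma>)) = ?h u \<sigma>"
    using AE_displ(1)[OF dim \<rho> NF(1), of v] AE_displ(2)[OF dim \<rho> NG(1), of v] AE_lborel_singleton[of "0::'a"]
  proof eventually_elim
    case (elim u)
    have e: "norm (sgn u) = 1" using elim(3) by (simp add: norm_sgn)
    show ?case
      using elim(1,2) AE_sphere_inner[OF dim e Nb1] AE_sphere_norm[where 'a='a]
    proof eventually_elim
      case (elim \<sigma>)
      let ?s = "sgn u \<bullet> \<sigma>"
      have "\<bar>?s\<bar> \<le> 1" using Cauchy_Schwarz_ineq2[of "sgn u" \<sigma>] e elim(4) by simp
      then have s: "?s \<in> {-1..1}" by auto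
      have B: "B (norm u) ?s = norm u powr l * b ?s"
        using \<open>u \<noteq> 0\<close> s by (intro kernel) auto
      show ?case
      proof (cases "?s \<in> {0..<1}")
        case True
        then have "f (v - displ \<rho> u \<sigma>) = ennreal (F (v - displ \<rho> u \<sigma>))" "g (v - displ_s \<rho> u \<sigma>) = ennreal (G (v - displ_s \<rho> u \<sigma>))"
          "w ?s = ennreal (b ?s)"
          using elim NF(2) NG(2) Nb(2) by auto
        then show ?thesis
          using F(1) G(1) b_nonneg[OF s] by (simp add: B ennreal_mult)
      next
        case False
        then have "?s \<notin> {0..1}" using elim(3) by auto
        then show ?thesis
          using supp[OF False] b_supp[OF s] by (simp add: B)
      qed
    qed
  qed
  from AE_lborel_reflect[OF this, of v]
  have "(\<integral>\<^sup>+vs. (\<integral>\<^sup>+\<sigma>. ennreal (F (post_v \<rho> v vs \<sigma>) * G (post_vs \<rho> v vs \<sigma>) * B (norm (v - vs)) (sgn (v - vs) \<bullet> \<sigma>)) \<partial>sphere_measure) \<partial>lebesgue)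
      = (\<integral>\<^sup>+vs. (\<integral>\<^sup>+\<sigma>. ?h (v - vs) \<sigma> \<partial>sphere_measure) \<partial>lborel)"
    unfolding nn_integral_completion post_v_eq post_vs_eq
    by (intro nn_integral_cong_AE) (auto elim!: eventually_mono intro!: nn_integral_cong_AE)
  also have "\<dots> = kernel_gain \<rho> l w f g v"
    unfolding kernel_gain_def by (rule nn_integral_lborel_reflect[of "\<lambda>u. \<integral>\<^sup>+\<sigma>. ?h u \<sigma> \<partial>sphere_measure"]) simp
  finally show ?thesis .
qed

lemma bracket_ge_1:
  assumes "\<And>i. 0 < m i"
  shows "1 \<le> bracket m i v"
  using assms by (simp add: bracket_def sum_nonneg less_imp_le)

lemma norm_powr_le_bracket:
  assumes m: "\<And>i. 0 < m i" and l: "0 \<le> l"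
  shows "norm v powr l \<le> ((\<Sum>k\<in>UNIV. m k) / m i) powr (l / 2) * bracket m i v powr l"
proof -
  let ?M = "\<Sum>k\<in>UNIV. m k"
  have M: "0 < ?M" using m by (intro sum_pos) auto
  have "(norm v)\<^sup>2 \<le> ?M / m i * (1 + m i / ?M * (norm v)\<^sup>2)"
    using M m[of i] by (simp add: distrib_left)
  then have "sqrt ((norm v)\<^sup>2) \<le> sqrt (?M / m i * (1 + m i / ?M * (norm v)\<^sup>2))"
    by (rule real_sqrt_le_mono)
  then have "norm v \<le> sqrt (?M / m i) * bracket m i v"
    by (simp only: bracket_def real_sqrt_mult) simp
  then have "norm v powr l \<le> (sqrt (?M / m i) * bracket m i v) powr l"
    using l by (intro powr_mono2) auto
  also have "\<dots> = sqrt (?M / m i) powr l * bracket m i v powr l"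
    by (rule powr_mult)
  also have "sqrt (?M / m i) powr l = (?M / m i) powr (l / 2)"
    using M m[of i] powr_powr[of "?M / m i" "1 / 2" l] by (simp add: powr_half_sqrt)
  finally show ?thesis .
qed

text \<open>
  One of the two velocities has at least half the norm of their difference; its power is absorbed by its own bracket,
  and the other bracket is at least \<open>1\<close>.
\<close>

lemma relative_speed_powr_le:
  fixes x y :: "'a::real_normed_vector"
  assumes m: "\<And>i. 0 < m i" and l: "0 \<le> lam i j" "lam i j \<le> \<Lambda>"
  shows "norm (x - y) powr lam i j
    \<le> 2 powr lam i j * M_pair m lam i j * (bracket m i x powr \<Lambda> * bracket m j y powr \<Lambda>)"
proof -
  let ?l = "lam i j" and ?\<mu> = "\<lambda>k. ((\<Sum>n\<in>UNIV. m n) / m k) powr (lam i j / 2)"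
  have br: "bracket m i x powr ?l \<le> bracket m i x powr \<Lambda>" "1 \<le> bracket m i x powr \<Lambda>" for i and x :: 'a
    using bracket_ge_1[of m i x, OF m] l by (auto intro: powr_mono ge_one_powr_ge_zero)
  have one: "norm z powr ?l \<le> ?\<mu> k * bracket m k z powr \<Lambda>" for k and z :: 'a
  proof -
    have "norm z powr ?l \<le> ?\<mu> k * bracket m k z powr ?l" by (rule norm_powr_le_bracket[of m, OF m l(1)])
    also have "\<dots> \<le> ?\<mu> k * bracket m k z powr \<Lambda>" by (intro mult_left_mono br) simp
    finally show ?thesis .
  qed
  have "norm (x - y) \<le> norm x + norm y" by (rule norm_triangle_ineq4)
  then have "norm (x - y) \<le> 2 * max (norm x) (norm y)" by simp
  then have "norm (x - y) powr ?l \<le> (2 * max (norm x) (norm y)) powr ?l"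
    using l by (intro powr_mono2) auto
  also have "\<dots> = 2 powr ?l * max (norm x) (norm y) powr ?l" by (rule powr_mult)
  also have "\<dots> \<le> 2 powr ?l * (M_pair m lam i j * (bracket m i x powr \<Lambda> * bracket m j y powr \<Lambda>))"
  proof (rule mult_left_mono)
    have a: "?\<mu> i * bracket m i x powr \<Lambda> \<le> M_pair m lam i j * (bracket m i x powr \<Lambda> * bracket m j y powr \<Lambda>)"
      using br(2)[of i x] br(2)[of j y] mult_left_mono[OF br(2)[of j y], of "bracket m i x powr \<Lambda>"]
      by (intro mult_mono) (auto simp: M_pair_def)
    have b: "?\<mu> j * bracket m j y powr \<Lambda> \<le> M_pair m lam i j * (bracket m i x powr \<Lambda> * bracket m j y powr \<Lambda>)"
      using br(2)[of i x] br(2)[of j y] mult_right_mono[OF br(2)[of i x], of "bracket m j y powr \<Lambda>"]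
      by (intro mult_mono) (auto simp: M_pair_def)
    show "max (norm x) (norm y) powr ?l \<le> M_pair m lam i j * (bracket m i x powr \<Lambda> * bracket m j y powr \<Lambda>)"
      using one[of x i] one[of y j] a b by (auto simp: max_def)
  qed simp
  finally show ?thesis by (simp only: mult.assoc)
qed

text \<open>
  Collisions preserve the relative speed: \<open>norm u\<close> is also the norm of the difference of the two outgoing velocities,
  so that its power is controlled by the weights at these velocities.
\<close>

lemma kernel_gain_le_pair_gain:
  fixes f g :: "'a::euclidean_space \<Rightarrow> ennreal"
  assumes m: "\<And>i. 0 < m i" and l: "0 \<le> lam i j" "lam i j \<le> \<Lambda>"
    and [measurable]: "w \<in> borel_measurable borel" "f \<in> borel_measurable borel" "g \<in> borel_measurable borel"
  shows "kernel_gain \<rho> (lam i j) w f g v \<le> ennreal (2 powr lam i j * M_pair m lam i j) *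
    pair_gain \<rho> w (\<lambda>x. f x * ennreal (bracket m i x powr \<Lambda>)) (\<lambda>x. g x * ennreal (bracket m j x powr \<Lambda>)) v"
proof -
  have [measurable]: "(\<lambda>x. bracket m i x powr \<Lambda>) \<in> borel_measurable borel" for i
    unfolding bracket_def by measurable
  let ?T = "2 powr lam i j * M_pair m lam i j"
  have T: "0 \<le> ?T" by (simp add: M_pair_def)
  let ?h = "\<lambda>u \<sigma>. (f (v - displ \<rho> u \<sigma>) * ennreal (bracket m i (v - displ \<rho> u \<sigma>) powr \<Lambda>)) *
      (g (v - displ_s \<rho> u \<sigma>) * ennreal (bracket m j (v - displ_s \<rho> u \<sigma>) powr \<Lambda>)) * w (sgn u \<bullet> \<sigma>)"
  have "kernel_gain \<rho> (lam i j) w f g v \<le> (\<integral>\<^sup>+u. (\<integral>\<^sup>+\<sigma>. ennreal ?T * ?h u \<sigma> \<partial>sphere_measure) \<partial>lborel)"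
    unfolding kernel_gain_def
  proof (rule nn_integral_mono)
    fix u :: 'a
    show "(\<integral>\<^sup>+\<sigma>. f (v - displ \<rho> u \<sigma>) * g (v - displ_s \<rho> u \<sigma>) * (ennreal (norm u powr lam i j) * w (sgn u \<bullet> \<sigma>)) \<partial>sphere_measure)
        \<le> (\<integral>\<^sup>+\<sigma>. ennreal ?T * ?h u \<sigma> \<partial>sphere_measure)"
      using AE_sphere_norm[where 'a='a]
    proof (intro nn_integral_mono_AE, eventually_elim)
      case (elim \<sigma>)
      let ?x = "v - displ \<rho> u \<sigma>" and ?y = "v - displ_s \<rho> u \<sigma>"
      have "?x - ?y = norm u *\<^sub>R \<sigma>" using displ_s_minus_displ[of \<rho> u \<sigma>] by simp
      then have "norm (?x - ?y) = norm u" using elim by simp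
      then have "norm u powr lam i j \<le> ?T * (bracket m i ?x powr \<Lambda> * bracket m j ?y powr \<Lambda>)"
        using relative_speed_powr_le[of m lam i j \<Lambda> ?x ?y, OF m l] by simp
      then have "ennreal (norm u powr lam i j) \<le> ennreal ?T * (ennreal (bracket m i ?x powr \<Lambda>) * ennreal (bracket m j ?y powr \<Lambda>))"
      proof -
        have "ennreal (?T * (x * y)) = ennreal ?T * (ennreal x * ennreal y)" if "0 \<le> x" for x y
          unfolding ennreal_mult'[OF T] ennreal_mult'[OF that] ..
        from this[of "bracket m i ?x powr \<Lambda>" "bracket m j ?y powr \<Lambda>"] ennreal_leI[OF \<open>norm u powr lam i j \<le> _\<close>]
        show ?thesis by simp
      qed
      then have "f ?x * g ?y * w (sgn u \<bullet> \<sigma>) * ennreal (norm u powr lam i j) \<le>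
          f ?x * g ?y * w (sgn u \<bullet> \<sigma>) * (ennreal ?T * (ennreal (bracket m i ?x powr \<Lambda>) * ennreal (bracket m j ?y powr \<Lambda>)))"
        by (rule mult_left_mono) simp
      then show ?case by (simp only: mult_ac)
    qed
  qed
  also have "\<dots> = ennreal ?T * pair_gain \<rho> w (\<lambda>x. f x * ennreal (bracket m i x powr \<Lambda>)) (\<lambda>x. g x * ennreal (bracket m j x powr \<Lambda>)) v"
    unfolding pair_gain_def by (simp add: nn_integral_cmult)
  finally show ?thesis .
qed

text \<open>
  The density \<open>w\<close> is set to \<open>0\<close> at \<open>s = 1\<close>, so that both squared lengths are positive wherever \<open>w\<close> is not zero.
\<close>

lemma angular_density_exists:
  fixes b :: "real \<Rightarrow> real"
  assumes b_nonneg: "\<And>s. s \<in> {-1..1} \<Longrightarrow> 0 \<le> b s"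
    and b_supp: "\<And>s. s \<in> {-1..1} \<Longrightarrow> s \<notin> {0..1} \<Longrightarrow> b s = 0"
    and b_L1: "set_integrable lebesgue {-1..1} (\<lambda>s. b s * (1 - s\<^sup>2) powr ((real N - 3) / 2))"
  shows "\<exists>w \<in> borel_measurable borel. (\<forall>s. s \<notin> {0..<1} \<longrightarrow> w s = 0) \<and>
    (AE s in lborel. s \<in> {0..<1} \<longrightarrow> ennreal (b s) = w s) \<and>
    (\<forall>h \<in> borel_measurable borel. (\<integral>\<^sup>+s. ennreal (h s) \<partial>xi_measure N b) = (\<integral>\<^sup>+s. w s * ennreal (h s) * slice_weight N s \<partial>lborel))"
proof -
  let ?\<omega> = "\<lambda>s::real. (1 - s\<^sup>2) powr ((real N - 3) / 2)"
  let ?k = "\<lambda>s. indicator {-1..1} s * (b s * ?\<omega> s)"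
  have k [measurable]: "?k \<in> borel_measurable lebesgue"
    using borel_measurable_integrable[OF b_L1[unfolded set_integrable_def]] by simp
  have [measurable]: "?\<omega> \<in> borel_measurable lebesgue" "(indicator {0..<1} :: real \<Rightarrow> ennreal) \<in> borel_measurable lebesgue"
    by (auto intro!: measurable_completion)
  have \<omega>_pos: "0 < ?\<omega> s" if "-1 < s" "s < 1" for s
  proof -
    have "0 < 1 - s\<^sup>2" using that by (simp add: abs_square_less_1 abs_less_iff)
    then show ?thesis by simp
  qed
  have "(\<lambda>s. indicator {0..<1} s * ennreal (?k s / ?\<omega> s)) \<in> borel_measurable lebesgue"
    by measurable
  from completion_ex_borel_measurable[OF this]
  obtain w0 where w0 [measurable]: "w0 \<in> borel_measurable lborel"
    and w0_eq: "AE s in lborel. indicator {0..<1} s * ennreal (?k s / ?\<omega> s) = w0 s" by auto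
  define w where "w = (\<lambda>s. indicator {0..<1} s * w0 s)"
  have [measurable]: "w \<in> borel_measurable borel" using w0 by (simp add: w_def)
  have w_eq: "AE s in lborel. s \<in> {0..<1} \<longrightarrow> ennreal (b s) = w s"
    using w0_eq
  proof eventually_elim
    case (elim s)
    show ?case
    proof
      assume s: "s \<in> {0..<1}"
      then show "ennreal (b s) = w s" using elim \<omega>_pos[of s] by (simp add: w_def)
    qed
  qed
  have "(\<integral>\<^sup>+s. ennreal (h s) \<partial>xi_measure N b) = (\<integral>\<^sup>+s. w s * ennreal (h s) * slice_weight N s \<partial>lborel)"
    if h: "h \<in> borel_measurable borel" for h
  proof -
    have [measurable]: "h \<in> borel_measurable lebesgue"
      using h by (intro measurable_completion) simp
    have "(\<integral>\<^sup>+s. ennreal (h s) \<partial>xi_measure N b) = (\<integral>\<^sup>+s. ennreal (?k s) * ennreal (h s) \<partial>lebesgue)"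
      unfolding xi_measure_def by (rule nn_integral_density) measurable
    also have "\<dots> = (\<integral>\<^sup>+s. ennreal (?k s) * ennreal (h s) \<partial>lborel)"
      by (rule nn_integral_completion)
    also have "\<dots> = (\<integral>\<^sup>+s. w s * ennreal (h s) * slice_weight N s \<partial>lborel)"
      using w_eq AE_lborel_singleton[of "1::real"] AE_lborel_singleton[of "-1::real"]
    proof (intro nn_integral_cong_AE, eventually_elim)
      case (elim s)
      consider "s \<in> {0..<1}" | "-1 < s" "s < 0" | "s \<notin> {-1..1}" using elim by force
      then show ?case
      proof cases
        case 1
        then have eq: "w s = ennreal (b s)" "slice_weight N s = ennreal (?\<omega> s)" "?k s = b s * ?\<omega> s" and "0 \<le> b s"
          using elim b_nonneg by (auto simp: slice_weight_def)
        have prod: "ennreal (b s * ?\<omega> s) = ennreal (b s) * ennreal (?\<omega> s)"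
          using \<open>0 \<le> b s\<close> by (rule ennreal_mult')
        show ?thesis unfolding eq prod by (simp only: mult_ac)
      next
        case 2
        then show ?thesis using b_supp[of s] by (simp add: w_def)
      next
        case 3
        then have "indicator {0..<1} s = (0::ennreal)" by (auto simp: indicator_def)
        then show ?thesis using 3 by (simp add: w_def)
      qed
    qed
    finally show ?thesis .
  qed
  then show ?thesis
    using w_eq by (intro bexI[of _ w]) (auto simp: w_def)
qed

lemma lebesgue_measurable_borel_version:
  fixes F :: "'a::euclidean_space \<Rightarrow> real"
  assumes "F \<in> borel_measurable lebesgue"
  shows "\<exists>f \<in> borel_measurable borel. AE x in lborel. ennreal (F x) = f x"
proof -
  have "(\<lambda>x. ennreal (F x)) \<in> borel_measurable lebesgue" using assms by measurable
  from completion_ex_borel_measurable[OF this] show ?thesis by simp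
qed

lemma mass_ratio_range:
  assumes "\<And>i. 0 < m i"
  shows "0 < mass_ratio m i j" "mass_ratio m i j < 1"
  using assms[of i] assms[of j] by (auto simp: mass_ratio_def)

lemma measurable_bracket [measurable]: "(\<lambda>x. bracket m i x) \<in> borel_measurable borel"
  unfolding bracket_def by measurable

text \<open>
  Only sums of \<open>r\<close>-th powers occur on the left. The inner sum over \<open>j\<close> costs the power of the number of species, and
  \<open>r \<ge> p\<close>, \<open>r \<ge> q\<close> bring the remaining sums to the powers that appear in the norms.
\<close>

lemma sum_le_species_Lr:
  fixes H :: "'i::finite \<Rightarrow> 'a::euclidean_space \<Rightarrow> ennreal" and Q :: "'i \<Rightarrow> 'i \<Rightarrow> 'a \<Rightarrow> ennreal"
  assumes meas [measurable]: "\<And>i j. Q i j \<in> borel_measurable borel"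
    and le: "\<And>i v. H i v \<le> (\<Sum>j\<in>UNIV. Q i j v)"
    and r: "1 \<le> r" and p: "0 < p" "p \<le> r" and q: "0 < q" "q \<le> r"
    and bound: "\<And>i j. (\<integral>\<^sup>+v. enn_powr (Q i j v) r \<partial>lborel) \<le> enn_powr C r * enn_powr (P i) (r / p) * enn_powr (R j) (r / q)"
  shows "enn_powr (\<Sum>i\<in>UNIV. \<integral>\<^sup>+v. enn_powr (H i v) r \<partial>lborel) (1 / r)
    \<le> ennreal (real CARD('i) powr ((r - 1) / r)) * C * enn_powr (\<Sum>i\<in>UNIV. P i) (1 / p) * enn_powr (\<Sum>j\<in>UNIV. R j) (1 / q)"
proof -
  let ?I = "ennreal (real CARD('i) powr (r - 1))"
  let ?P = "\<Sum>i\<in>UNIV. P i" and ?R = "\<Sum>j\<in>UNIV. R j"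
  have "(\<integral>\<^sup>+v. enn_powr (H i v) r \<partial>lborel) \<le> ?I * (\<Sum>j\<in>UNIV. enn_powr C r * enn_powr (P i) (r / p) * enn_powr (R j) (r / q))" for i
  proof -
    have "enn_powr (H i v) r \<le> ?I * (\<Sum>j\<in>UNIV. enn_powr (Q i j v) r)" for v
      using r by (intro order_trans[OF enn_powr_mono[OF le] power_sum_le_card_powr_sum]) auto
    then have "(\<integral>\<^sup>+v. enn_powr (H i v) r \<partial>lborel) \<le> (\<integral>\<^sup>+v. ?I * (\<Sum>j\<in>UNIV. enn_powr (Q i j v) r) \<partial>lborel)"
      by (rule nn_integral_mono)
    also have "\<dots> = ?I * (\<Sum>j\<in>UNIV. \<integral>\<^sup>+v. enn_powr (Q i j v) r \<partial>lborel)"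
      by (simp add: nn_integral_cmult nn_integral_sum)
    also have "\<dots> \<le> ?I * (\<Sum>j\<in>UNIV. enn_powr C r * enn_powr (P i) (r / p) * enn_powr (R j) (r / q))"
      by (intro mult_left_mono sum_mono bound) simp
    finally show ?thesis .
  qed
  then have "(\<Sum>i\<in>UNIV. \<integral>\<^sup>+v. enn_powr (H i v) r \<partial>lborel)
      \<le> (\<Sum>i\<in>UNIV. ?I * (\<Sum>j\<in>UNIV. enn_powr C r * enn_powr (P i) (r / p) * enn_powr (R j) (r / q)))"
    by (rule sum_mono)
  also have "\<dots> = ?I * enn_powr C r * (\<Sum>i\<in>UNIV. enn_powr (P i) (r / p)) * (\<Sum>j\<in>UNIV. enn_powr (R j) (r / q))"
    by (simp only: sum_distrib_left[symmetric] sum_distrib_right[symmetric] mult.assoc)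
  also have "\<dots> \<le> ?I * enn_powr C r * enn_powr ?P (r / p) * enn_powr ?R (r / q)"
    using p q by (intro mult_mono sum_powr_le_powr_sum order_refl) auto
  finally have "enn_powr (\<Sum>i\<in>UNIV. \<integral>\<^sup>+v. enn_powr (H i v) r \<partial>lborel) (1 / r)
      \<le> enn_powr (?I * enn_powr C r * enn_powr ?P (r / p) * enn_powr ?R (r / q)) (1 / r)"
    using r by (intro enn_powr_mono) auto
  also have "\<dots> = enn_powr ?I (1 / r) * C * enn_powr ?P (1 / p) * enn_powr ?R (1 / q)"
    using r p q by (simp add: enn_powr_mult enn_powr_powr)
  also have "enn_powr ?I (1 / r) = ennreal (real CARD('i) powr ((r - 1) / r))"
    using r by (simp add: enn_powr_ennreal powr_powr)
  finally show ?thesis .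
qed

lemma sum_root_le_root_sum:
  fixes P :: "'i::finite \<Rightarrow> ennreal"
  assumes "1 \<le> p"
  shows "(\<Sum>i\<in>UNIV. enn_powr (P i) (1 / p)) \<le> ennreal (real CARD('i) powr (1 - 1 / p)) * enn_powr (\<Sum>i\<in>UNIV. P i) (1 / p)"
proof -
  have "(\<Sum>i\<in>UNIV. enn_powr (P i) (1 / p)) = enn_powr (enn_powr (\<Sum>i\<in>UNIV. enn_powr (P i) (1 / p)) p) (1 / p)"
    using assms by (simp add: enn_powr_powr)
  also have "\<dots> \<le> enn_powr (ennreal (real CARD('i) powr (p - 1)) * (\<Sum>i\<in>UNIV. enn_powr (enn_powr (P i) (1 / p)) p)) (1 / p)"
    using assms by (intro enn_powr_mono power_sum_le_card_powr_sum) auto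
  also have "\<dots> = ennreal (real CARD('i) powr ((p - 1) / p)) * enn_powr (\<Sum>i\<in>UNIV. P i) (1 / p)"
    using assms by (simp add: enn_powr_mult enn_powr_powr enn_powr_ennreal powr_powr)
  also have "(p - 1) / p = 1 - 1 / p"
    using assms by (simp add: field_simps)
  finally show ?thesis .
qed

lemma conj_exp_ennreal:
  assumes "1 < x"
  shows "conj_exp (ennreal x) = ennreal (1 / (1 - 1 / x))"
proof -
  have "1 - 1 / ennreal x = ennreal (1 - 1 / x)"
    using assms by (simp add: divide_ennreal ennreal_minus flip: ennreal_1)
  moreover have "0 < 1 - 1 / x" using assms by simp
  ultimately show ?thesis
    unfolding conj_exp_def by (simp add: divide_ennreal flip: ennreal_1)
qed

lemma conj_exp_ratio:
  assumes "1 \<le> x" "1 < r"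
  shows "enn2real (conj_exp (ennreal r) / conj_exp (ennreal x)) = (1 - 1 / x) / (1 - 1 / r)"
proof (cases "x = 1")
  case False
  then have "1 < x" using assms by simp
  then have "0 < 1 - 1 / x" "0 < 1 - 1 / r" using assms by auto
  then show ?thesis
    using conj_exp_ennreal[OF \<open>1 < x\<close>] conj_exp_ennreal[OF assms(2)]
    by (simp add: divide_ennreal)
qed (use assms in \<open>simp add: conj_exp_ennreal\<close>)

lemma MAX_MAX_ge:
  fixes X :: "'i::finite \<Rightarrow> 'i \<Rightarrow> 'b::linorder"
  shows "X i j \<le> (MAX i. MAX j. X i j)"
proof -
  have "X i j \<le> (MAX j. X i j)" by (intro Max_ge) auto
  also have "\<dots> \<le> (MAX i. MAX j. X i j)" by (intro Max_ge) auto
  finally show ?thesis .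
qed

text \<open>
  The Borel data to which the estimates for pairs apply: \<open>w\<close> represents the angular kernels, \<open>f\<close> and \<open>g\<close> the
  distribution functions multiplied by the weights, and \<open>H\<close> the gain term.
\<close>

definition Borel_reduction :: "('i::finite \<Rightarrow> real) \<Rightarrow> ('i \<Rightarrow> 'i \<Rightarrow> real) \<Rightarrow> real \<Rightarrow> nat \<Rightarrow> ('i \<Rightarrow> 'i \<Rightarrow> real \<Rightarrow> real) \<Rightarrow>
    ('i \<Rightarrow> 'i \<Rightarrow> real \<Rightarrow> real \<Rightarrow> real) \<Rightarrow> ('i \<Rightarrow> 'a::euclidean_space \<Rightarrow> real) \<Rightarrow> ('i \<Rightarrow> 'a \<Rightarrow> real) \<Rightarrow>
    ('i \<Rightarrow> 'i \<Rightarrow> real \<Rightarrow> ennreal) \<Rightarrow> ('i \<Rightarrow> 'a \<Rightarrow> ennreal) \<Rightarrow> ('i \<Rightarrow> 'a \<Rightarrow> ennreal) \<Rightarrow> ('i \<Rightarrow> 'a \<Rightarrow> ennreal) \<Rightarrow> bool" where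
  "Borel_reduction m lam \<Lambda> N b B F G w f g H \<longleftrightarrow>
     (\<forall>i j. w i j \<in> borel_measurable borel) \<and> (\<forall>i. f i \<in> borel_measurable borel) \<and>
     (\<forall>i. g i \<in> borel_measurable borel) \<and> (\<forall>i. H i \<in> borel_measurable borel) \<and>
     (\<forall>i j s. s \<notin> {0..<1} \<longrightarrow> w i j s = 0) \<and>
     (\<forall>i j. \<forall>h \<in> borel_measurable borel.
       (\<integral>\<^sup>+s. ennreal (h s) \<partial>xi_measure N (b i j)) = (\<integral>\<^sup>+s. w i j s * ennreal (h s) * slice_weight N s \<partial>lborel)) \<and>
     (\<forall>i. AE v in lborel. ennreal \<bar>F i v\<bar> * ennreal (bracket m i v powr \<Lambda>) = f i v) \<and>
     (\<forall>i. AE v in lborel. ennreal \<bar>G i v\<bar> * ennreal (bracket m i v powr \<Lambda>) = g i v) \<and>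
     (\<forall>i v. gain m B F G i v = H i v) \<and>
     (\<forall>i v. H i v \<le> (\<Sum>j\<in>UNIV. ennreal (2 powr lam i j * M_pair m lam i j) * pair_gain (mass_ratio m i j) (w i j) (f i) (g j) v))"

lemma Borel_reduction_exists:
  fixes m :: "'i::finite \<Rightarrow> real" and lam :: "'i \<Rightarrow> 'i \<Rightarrow> real" and b :: "'i \<Rightarrow> 'i \<Rightarrow> real \<Rightarrow> real"
    and B :: "'i \<Rightarrow> 'i \<Rightarrow> real \<Rightarrow> real \<Rightarrow> real" and F G :: "'i \<Rightarrow> 'a::euclidean_space \<Rightarrow> real"
  assumes dim: "2 \<le> DIM('a)"
    and mass: "\<And>i. m i > 0"
    and lam: "\<And>i j. 0 \<le> lam i j" "\<And>i j. lam i j \<le> \<Lambda>"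
    and b_nonneg: "\<And>i j s. s \<in> {-1..1} \<Longrightarrow> b i j s \<ge> 0"
    and b_supp: "\<And>i j s. s \<in> {-1..1} \<Longrightarrow> s \<notin> {0..1} \<Longrightarrow> b i j s = 0"
    and b_L1: "\<And>i j. set_integrable lebesgue {-1..1} (\<lambda>s. b i j s * (1 - s\<^sup>2) powr ((real N - 3) / 2))"
    and kernel: "\<And>i j x y. x > 0 \<Longrightarrow> y \<in> {-1..1} \<Longrightarrow> B i j x y = x powr lam i j * b i j y"
    and F: "\<And>i v. F i v \<ge> 0" "\<And>i. F i \<in> borel_measurable lebesgue"
    and G: "\<And>i v. G i v \<ge> 0" "\<And>i. G i \<in> borel_measurable lebesgue"
  shows "\<exists>w f g H. Borel_reduction m lam \<Lambda> N b B F G w f g H"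
proof -
  define D where "D i j w \<longleftrightarrow> w \<in> borel_measurable borel \<and> (\<forall>s. s \<notin> {0..<1} \<longrightarrow> w s = 0) \<and>
    (AE s in lborel. s \<in> {0..<1} \<longrightarrow> ennreal (b i j s) = w s) \<and>
    (\<forall>h \<in> borel_measurable borel. (\<integral>\<^sup>+s. ennreal (h s) \<partial>xi_measure N (b i j)) = (\<integral>\<^sup>+s. w s * ennreal (h s) * slice_weight N s \<partial>lborel))"
    for i j w
  have "\<forall>i j. \<exists>w. D i j w"
  proof (intro allI)
    fix i j
    have "\<exists>w \<in> borel_measurable borel. (\<forall>s. s \<notin> {0..<1} \<longrightarrow> w s = 0) \<and>
      (AE s in lborel. s \<in> {0..<1} \<longrightarrow> ennreal (b i j s) = w s) \<and>
      (\<forall>h \<in> borel_measurable borel. (\<integral>\<^sup>+s. ennreal (h s) \<partial>xi_measure N (b i j)) = (\<integral>\<^sup>+s. w s * ennreal (h s) * slice_weight N s \<partial>lborel))"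
      by (intro angular_density_exists b_nonneg b_supp b_L1)
    then show "\<exists>w. D i j w" unfolding D_def by blast
  qed
  then obtain w where "\<And>i j. D i j (w i j)" by metis
  then have w: "\<And>i j. w i j \<in> borel_measurable borel" "\<And>i j s. s \<notin> {0..<1} \<Longrightarrow> w i j s = 0"
    "\<And>i j. AE s in lborel. s \<in> {0..<1} \<longrightarrow> ennreal (b i j s) = w i j s"
    "\<And>i j h. h \<in> borel_measurable borel \<Longrightarrow>
      (\<integral>\<^sup>+s. ennreal (h s) \<partial>xi_measure N (b i j)) = (\<integral>\<^sup>+s. w i j s * ennreal (h s) * slice_weight N s \<partial>lborel)"
    unfolding D_def by blast+
  have "\<forall>i. \<exists>f \<in> borel_measurable borel. AE x in lborel. ennreal (F i x) = f x"
    by (intro allI lebesgue_measurable_borel_version F)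
  then obtain f where f: "\<And>i. f i \<in> borel_measurable borel" "\<And>i. AE x in lborel. ennreal (F i x) = f i x"
    by metis
  have "\<forall>i. \<exists>g \<in> borel_measurable borel. AE x in lborel. ennreal (G i x) = g x"
    by (intro allI lebesgue_measurable_borel_version G)
  then obtain g where g: "\<And>i. g i \<in> borel_measurable borel" "\<And>i. AE x in lborel. ennreal (G i x) = g i x"
    by metis
  note [measurable] = w(1) f(1) g(1)
  let ?H = "\<lambda>i v. \<Sum>j\<in>UNIV. kernel_gain (mass_ratio m i j) (lam i j) (w i j) (f i) (g j) v"
  have gain: "gain m B F G i v = ?H i v" for i v
    unfolding gain_def
  proof (rule sum.cong[OF refl], goal_cases)
    case (1 j)
    show ?case
      by (intro gain_term_eq_kernel_gain[where b = "b i j"] dim mass_ratio_range mass w f g F G b_nonneg b_supp kernel)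
  qed
  let ?f = "\<lambda>i x. f i x * ennreal (bracket m i x powr \<Lambda>)" and ?g = "\<lambda>i x. g i x * ennreal (bracket m i x powr \<Lambda>)"
  have "?f i \<in> borel_measurable borel" "?g i \<in> borel_measurable borel" "?H i \<in> borel_measurable borel" for i
    by measurable
  moreover have "AE v in lborel. ennreal \<bar>F i v\<bar> * ennreal (bracket m i v powr \<Lambda>) = ?f i v" for i
    using f(2)[of i] by eventually_elim (simp add: F(1))
  moreover have "AE v in lborel. ennreal \<bar>G i v\<bar> * ennreal (bracket m i v powr \<Lambda>) = ?g i v" for i
    using g(2)[of i] by eventually_elim (simp add: G(1))
  moreover have "?H i v \<le> (\<Sum>j\<in>UNIV. ennreal (2 powr lam i j * M_pair m lam i j) *
      pair_gain (mass_ratio m i j) (w i j) (?f i) (?g j) v)" for i v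
    by (intro sum_mono kernel_gain_le_pair_gain mass lam w f g)
  ultimately have "Borel_reduction m lam \<Lambda> N b B F G w ?f ?g ?H"
    unfolding Borel_reduction_def using w gain by (intro conjI allI ballI impI) (assumption | rule w | blast)+
  then show ?thesis by blast
qed

lemma Lnorm_finite_eq:
  fixes H h :: "'i::finite \<Rightarrow> 'a::euclidean_space \<Rightarrow> ennreal"
  assumes "\<And>i. AE v in lborel. H i v * ennreal (bracket m i v powr k) = h i v" "0 < p"
  shows "Lnorm m (ennreal p) k H = enn_powr (\<Sum>i\<in>UNIV. \<integral>\<^sup>+v. enn_powr (h i v) p \<partial>lborel) (1 / p)"
proof -
  have "(\<integral>\<^sup>+v. enn_powr (H i v * ennreal (bracket m i v powr k)) p \<partial>lebesgue) = (\<integral>\<^sup>+v. enn_powr (h i v) p \<partial>lborel)" for i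
    unfolding nn_integral_completion
    using assms(1)[of i] by (intro nn_integral_cong_AE) (auto elim!: eventually_mono)
  then show ?thesis using assms(2) by (simp add: Lnorm_def)
qed

lemma Lnorm_infinity_obtain:
  fixes H h :: "'i::finite \<Rightarrow> 'a::euclidean_space \<Rightarrow> ennreal"
  assumes "\<And>i. AE v in lborel. H i v * ennreal (bracket m i v powr k) = h i v"
  obtains M where "\<And>i. AE v in lborel. h i v \<le> M i" "Lnorm m \<infinity> k H = (\<Sum>i\<in>UNIV. M i)"
proof (rule that)
  let ?M = "\<lambda>i. esssup lebesgue (\<lambda>v. H i v * ennreal (bracket m i v powr k))"
  show "AE v in lborel. h i v \<le> ?M i" for i
  proof -
    have "AE v in lborel. H i v * ennreal (bracket m i v powr k) \<le> ?M i"
      using esssup_AE[of "\<lambda>v. H i v * ennreal (bracket m i v powr k)" lebesgue] by (simp only: AE_completion_iff)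
    with assms[of i] show ?thesis by eventually_elim simp
  qed
  show "Lnorm m \<infinity> k H = (\<Sum>i\<in>UNIV. ?M i)" by (simp add: Lnorm_def)
qed

lemma Lnorm_infinity_le:
  fixes H :: "'i::finite \<Rightarrow> 'a::euclidean_space \<Rightarrow> ennreal"
  assumes "\<And>i. H i \<in> borel_measurable borel" "\<And>i. 0 < m i" "\<And>i v. H i v \<le> c i"
  shows "Lnorm m \<infinity> 0 H \<le> (\<Sum>i\<in>UNIV. c i)"
proof -
  have "bracket m i v powr 0 = 1" for i and v :: 'a
    using bracket_ge_1[of m i v, OF assms(2)] by simp
  then have "esssup lebesgue (\<lambda>v. H i v * ennreal (bracket m i v powr 0)) \<le> c i" for i
  proof -
    have "H i \<in> borel_measurable lebesgue"
      using assms(1)[of i] by (intro measurable_completion) simp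
    then show ?thesis
      unfolding \<open>\<And>v i. bracket m i v powr 0 = 1\<close> by (intro esssup_I) (simp_all add: assms(3))
  qed
  then show ?thesis by (simp add: Lnorm_def sum_mono)
qed

section \<open>Exponents and the estimate for the mixture\<close>

lemma exponents_finite:
  fixes p q :: ennreal
  assumes "1 \<le> p" "1 \<le> q" "1 / p + 1 / q = 1 + 1 / ennreal r" "1 \<le> r"
  obtains p' q' where "p = ennreal p'" "q = ennreal q'" "1 \<le> p'" "1 \<le> q'" "1 / p' + 1 / q' = 1 + 1 / r"
proof -
  have le1: "1 / x \<le> 1" if "1 \<le> x" for x :: ennreal
    using that by (cases x) (auto simp: divide_ennreal simp flip: ennreal_1)
  have r: "1 + 1 / ennreal r = ennreal (1 + 1 / r)"
    using assms(4) by (simp add: divide_ennreal ennreal_plus flip: ennreal_1)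
  have gt: "1 < 1 + 1 / ennreal r"
    unfolding r using assms(4) by (simp flip: ennreal_1)
  have "p \<noteq> \<infinity>" "q \<noteq> \<infinity>"
    using assms(3) le1[OF assms(1)] le1[OF assms(2)] gt by (auto simp: not_le)
  then obtain p' q' where p': "p = ennreal p'" "0 \<le> p'" and q': "q = ennreal q'" "0 \<le> q'"
    by (cases p; cases q) auto
  have ge: "1 \<le> p'" "1 \<le> q'" using assms(1,2) p' q' by (auto simp flip: ennreal_1)
  have "ennreal (1 / p' + 1 / q') = ennreal (1 + 1 / r)"
    using assms(3) ge unfolding r p' q' by (simp add: divide_ennreal ennreal_plus flip: ennreal_1)
  then have "1 / p' + 1 / q' = 1 + 1 / r"
    using ge assms(4) by (subst (asm) ennreal_inj) auto
  with that p' q' ge show ?thesis by blast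
qed

lemma exponents_infinite:
  fixes p q :: ennreal
  assumes "1 \<le> p" "1 \<le> q" "1 / p + 1 / q = 1"
  obtains "p = 1" "q = \<infinity>" | "p = \<infinity>" "q = 1"
  | p' q' where "p = ennreal p'" "q = ennreal q'" "1 < p'" "1 < q'" "1 / p' + 1 / q' = 1"
proof (cases p; cases q)
  fix p' q' assume p': "p = ennreal p'" "0 \<le> p'" and q': "q = ennreal q'" "0 \<le> q'"
  have ge: "1 \<le> p'" "1 \<le> q'" using assms(1,2) p' q' by (auto simp flip: ennreal_1)
  have "ennreal (1 / p' + 1 / q') = ennreal 1"
    using assms(3) ge unfolding p' q' by (simp add: divide_ennreal ennreal_plus flip: ennreal_1)
  then have eq: "1 / p' + 1 / q' = 1"
    using ge by (subst (asm) ennreal_inj) auto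
  moreover have "0 < 1 / p'" "0 < 1 / q'" using ge by auto
  ultimately have "1 / p' < 1" "1 / q' < 1" by linarith+
  then have "1 < p'" "1 < q'" using ge by (auto simp: divide_simps split: if_splits)
  with that(3) p' q' eq show ?thesis by blast
next
  fix p' assume p': "p = ennreal p'" "0 \<le> p'" and "q = top"
  have ge: "1 \<le> p'" using assms(1) p' by (auto simp flip: ennreal_1)
  have "ennreal (1 / p') = ennreal 1"
    using assms(3) ge \<open>q = top\<close> unfolding p' by (simp add: divide_ennreal flip: ennreal_1)
  then have "p' = 1" using ge by (subst (asm) ennreal_inj) auto
  then show ?thesis using that(1) p' \<open>q = top\<close> by simp
next
  fix q' assume q': "q = ennreal q'" "0 \<le> q'" and "p = top"
  have ge: "1 \<le> q'" using assms(2) q' by (auto simp flip: ennreal_1)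
  have "ennreal (1 / q') = ennreal 1"
    using assms(3) ge \<open>p = top\<close> unfolding q' by (simp add: divide_ennreal flip: ennreal_1)
  then have "q' = 1" using ge by (subst (asm) ennreal_inj) auto
  then show ?thesis using that(2) q' \<open>p = top\<close> by simp
next
  assume "p = top" "q = top"
  then show ?thesis using assms(3) by simp
qed

theorem theorem4p4:
  fixes m :: "'i::finite \<Rightarrow> real"
    and lam :: "'i \<Rightarrow> 'i \<Rightarrow> real"
    and b :: "'i \<Rightarrow> 'i \<Rightarrow> real \<Rightarrow> real"
    and B :: "'i \<Rightarrow> 'i \<Rightarrow> real \<Rightarrow> real \<Rightarrow> real"
    and F G :: "'i \<Rightarrow> real ^ 'n \<Rightarrow> real"
    and p q r :: ennreal
    and \<Lambda> :: real
  assumes dim: "CARD('n) \<ge> 2"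
    and mass: "\<And>i. m i > 0"
    and exps: "1 \<le> p" "1 \<le> q" "1 \<le> r" "1 / p + 1 / q = 1 + 1 / r"
    and lam_nonneg: "\<And>i j. lam i j \<ge> 0"
    and b_nonneg: "\<And>i j s. s \<in> {-1..1} \<Longrightarrow> b i j s \<ge> 0"
    and b_supp: "\<And>i j s. s \<in> {-1..1} \<Longrightarrow> s \<notin> {0..1} \<Longrightarrow> b i j s = 0"
    and b_L1: "\<And>i j. set_integrable lebesgue {-1..1}
                 (\<lambda>s. b i j s * (1 - s\<^sup>2) powr ((real CARD('n) - 3) / 2))"
    and kernel: "\<And>i j x y. x > 0 \<Longrightarrow> y \<in> {-1..1} \<Longrightarrow> B i j x y = x powr lam i j * b i j y"
    and Lambda: "\<Lambda> = (MAX i. MAX j. lam i j)"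
    and F_nonneg: "\<And>i v. F i v \<ge> 0"
    and G_nonneg: "\<And>i v. G i v \<ge> 0"
    and F: "F \<in> Lspace m p \<Lambda>"
    and G: "G \<in> Lspace m q \<Lambda>"
  shows "Lnorm m r 0 (gain m B F G)
           \<le> (if r = \<infinity> \<and> 1 < p \<and> p < \<infinity> then of_nat CARD('i) else 1)
             * C_gain CARD('n) m lam b p q r
             * Lnorm m p \<Lambda> (\<lambda>i v. ennreal \<bar>F i v\<bar>) * Lnorm m q \<Lambda> (\<lambda>i v. ennreal \<bar>G i v\<bar>)"
proof -
  have dim': "2 \<le> DIM(real ^ 'n)" using dim by simp
  have Dim: "DIM(real ^ 'n) = CARD('n)" by simp
  have lam_le: "lam i j \<le> \<Lambda>" for i j unfolding Lambda by (rule MAX_MAX_ge)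
  have F_meas: "F i \<in> borel_measurable lebesgue" and G_meas: "G i \<in> borel_measurable lebesgue" for i
    using F G by (auto simp: Lspace_def)
  have "\<exists>w f g H. Borel_reduction m lam \<Lambda> CARD('n) b B F G w f g H"
    by (rule Borel_reduction_exists[OF dim' mass lam_nonneg lam_le b_nonneg b_supp b_L1 kernel F_nonneg F_meas G_nonneg G_meas])
  then obtain w f g H where red: "Borel_reduction m lam \<Lambda> CARD('n) b B F G w f g H"
    by blast
  then have meas [measurable]: "\<And>i j. w i j \<in> borel_measurable borel" "\<And>i. f i \<in> borel_measurable borel"
      "\<And>i. g i \<in> borel_measurable borel" "\<And>i. H i \<in> borel_measurable borel"
    and supp: "\<And>i j s. s \<notin> {0..<1} \<Longrightarrow> w i j s = 0"
    and xi: "\<And>i j h. h \<in> borel_measurable borel \<Longrightarrow>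
      (\<integral>\<^sup>+s. ennreal (h s) \<partial>xi_measure CARD('n) (b i j)) = (\<integral>\<^sup>+s. w i j s * ennreal (h s) * slice_weight CARD('n) s \<partial>lborel)"
    and f: "\<And>i. AE v in lborel. ennreal \<bar>F i v\<bar> * ennreal (bracket m i v powr \<Lambda>) = f i v"
    and g: "\<And>i. AE v in lborel. ennreal \<bar>G i v\<bar> * ennreal (bracket m i v powr \<Lambda>) = g i v"
    and gain: "\<And>i v. gain m B F G i v = H i v"
    and H_le: "\<And>i v. H i v \<le> (\<Sum>j\<in>UNIV. ennreal (2 powr lam i j * M_pair m lam i j) * pair_gain (mass_ratio m i j) (w i j) (f i) (g j) v)"
    unfolding Borel_reduction_def by blast+
  define N where "N = CARD('n)"
  define S where "S = ennreal (sphere_area (N - 2))"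
  define T where "T i j = ennreal (2 powr lam i j * M_pair m lam i j)" for i j
  define \<rho> where "\<rho> = mass_ratio m"
  have \<rho>: "0 < \<rho> i j" "\<rho> i j < 1" for i j unfolding \<rho>_def by (rule mass_ratio_range[of m, OF mass])+
  let ?NF = "Lnorm m p \<Lambda> (\<lambda>i v. ennreal \<bar>F i v\<bar>)" and ?NG = "Lnorm m q \<Lambda> (\<lambda>i v. ennreal \<bar>G i v\<bar>)"
  let ?pg = "\<lambda>i j v. pair_gain (\<rho> i j) (w i j) (f i) (g j) v"
  let ?Ci = "\<lambda>i j. C_pair_infinity N (b i j) (\<rho> i j) p"
  let ?W = "\<lambda>i j x y s. w i j s * Holder_weight N (\<rho> i j) x y s * slice_weight N s"
  define Q where "Q i j v = T i j * ?pg i j v" for i j v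
  have [measurable]: "Q i j \<in> borel_measurable borel" for i j unfolding Q_def[abs_def] by measurable
  have HQ: "H i v \<le> (\<Sum>j\<in>UNIV. Q i j v)" for i v using H_le by (simp add: Q_def T_def \<rho>_def)
  have gain_H: "gain m B F G = H" using gain by (intro ext)
  have minus: "minus_int N (b i j) (\<rho> i j) a = (\<integral>\<^sup>+s. w i j s * ennreal (minus_sq (\<rho> i j) s powr (- a)) * slice_weight N s \<partial>lborel)" for i j a
    unfolding N_def by (subst xi[symmetric]) (simp_all add: minus_int_def minus_sq_def)
  have plus: "plus_int N (b i j) (\<rho> i j) a = (\<integral>\<^sup>+s. w i j s * ennreal (plus_sq (\<rho> i j) s powr (- a)) * slice_weight N s \<partial>lborel)" for i j a
    unfolding N_def by (subst xi[symmetric]) (simp_all add: plus_int_def plus_sq_def)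
  have b_norm: "b_norm N (b i j) = S * (\<integral>\<^sup>+s. w i j s * slice_weight N s \<partial>lborel)" for i j
  proof -
    have "emeasure (xi_measure N (b i j)) {-1..1} = (\<integral>\<^sup>+s. ennreal (indicator {-1..1} s) \<partial>xi_measure N (b i j))"
      by (subst nn_integral_indicator[symmetric]) (simp_all add: xi_measure_def ennreal_indicator)
    also have "\<dots> = (\<integral>\<^sup>+s. w i j s * ennreal (indicator {-1..1} s) * slice_weight N s \<partial>lborel)"
      unfolding N_def by (rule xi) simp
    also have "\<dots> = (\<integral>\<^sup>+s. w i j s * slice_weight N s \<partial>lborel)"
      by (intro nn_integral_cong) (auto simp: slice_weight_def indicator_def)
    finally show ?thesis by (simp add: b_norm_def S_def)
  qed
  have Holder_le: "S * (\<integral>\<^sup>+s. ?W i j \<beta> \<gamma> s \<partial>lborel)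
      \<le> S * enn_powr (minus_int N (b i j) (\<rho> i j) (real N * (\<beta> + \<gamma>) / 2)) (\<beta> / (\<beta> + \<gamma>))
          * enn_powr (plus_int N (b i j) (\<rho> i j) (real N * (\<beta> + \<gamma>) / 2)) (\<gamma> / (\<beta> + \<gamma>))"
    if "0 \<le> \<beta>" "0 \<le> \<gamma>" "0 < \<beta> + \<gamma>" for i j \<beta> \<gamma>
    unfolding minus plus mult.assoc[of S]
    by (intro mult_left_mono Holder_weight_integral[OF \<rho> meas(1) supp that]) simp_all
  show ?thesis
  proof (cases "r = \<infinity>")
    case False
    then obtain r' where r': "r = ennreal r'" "0 \<le> r'" by (cases r) auto
    have r1: "1 \<le> r'" using exps(3) r' by (simp flip: ennreal_1)
    obtain p' q' where p': "p = ennreal p'" and q': "q = ennreal q'" and ge: "1 \<le> p'" "1 \<le> q'"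
      and sum: "1 / p' + 1 / q' = 1 + 1 / r'"
      using exponents_finite[OF exps(1,2) exps(4)[unfolded r'(1)] r1] by blast
    \<comment> \<open>The Hoelder exponents: \<open>\<beta>\<close> and \<open>\<gamma>\<close> are the reciprocals of the exponents conjugate to \<open>q\<close> and \<open>p\<close>.\<close>
    define \<alpha> \<beta> \<gamma> where "\<alpha> = 1 / r'" and "\<beta> = 1 - 1 / q'" and "\<gamma> = 1 - 1 / p'"
    have abc: "0 < \<alpha>" "0 \<le> \<beta>" "0 \<le> \<gamma>" "\<alpha> + \<beta> + \<gamma> = 1"
      using r1 ge sum by (auto simp: \<alpha>_def \<beta>_def \<gamma>_def)
    have pq: "p' * (\<alpha> + \<beta>) = 1" "q' * (\<alpha> + \<gamma>) = 1"
    proof -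
      have "\<alpha> + \<beta> = 1 / p'" "\<alpha> + \<gamma> = 1 / q'" using sum by (auto simp: \<alpha>_def \<beta>_def \<gamma>_def)
      then show "p' * (\<alpha> + \<beta>) = 1" "q' * (\<alpha> + \<gamma>) = 1" using ge by auto
    qed
    have "1 / r' \<le> 1 / p'" "1 / r' \<le> 1 / q'" using sum abc(2,3) by (auto simp: \<beta>_def \<gamma>_def)
    then have le: "p' \<le> r'" "q' \<le> r'" using ge r1 by (auto simp: divide_simps split: if_splits)
    define P where "P i = (\<integral>\<^sup>+x. enn_powr (f i x) p' \<partial>lborel)" for i
    define R where "R j = (\<integral>\<^sup>+x. enn_powr (g j x) q' \<partial>lborel)" for j
    have NF: "?NF = enn_powr (\<Sum>i\<in>UNIV. P i) (1 / p')" and NG: "?NG = enn_powr (\<Sum>j\<in>UNIV. R j) (1 / q')"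
      unfolding p' q' P_def R_def using ge by (auto intro!: Lnorm_finite_eq f g)
    let ?X = "\<lambda>i j. S * (\<integral>\<^sup>+s. ?W i j \<beta> \<gamma> s \<partial>lborel)"
    have main: "Lnorm m r 0 (gain m B F G) \<le> ennreal (real CARD('i) powr ((r' - 1) / r')) * C * ?NF * ?NG"
      if C: "\<And>i j. T i j * ?X i j \<le> C" for C
    proof -
      have "Lnorm m r 0 H = enn_powr (\<Sum>i\<in>UNIV. \<integral>\<^sup>+v. enn_powr (H i v) r' \<partial>lborel) (1 / r')"
      proof -
        have "bracket m i v powr 0 = 1" for i and v :: "real ^ 'n"
          using bracket_ge_1[of m i v, OF mass] by simp
        then show ?thesis unfolding r'(1) using r1 by (intro Lnorm_finite_eq) auto
      qed
      also have "\<dots> \<le> ennreal (real CARD('i) powr ((r' - 1) / r')) * C * enn_powr (\<Sum>i\<in>UNIV. P i) (1 / p') * enn_powr (\<Sum>j\<in>UNIV. R j) (1 / q')"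
      proof (rule sum_le_species_Lr[OF _ HQ r1])
        fix i j
        have "(\<integral>\<^sup>+v. enn_powr (Q i j v) r' \<partial>lborel) = enn_powr (T i j) r' * (\<integral>\<^sup>+v. enn_powr (?pg i j v) (1 / \<alpha>) \<partial>lborel)"
          using r1 by (simp add: Q_def enn_powr_mult nn_integral_cmult \<alpha>_def)
        also have "\<dots> \<le> enn_powr (T i j) r' * (enn_powr (?X i j) (1 / \<alpha>) * enn_powr (P i) (1 / (\<alpha> * p')) * enn_powr (R j) (1 / (\<alpha> * q')))"
          using pair_gain_Lr[OF dim' \<rho> meas(1) meas(2) meas(3) supp abc _ pq(1) _ pq(2)] ge
          unfolding P_def R_def S_def N_def Dim by (intro mult_left_mono) auto
        also have "\<dots> = enn_powr (T i j * ?X i j) r' * enn_powr (P i) (r' / p') * enn_powr (R j) (r' / q')"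
          using r1 by (simp add: \<alpha>_def enn_powr_mult mult.assoc)
        also have "\<dots> \<le> enn_powr C r' * enn_powr (P i) (r' / p') * enn_powr (R j) (r' / q')"
          using r1 by (intro mult_right_mono enn_powr_mono C) auto
        finally show "(\<integral>\<^sup>+v. enn_powr (Q i j v) r' \<partial>lborel) \<le> enn_powr C r' * enn_powr (P i) (r' / p') * enn_powr (R j) (r' / q')" .
      qed (use ge le in auto)
      finally show ?thesis by (simp only: gain_H NF NG)
    qed
    show ?thesis
    proof (cases "r = 1")
      case True
      then have "r' = 1" using r' by (simp flip: ennreal_1)
      then have zero: "\<beta> = 0" "\<gamma> = 0" using abc by (auto simp: \<alpha>_def)
      have "Lnorm m r 0 (gain m B F G) \<le> ennreal (real CARD('i) powr ((r' - 1) / r')) *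
          (MAX i. MAX j. T i j * b_norm N (b i j)) * ?NF * ?NG"
      proof (rule main)
        fix i j
        have "?X i j \<le> b_norm N (b i j)"
          unfolding b_norm
        proof (intro mult_left_mono nn_integral_mono mult_right_mono)
          fix s
          \<comment> \<open>An inequality, because \<open>0 powr 0 = 0\<close>.\<close>
          have "Holder_weight N (\<rho> i j) 0 0 s \<le> 1" by (simp add: Holder_weight_def)
          from mult_left_mono[OF this, of "w i j s"]
          show "w i j s * Holder_weight N (\<rho> i j) \<beta> \<gamma> s \<le> w i j s" by (simp add: zero)
        qed auto
        then have "T i j * ?X i j \<le> T i j * b_norm N (b i j)" by (rule mult_left_mono) simp
        also have "\<dots> \<le> (MAX i. MAX j. T i j * b_norm N (b i j))" by (rule MAX_MAX_ge)
        finally show "T i j * ?X i j \<le> (MAX i. MAX j. T i j * b_norm N (b i j))" .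
      qed
      then show ?thesis
        using True \<open>r' = 1\<close> by (simp add: C_gain_def T_def N_def)
    next
      case ne1: False
      then have r2: "1 < r'" using r1 r' by (auto simp: less_le)
      have bc: "\<beta> + \<gamma> = 1 - 1 / r'" "0 < \<beta> + \<gamma>"
      proof -
        show *: "\<beta> + \<gamma> = 1 - 1 / r'" using abc(4) by (simp add: \<alpha>_def)
        show "0 < \<beta> + \<gamma>" unfolding * using r2 by simp
      qed
      have conj: "real N / (2 * enn2real (conj_exp r)) = real N * (\<beta> + \<gamma>) / 2"
        using bc r2 unfolding r'(1) conj_exp_ennreal[OF r2] by (simp add: bc(1)[symmetric])
      have ratio: "enn2real (conj_exp r / conj_exp q) = \<beta> / (\<beta> + \<gamma>)" "enn2real (conj_exp r / conj_exp p) = \<gamma> / (\<beta> + \<gamma>)"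
        unfolding bc(1) r'(1) p' q' conj_exp_ratio[OF ge(1) r2] conj_exp_ratio[OF ge(2) r2] by (simp_all add: \<beta>_def \<gamma>_def)
      have "Lnorm m r 0 (gain m B F G) \<le> ennreal (real CARD('i) powr ((r' - 1) / r')) *
          (MAX i. MAX j. T i j * C_pair N (b i j) (\<rho> i j) p q r) * ?NF * ?NG"
      proof (rule main)
        fix i j
        have "?X i j \<le> C_pair N (b i j) (\<rho> i j) p q r"
          using Holder_le[OF abc(2,3) bc(2), of i j]
          unfolding C_pair_def conj ratio S_def[symmetric] .
        then have "T i j * ?X i j \<le> T i j * C_pair N (b i j) (\<rho> i j) p q r" by (rule mult_left_mono) simp
        also have "\<dots> \<le> (MAX i. MAX j. T i j * C_pair N (b i j) (\<rho> i j) p q r)" by (rule MAX_MAX_ge)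
        finally show "T i j * ?X i j \<le> (MAX i. MAX j. T i j * C_pair N (b i j) (\<rho> i j) p q r)" .
      qed
      then show ?thesis
        using False ne1 r' by (simp add: C_gain_def T_def N_def \<rho>_def)
    qed
  next
    case True
    \<comment> \<open>Here the exponents of Hoelder's inequality are \<open>0\<close>, \<open>1 / p\<close> and \<open>1 / q\<close>, and the bounds hold pointwise in \<open>v\<close>.\<close>
    define K where "K = (MAX i. MAX j. T i j * ?Ci i j)"
    have C_gain: "C_gain CARD('n) m lam b p q r = K"
      using True by (simp add: C_gain_def K_def T_def N_def \<rho>_def)
    have K: "T i j * ?Ci i j \<le> K" for i j
      unfolding K_def by (rule MAX_MAX_ge)
    have main: "Lnorm m r 0 (gain m B F G) \<le> K * (\<Sum>i\<in>UNIV. P i) * (\<Sum>j\<in>UNIV. R j)"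
      if PR: "\<And>i j v. ?pg i j v \<le> ?Ci i j * P i * R j" for P R
    proof -
      have "H i v \<le> K * P i * (\<Sum>j\<in>UNIV. R j)" for i v
      proof -
        have "H i v \<le> (\<Sum>j\<in>UNIV. Q i j v)" by (rule HQ)
        also have "\<dots> \<le> (\<Sum>j\<in>UNIV. K * P i * R j)"
        proof (rule sum_mono)
          fix j
          have "Q i j v \<le> T i j * (?Ci i j * P i * R j)"
            unfolding Q_def by (intro mult_left_mono PR) simp
          also have "\<dots> = T i j * ?Ci i j * P i * R j" by (simp only: mult.assoc)
          also have "\<dots> \<le> K * P i * R j" by (intro mult_right_mono K) auto
          finally show "Q i j v \<le> K * P i * R j" .
        qed
        finally show ?thesis by (simp only: sum_distrib_left)
      qed
      then have "Lnorm m r 0 H \<le> (\<Sum>i\<in>UNIV. K * P i * (\<Sum>j\<in>UNIV. R j))"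
        unfolding True by (intro Lnorm_infinity_le mass) auto
      then show ?thesis by (simp only: gain_H sum_distrib_left[symmetric] sum_distrib_right[symmetric])
    qed
    have "1 / p + 1 / q = 1" using exps(4) True by simp
    from exponents_infinite[OF exps(1,2) this] show ?thesis
    proof cases
      case 1
      obtain R where R: "\<And>i. AE v in lborel. g i v \<le> R i" "?NG = (\<Sum>i\<in>UNIV. R i)"
        using Lnorm_infinity_obtain[OF g] 1(2) by metis
      have NF: "?NF = (\<Sum>i\<in>UNIV. \<integral>\<^sup>+x. f i x \<partial>lborel)"
        using Lnorm_finite_eq[of "\<lambda>i v. ennreal \<bar>F i v\<bar>" m \<Lambda> f 1, OF f] 1(1) by simp
      have "Lnorm m r 0 (gain m B F G) \<le> K * (\<Sum>i\<in>UNIV. \<integral>\<^sup>+x. f i x \<partial>lborel) * (\<Sum>j\<in>UNIV. R j)"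
      proof (rule main)
        fix i j v
        show "?pg i j v \<le> ?Ci i j * (\<integral>\<^sup>+x. f i x \<partial>lborel) * R j"
          using pair_gain_le_sup_right[where \<rho> = "\<rho> i j" and w = "w i j" and f = "f i" and g = "g j" and M = "R j" and v = v,
              OF dim' \<rho> meas(1-3) supp R(1)] 1(1)
          by (simp add: C_pair_infinity_def minus[unfolded N_def] N_def)
      qed
      then show ?thesis unfolding C_gain NF R(2) using 1 by simp
    next
      case 2
      obtain P where P: "\<And>i. AE v in lborel. f i v \<le> P i" "?NF = (\<Sum>i\<in>UNIV. P i)"
        using Lnorm_infinity_obtain[OF f] 2(1) by metis
      have NG: "?NG = (\<Sum>i\<in>UNIV. \<integral>\<^sup>+x. g i x \<partial>lborel)"
        using Lnorm_finite_eq[of "\<lambda>i v. ennreal \<bar>G i v\<bar>" m \<Lambda> g 1, OF g] 2(2) by simp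
      have "Lnorm m r 0 (gain m B F G) \<le> K * (\<Sum>i\<in>UNIV. P i) * (\<Sum>j\<in>UNIV. \<integral>\<^sup>+x. g j x \<partial>lborel)"
      proof (rule main)
        fix i j v
        have c: "1 / conj_exp p = 1" unfolding 2(1) conj_exp_infinity by simp
        show "?pg i j v \<le> ?Ci i j * P i * (\<integral>\<^sup>+x. g j x \<partial>lborel)"
          using pair_gain_le_sup_left[where \<rho> = "\<rho> i j" and w = "w i j" and f = "f i" and g = "g j" and M = "P i" and v = v,
              OF dim' \<rho> meas(1-3) supp P(1)] 2(1)
          unfolding C_pair_infinity_def c by (simp add: plus[unfolded N_def] N_def)
      qed
      then show ?thesis unfolding C_gain NG P(2) using 2 by simp
    next
      case (3 p' q')
      define P where "P i = (\<integral>\<^sup>+x. enn_powr (f i x) p' \<partial>lborel)" for i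
      define R where "R j = (\<integral>\<^sup>+x. enn_powr (g j x) q' \<partial>lborel)" for j
      have NF: "?NF = enn_powr (\<Sum>i\<in>UNIV. P i) (1 / p')" and NG: "?NG = enn_powr (\<Sum>j\<in>UNIV. R j) (1 / q')"
        unfolding 3(1,2) P_def R_def using 3 by (auto intro!: Lnorm_finite_eq f g)
      \<comment> \<open>Sums of norms are compared with norms of sums, once for each of the two indices; the powers of the number of
        species, \<open>1 - 1 / p'\<close> and \<open>1 - 1 / q'\<close>, add up to \<open>1\<close>.\<close>
      have "Lnorm m r 0 (gain m B F G) \<le> K * (\<Sum>i\<in>UNIV. enn_powr (P i) (1 / p')) * (\<Sum>j\<in>UNIV. enn_powr (R j) (1 / q'))"
      proof (rule main)
        fix i j v
        let ?X = "S * (\<integral>\<^sup>+s. ?W i j (1 / p') (1 / q') s \<partial>lborel)"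
        have "?pg i j v \<le> enn_powr (?X * P i) (1 / p') * enn_powr (?X * R j) (1 / q')"
          using pair_gain_Holder[where \<rho> = "\<rho> i j" and w = "w i j" and f = "f i" and g = "g j" and v = v
                and a = 0 and b = "1 / p'" and c = "1 / q'" and p = p' and q = q', OF dim' \<rho> meas(1-3) supp] 3
          by (simp add: S_def N_def P_def R_def)
        also have "\<dots> = (enn_powr ?X (1 / p') * enn_powr ?X (1 / q')) * enn_powr (P i) (1 / p') * enn_powr (R j) (1 / q')"
          using 3 by (simp add: enn_powr_mult mult_ac)
        also have "enn_powr ?X (1 / p') * enn_powr ?X (1 / q') = ?X"
          using 3 enn_powr_add[of "1 / p'" "1 / q'" ?X] by simp
        also have "?X * enn_powr (P i) (1 / p') * enn_powr (R j) (1 / q') \<le>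
            ?Ci i j * enn_powr (P i) (1 / p') * enn_powr (R j) (1 / q')"
        proof (intro mult_right_mono)
          have c: "1 / conj_exp p = ennreal (1 / q')"
          proof -
            have "1 - 1 / p' = 1 / q'" using 3(5) by simp
            then show ?thesis using 3 conj_exp_ennreal[OF 3(3)] by (simp add: divide_ennreal flip: ennreal_1)
          qed
          have d: "1 / p = ennreal (1 / p')" using 3 by (simp add: divide_ennreal flip: ennreal_1)
          show "?X \<le> ?Ci i j"
            unfolding C_pair_infinity_def c d S_def[symmetric]
            using Holder_le[of "1 / p'" "1 / q'" i j] 3(3-5) by simp
        qed auto
        finally show "?pg i j v \<le> ?Ci i j * enn_powr (P i) (1 / p') * enn_powr (R j) (1 / q')" .
      qed
      also have "\<dots> \<le> K * (ennreal (real CARD('i) powr (1 - 1 / p')) * ?NF) * (ennreal (real CARD('i) powr (1 - 1 / q')) * ?NG)"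
        unfolding NF NG using 3 by (intro mult_mono sum_root_le_root_sum order_refl) auto
      also have "\<dots> = (ennreal (real CARD('i) powr (1 - 1 / p')) * ennreal (real CARD('i) powr (1 - 1 / q'))) * K * ?NF * ?NG"
        by (simp only: mult_ac)
      also have "ennreal (real CARD('i) powr (1 - 1 / p')) * ennreal (real CARD('i) powr (1 - 1 / q')) = of_nat CARD('i)"
      proof -
        have "(1 - 1 / p') + (1 - 1 / q') = 1" using 3(5) by simp
        then have "real CARD('i) powr (1 - 1 / p') * real CARD('i) powr (1 - 1 / q') = real CARD('i)"
          by (simp only: powr_add[symmetric]) simp
        then show ?thesis by (simp only: ennreal_mult[symmetric] powr_ge_zero ennreal_of_nat_eq_real_of_nat)
      qed
      finally have "Lnorm m r 0 (gain m B F G) \<le> of_nat CARD('i) * K * ?NF * ?NG" .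
      moreover have "1 < p" "p < \<infinity>" using 3 by (auto simp: ennreal_less_iff simp flip: ennreal_1)
      ultimately show ?thesis unfolding C_gain using True by simp
    qed
  qed
qed

end
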